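(* Consider the $K$-tier network model described in the context, with noise power $W\ge 0$ and target SINR $\beta>0$, and let $\mathcal O_k=\mathbb P\{\mathrm{SINR}_k<\beta\}$ be the outage probability of a typical user associated with tier $k$. Let $\sigma_k=\beta W/P_k$, $\tau_{j,k}=\beta/(M_{j,k}B_{j,k})$, $$\varphi_{j,k}(0)=\frac{\delta_j\tau_{j,k}\,{}_2F_1(1,1-\delta_j;2-\delta_j;-\tau_{j,k})}{1-\delta_j},\qquad \varphi_{j,k}(n)=\frac{\delta_j\tau_{j,k}^n\,{}_2F_1(n+1,n-\delta_j;n+1-\delta_j;-\tau_{j,k})}{n-\delta_j}\ (n\ge1),$$ and for $x>0$ let $g_{k,n}(x)=\sum_{j=1}^K\mathcal A_j\lambda_j\Omega_{j,k}^{\delta_j}\varphi_{j,k}(n)\,x^{\delta_{j,k}}$. Let $\mathbf Q_{M_k}(x)$ be the $M_k\times M_k$ lower triangular Toeplitz matrix with zero diagonal whose $(p,q)$ entry is $g_{k,p-q}(x)$ for $p>q$ (and $0$ for $p\le q$), and write $\mathbf Q^i_{M_k}(x)(p,q)$ for the $(p,q)$ entry of its $i$-th power. Then $$\mathcal O_k=1-\frac{\lambda_k}{\mathcal T_k}\sum_{i=0}^{M_k-1}\sum_{m=0}^{M_k-1}\sum_{n=0}^{m}\int_0^{R_k^2}\frac{\pi^{i+1}\sigma_k^{m-n}}{(m-n)!\,i!}x^{\frac{\alpha_k}{2}(m-n)}\exp\Big(-\sigma_kx^{\alpha_k/2}-\pi g_{k,0}(x)-\pi\sum_{j=1}^K\lambda_j\Omega_{j,k}^{\delta_j}x^{\delta_{j,k}}\Big)\mathbf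 Q^i_{M_k}(x)(n+1,1)\,dx.$$ Moreover, if $\alpha_j=\alpha$ for all $j$ (so $\delta_j=\delta$), let $\Lambda=\sum_j\lambda_j\Omega_j^\delta$, $\theta_{k,n}=\sum_{j=1}^K\mathcal A_j\lambda_j\Omega_{j,k}^{\delta}\varphi_{j,k}(n)$, $\mathbf\Theta_{M_k}$ the $M_k\times M_k$ lower triangular Toeplitz matrix with zero diagonal and $(p,q)$ entry $\theta_{k,p-q}$ for $p>q$, $\mathcal Z_k=\theta_{k,0}+\Lambda/\Omega_k^{\delta}$, and $\mathcal Q_k(i,m,n)=\int_0^{R_k^2}x^{i+\frac{\alpha}{2}(m-n)}e^{-\sigma_kx^{\alpha/2}-\pi\mathcal Z_kx}dx$. Then $$\mathcal O_k=1-\frac{\lambda_k}{\mathcal T_k}\sum_{i=0}^{M_k-1}\sum_{m=0}^{M_k-1}\sum_{n=0}^{m}\frac{\pi^{i+1}\sigma_k^{m-n}\mathcal Q_k(i,m,n)}{i!\,(m-n)!}\mathbf\Theta^i_{M_k}(n+1,1).$$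
   Context: Network model: $\mathcal K=\{1,\dots,K\}$. In $\mathbb R^2$, tier-$k$ base stations (BSs) form a homogeneous PPP of intensity $\lambda_k>0$ and users a homogeneous PPP of intensity $\lambda_u>0$, all independent. Tier-$k$ BSs have transmit power $P_k>0$, $M_k\in\mathbb N$ antennas, biasing factor $B_k>0$, and path-loss exponent $\alpha_k>2$. Notation: $\Omega_k=P_kM_kB_k$, $\delta_k=2/\alpha_k$, and $\mathcal V_{j,k}=\mathcal V_j/\mathcal V_k$ for $\mathcal V\in\{P,M,B,\Omega,\delta\}$. An access threshold $\epsilon>0$ is fixed and $R_k=(\Omega_k/\epsilon)^{1/\alpha_k}$. Association: for a user at the origin with $D_k$ the distance to the nearest tier-$k$ BS, set $\hat\rho_k=\Omega_kD_k^{-\alpha_k}$ if $D_k\le R_k$, else $0$; the user is associated with (the nearest BS of) tier $k$ iff $\hat\rho_k>\hat\rho_j$ for all $j\neq k$, and $\mathcal T_k$ is the probability of this event (it equals $\pi\lambda_k\int_0^{R_k^2}\exp(-\pi\sum_{j}\lambda_j\Omega_{j,k}^{\delta_j}r^{\delta_{j,k}})dr$). Activation: the activation probability of tier $j$ is $\mathcal A_j=1-\exp\big(-\pi\lambda_u\int_0^{R_j^2}\exp(-\pi\sum_{l=1}^K\lambda_l\Omega_{l,j}^{\delta_l}r^{\delta_{l,j}})dr\big)$, and active tier-$j$ BSs are modeled as a homogeneous PPP of intensity $\mathcal A_j\lambda_j$. SINR model: conditional on association with tier $k$, the distance $X_k$ to the serving BS has density $f_{X_k}(x)=\frac{2\pi\lambda_k}{\mathcal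 T_k}x\exp(-\pi\sum_j\lambda_j\Omega_{j,k}^{\delta_j}x^{2\delta_{j,k}})$ for $0<x\le R_k$ (and $0$ otherwise). Given $X_k$, the interfering BSs of tier $j$ are the points of independent homogeneous PPPs $\Phi_j^o$ of intensity $\mathcal A_j\lambda_j$ lying outside the disk centred at the user of radius $r_{j,k}=\Omega_{j,k}^{1/\alpha_j}X_k^{\alpha_k/\alpha_j}$. The serving BS uses maximum ratio transmission, so the signal gain $\|\mathbf h\|^2\sim\mathrm{Gamma}(M_k,1)$; an interferer of tier $j$ at distance $r$ contributes $P_jVr^{-\alpha_j}$ with $V\sim\mathrm{Exp}(1)$; all fading variables are independent of each other and of the point processes. $I_o$ is the total interference and $\mathrm{SINR}_k=P_k\|\mathbf h\|^2X_k^{-\alpha_k}/(I_o+W)$. ${}_2F_1$ is the Gauss hypergeometric function. *)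

theory Defs
  imports "HOL-Probability.Probability" "Jordan_Normal_Form.Matrix"
begin

definition hyp2f1_series :: "real \<Rightarrow> real \<Rightarrow> real \<Rightarrow> real \<Rightarrow> real" where
  "hyp2f1_series a b c z =
     (\<Sum>n. pochhammer a n * pochhammer b n / (pochhammer c n * fact n) * z ^ n)"

text \<open>The (real) Gauss hypergeometric function 2F1(a,b;c;z): the Gauss series for
  abs z < 1, and its analytic continuation to z \<le> -1 given by the Pfaff transformation
  2F1(a,b;c;z) = (1-z) powr (-a) * 2F1(a,c-b;c;z/(z-1)), where z/(z-1) lies in [1/2,1).\<close>
definition hyp2f1 :: "real \<Rightarrow> real \<Rightarrow> real \<Rightarrow> real \<Rightarrow> real" where
  "hyp2f1 a b c z =
     (if z \<le> -1 then (1 - z) powr (- a) * hyp2f1_series a (c - b) c (z / (z - 1))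
      else hyp2f1_series a b c z)"

definition pp_count :: "'a set \<Rightarrow> 'a set \<Rightarrow> ennreal" where
  "pp_count C A = emeasure (count_space UNIV) (C \<inter> A)"

definition cfg_space :: "'a measure \<Rightarrow> 'a set measure" where
  "cfg_space N = sigma {C. C \<subseteq> space N}
     {{C. C \<subseteq> space N \<and> pp_count C A \<le> of_nat n} | A n. A \<in> sets N}"

definition poisson_point_process :: "'w measure \<Rightarrow> 'a measure \<Rightarrow> ('w \<Rightarrow> 'a set) \<Rightarrow> bool" where
  "poisson_point_process Pr N Phi \<longleftrightarrow>
     prob_space Pr \<and>
     Phi \<in> measurable Pr (cfg_space N) \<and>
     (\<forall>A \<in> sets N. emeasure N A < \<infinity> \<longrightarrow>
        (\<forall>n::nat. measure Pr {w \<in> space Pr. pp_count (Phi w) A = of_nat n}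
                   = exp (- measure N A) * measure N A ^ n / fact n)) \<and>
     (\<forall>(n::nat) (A :: nat \<Rightarrow> 'a set).
        (\<forall>i<n. A i \<in> sets N \<and> emeasure N (A i) < \<infinity>) \<longrightarrow>
        (\<forall>i<n. \<forall>j<n. i \<noteq> j \<longrightarrow> A i \<inter> A j = {}) \<longrightarrow>
        prob_space.indep_vars Pr (\<lambda>_. borel) (\<lambda>i w. pp_count (Phi w) (A i)) {..<n})"

end

theory Submission
  imports Defs
    "HOL-Complex_Analysis.Cauchy_Integral_Formula"
begin

text \<open>
  Given \<^term>\<open>X = x\<close>, the Erlang tail turns the coverage event into an expectation of Poisson weights
  \<^term>\<open>t ^ m / fact m * exp (- t)\<close> at the scaled interference plus noise. The generating function of
  these weights in \<open>u\<close> is the Laplace transform of the interference \<open>J\<close> at \<open>1 - u\<close>, which the Laplace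
  functional of the Poisson processes evaluates to \<open>exp (- \<pi> g\<^sub>0 + \<pi> (\<Sum>n\<ge>1. g\<^sub>n u\<^sup>n))\<close>: under
  exponential fading an interferer with mean gain \<open>c\<close> contributes
  \<open>1 - 1 / (1 + (1 - u) c) = c / (1 + c) - (\<Sum>n\<ge>1. c\<^sup>n / (1 + c)\<^sup>n\<^sup>+\<^sup>1 u\<^sup>n)\<close>, and integrating over the
  plane gives Euler integrals of hypergeometric type. Comparing coefficients of \<open>u\<^sup>n\<close> replaces the
  differentiation of the Laplace transform, and powers of the power series are powers of the
  Toeplitz matrix.
\<close>

text \<open>Expectations are taken in \<open>ennreal\<close>: the interference is a sum over a
  possibly infinite configuration and may be infinite, and nonnegativity turns every exchange of sum
  and integral into Tonelli. The generating function is therefore inspected only for 0 < u < 1,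
  where 1 - u > 0 and all coefficients are nonnegative; equality on that interval already fixes
  them. The constants come from scaling by s = \<beta> x^\<alpha>_k / P_k. A tier-j interferer on
  the boundary of its exclusion disc has scaled mean gain s P_j r_{j,k}^(-\<alpha>_j) = \<beta>
  P_{j,k} / \<Omega>_{j,k} = \<tau>_{j,k}, independently of x. All dependence on x thus sits in the
  disc area \<pi> r_{j,k}^2 = \<pi> \<Omega>_{j,k}^\<delta>_j (x^2)^\<delta>_{j,k}, which is why x^2
  is the final integration variable. The obstacle in conditioning is that the exclusion radius
  depends on X, so the interference is not a function of the point processes alone. It is treated as
  a jointly measurable function of a deterministic distance and the outcome, and independence enters
  through sub-\<sigma>-algebras.\<close>

hide_const (open) Order.top

section \<open>Laplace functional of a Poisson point process\<close>

text \<open>The map t to e^(-t) on the extended half line. The value 0 at infinity is the continuous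
  extension, so a configuration with infinite total contributes nothing to a Laplace
  transform.\<close>

definition exp_neg :: "ennreal \<Rightarrow> ennreal" where
  "exp_neg t = (if t = \<infinity> then 0 else ennreal (exp (- enn2real t)))"

lemma exp_neg_simps [simp]:
  "exp_neg \<infinity> = 0" "exp_neg top = 0" "0 \<le> r \<Longrightarrow> exp_neg (ennreal r) = ennreal (exp (- r))" "exp_neg 0 = 1"
  by (auto simp: exp_neg_def)

lemma exp_neg_le_1: "exp_neg t \<le> 1"
  by (auto simp: exp_neg_def)

lemma measurable_exp_neg [measurable]: "exp_neg \<in> borel_measurable borel"
  unfolding exp_neg_def[abs_def] by measurable

lemma exp_neg_add: "exp_neg (a + b) = exp_neg a * exp_neg b"
proof (cases "a = \<infinity> \<or> b = \<infinity>")
  case False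
  then obtain r s where "a = ennreal r" "0 \<le> r" "b = ennreal s" "0 \<le> s"
    by (metis ennreal_cases infinity_ennreal_def)
  then show ?thesis
    by (simp flip: ennreal_plus ennreal_mult add: exp_diff exp_minus field_simps)
qed auto

lemma exp_neg_sum: "exp_neg (\<Sum>i\<in>A. f i) = (\<Prod>i\<in>A. exp_neg (f i))"
  by (induction A rule: infinite_finite_induct) (auto simp: exp_neg_add)

text \<open>The order-reversing adjunction between \<open>exp_neg\<close> and -ln. It lets suprema
  pass to infima in \<open>exp_neg_SUP\<close> by an order argument alone.\<close>

lemma le_exp_neg_iff:
  assumes "0 < l" "l \<le> 1"
  shows "ennreal l \<le> exp_neg a \<longleftrightarrow> a \<le> ennreal (- ln l)"
proof (cases a)
  case (real r)
  then have "ennreal l \<le> exp_neg a \<longleftrightarrow> l \<le> exp (- r)" by simp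
  also have "\<dots> \<longleftrightarrow> r \<le> - ln l"
    using ln_le_cancel_iff[of l "exp (- r)"] assms(1) by force
  finally show ?thesis using real assms by simp
qed (use assms in \<open>auto simp: top_unique\<close>)

lemma exp_neg_antimono: "a \<le> b \<Longrightarrow> exp_neg b \<le> exp_neg a"
  by (cases a; cases b) (auto simp: top_unique)

lemma exp_neg_SUP:
  assumes "I \<noteq> {}"
  shows "exp_neg (SUP i\<in>I. f i) = (INF i\<in>I. exp_neg (f i))"
proof (rule antisym)
  show "exp_neg (SUP i\<in>I. f i) \<le> (INF i\<in>I. exp_neg (f i))"
    by (intro INF_greatest exp_neg_antimono SUP_upper)
  show "(INF i\<in>I. exp_neg (f i)) \<le> exp_neg (SUP i\<in>I. f i)"
  proof (cases "(INF i\<in>I. exp_neg (f i)) = 0")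
    case False
    have "(INF i\<in>I. exp_neg (f i)) \<le> 1"
      using assms by (metis INF_lower2 exp_neg_le_1 ex_in_conv)
    then obtain l where l: "(INF i\<in>I. exp_neg (f i)) = ennreal l" "0 < l" "l \<le> 1"
      using False by (cases "INF i\<in>I. exp_neg (f i)") (auto simp: top_unique less_le)
    have "f i \<le> ennreal (- ln l)" if "i \<in> I" for i
      using INF_lower[OF that, of "\<lambda>i. exp_neg (f i)"] l le_exp_neg_iff[of l "f i"] by simp
    then have "(SUP i\<in>I. f i) \<le> ennreal (- ln l)" by (rule SUP_least)
    then show ?thesis using l le_exp_neg_iff[of l "SUP i\<in>I. f i"] by simp
  qed simp
qed

section \<open>Counts and sums over configurations as measurable functions\<close>

lemma pp_count_nn_integral:
  "pp_count C A = (\<integral>\<^sup>+p. indicator A p \<partial>count_space C)"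
proof -
  have "(\<integral>\<^sup>+p. indicator A p \<partial>count_space C) = (\<integral>\<^sup>+p. indicator (A \<inter> C) p \<partial>count_space C)"
    by (intro nn_integral_cong) (auto simp: indicator_def)
  also have "\<dots> = emeasure (count_space C) (A \<inter> C)"
    by (intro nn_integral_indicator) auto
  also have "\<dots> = emeasure (count_space UNIV) (A \<inter> C)"
    by (cases "finite (A \<inter> C)") (auto simp: emeasure_count_space)
  finally show ?thesis by (simp add: pp_count_def Int_commute)
qed

lemma pp_count_cases: "pp_count C A = \<infinity> \<or> (\<exists>n::nat. pp_count C A = of_nat n)"
  by (cases "finite (C \<inter> A)") (auto simp: pp_count_def)

lemma space_cfg_space [simp]: "space (cfg_space N) = {C. C \<subseteq> space N}"
  by (auto simp: cfg_space_def intro!: space_measure_of)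

lemma measurable_pp_count [measurable]:
  assumes "A \<in> sets N"
  shows "(\<lambda>C. pp_count C A) \<in> borel_measurable (cfg_space N)"
proof (rule borel_measurableI_le)
  fix y :: ennreal
  have gen: "{C. C \<subseteq> space N \<and> pp_count C A \<le> of_nat n} \<in> sets (cfg_space N)" for n
    using assms by (auto simp: cfg_space_def intro!: sets_measure_of[THEN equalityD2, THEN subsetD])
  show "{C \<in> space (cfg_space N). pp_count C A \<le> y} \<in> sets (cfg_space N)"
  proof (cases y)
    case (real r)
    \<comment> \<open>The generators of \<open>cfg_space\<close> provide integer levels only. Since
      a count is an integer or infinite, a real level may be replaced by its floor.\<close>
    have "pp_count C A \<le> y \<longleftrightarrow> pp_count C A \<le> of_nat (nat \<lfloor>r\<rfloor>)" for C
      using pp_count_cases[of C A]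
    proof
      assume "\<exists>n::nat. pp_count C A = of_nat n"
      then obtain n :: nat where n: "pp_count C A = of_nat n" by auto
      have "ennreal (real n) \<le> ennreal r \<longleftrightarrow> real n \<le> r" using real by simp
      also have "\<dots> \<longleftrightarrow> n \<le> nat \<lfloor>r\<rfloor>" using real by linarith
      finally show ?thesis using n real by (simp only: ennreal_of_nat_eq_real_of_nat ennreal_le_iff of_nat_0_le_iff of_nat_le_iff)
    qed (use real in \<open>auto simp: top_unique\<close>)
    then show ?thesis using gen by simp
  next
    case top
    then show ?thesis using sets.top[of "cfg_space N"] by simp
  qed
qed

lemma measurable_nn_integral_cfg [measurable]:
  fixes f :: "'a \<Rightarrow> ennreal"
  assumes "f \<in> borel_measurable N"
  shows "(\<lambda>C. \<integral>\<^sup>+p. f p \<partial>count_space C) \<in> borel_measurable (cfg_space N)"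
  using assms
proof (induction rule: borel_measurable_induct)
  case (cong f g)
  have "(\<integral>\<^sup>+p. f p \<partial>count_space C) = (\<integral>\<^sup>+p. g p \<partial>count_space C)" if "C \<in> space (cfg_space N)" for C
    using that cong(3) by (intro nn_integral_cong) auto
  then show ?case using cong(4) by (subst measurable_cong)
next
  case (set A)
  then show ?case by (simp add: pp_count_nn_integral[symmetric] measurable_pp_count)
next
  case (mult u c)
  then show ?case by (simp add: nn_integral_cmult)
next
  case (add u v)
  then show ?case by (simp add: nn_integral_add)
next
  case (seq U)
  then show ?case by (simp add: nn_integral_monotone_convergence_SUP image_comp)
qed

text \<open>The masses at the integers sum to 1, so the count is almost surely finite and the
  expectation splits over its values into an exponential series. Nothing beyond these masses is
  assumed about the law of the count.\<close>

lemma laplace_poisson_count: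
  assumes "prob_space Pr" "C \<in> borel_measurable Pr" "0 \<le> m"
    and pois: "\<And>n::nat. measure Pr {w \<in> space Pr. C w = of_nat n} = exp (- m) * m ^ n / fact n"
    and "0 \<le> c"
  shows "(\<integral>\<^sup>+w. exp_neg (ennreal c * C w) \<partial>Pr) = ennreal (exp (- (m * (1 - exp (- c)))))"
proof -
  interpret prob_space Pr by fact
  note [measurable] = assms(2)
  define E where "E n = {w \<in> space Pr. C w = of_nat n}" for n :: nat
  have E [measurable]: "E n \<in> sets Pr" for n unfolding E_def by measurable
  have exps: "(\<lambda>n. exp (- m) * x ^ n / fact n) sums exp (x - m)" for x
    using sums_mult[OF exp_converges[of x], of "exp (-m)"]
    by (simp add: divide_inverse ac_simps exp_diff exp_minus)
  have disj: "disjoint_family E"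
    by (auto simp: disjoint_family_on_def E_def)
  have "(\<Sum>n. emeasure Pr (E n)) = (\<Sum>n. ennreal (exp (- m) * m ^ n / fact n))"
    by (simp add: emeasure_eq_measure pois E_def)
  also have "\<dots> = ennreal 1"
    using exps[of m] assms(3) by (intro suminf_ennreal_eq) auto
  finally have "emeasure Pr (\<Union>n. E n) = 1"
    using disj E by (subst suminf_emeasure[symmetric]) auto
  then have AE: "AE w in Pr. w \<in> (\<Union>n. E n)"
    by (intro AE_prob_1) (simp_all add: emeasure_eq_measure)
  have "(\<integral>\<^sup>+w. exp_neg (ennreal c * C w) \<partial>Pr) = (\<integral>\<^sup>+w. (\<Sum>n. ennreal (exp (- c * n)) * indicator (E n) w) \<partial>Pr)"
  proof (rule nn_integral_cong_AE, use AE in eventually_elim)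
    fix w assume "w \<in> (\<Union>n. E n)"
    then obtain n where n: "w \<in> E n" by auto
    have "(\<Sum>i. ennreal (exp (- c * i)) * indicator (E i) w) = (\<Sum>i\<in>{n}. ennreal (exp (- c * i)) * indicator (E i) w)"
      using disj n by (intro suminf_finite) (auto simp: disjoint_family_on_def indicator_def)
    also have "\<dots> = exp_neg (ennreal c * C w)"
      using n \<open>0 \<le> c\<close> by (simp add: E_def ennreal_of_nat_eq_real_of_nat flip: ennreal_mult)
    finally show "exp_neg (ennreal c * C w) = (\<Sum>n. ennreal (exp (- c * n)) * indicator (E n) w)" by simp
  qed
  also have "\<dots> = (\<Sum>n. \<integral>\<^sup>+w. ennreal (exp (- c * n)) * indicator (E n) w \<partial>Pr)"
    by (intro nn_integral_suminf) auto
  also have "\<dots> = (\<Sum>n. ennreal (exp (- m) * (m * exp (- c)) ^ n / fact n))"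
    using assms(3) by (intro suminf_cong)
      (simp add: nn_integral_cmult emeasure_eq_measure pois E_def power_mult_distrib ac_simps
         flip: ennreal_mult exp_of_nat_mult)
  also have "\<dots> = ennreal (exp (m * exp (- c) - m))"
    using exps[of "m * exp (- c)"] assms(3) by (intro suminf_ennreal_eq) auto
  finally show ?thesis by (simp add: algebra_simps)
qed

context
  fixes Pr :: "'w measure" and N :: "'a measure" and Phi :: "'w \<Rightarrow> 'a set"
  assumes ppp: "poisson_point_process Pr N Phi"
begin

lemma ppp_prob_space: "prob_space Pr"
  and measurable_ppp [measurable]: "Phi \<in> measurable Pr (cfg_space N)"
  using ppp by (auto simp: poisson_point_process_def)

lemma ppp_subset: "w \<in> space Pr \<Longrightarrow> Phi w \<subseteq> space N"
  using measurable_space[OF measurable_ppp] by auto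

text \<open>The sum over the configuration is a linear combination of counts in the level sets of
  \<open>f\<close>. These sets are disjoint, so the counts are independent; they lie in
  \<open>A\<close>, hence have finite intensity and the counts are Poisson.\<close>

lemma ppp_laplace_simple:
  fixes f :: "'a \<Rightarrow> ennreal"
  assumes f: "simple_function N f" "\<And>p. f p < top"
    and supp: "A \<in> sets N" "emeasure N A < \<infinity>" "\<And>p. p \<in> space N - A \<Longrightarrow> f p = 0"
  shows "(\<integral>\<^sup>+w. exp_neg (\<integral>\<^sup>+p. f p \<partial>count_space (Phi w)) \<partial>Pr) = exp_neg (\<integral>\<^sup>+p. 1 - exp_neg (f p) \<partial>N)"
proof -
  interpret prob_space Pr by (rule ppp_prob_space)
  \<comment> \<open>The value 0 is dropped because its level set contains the complement of
    \<open>A\<close>, whose intensity may be infinite.\<close>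
  define S where "S = f ` space N - {0}"
  have "finite S" using simple_functionD(1)[OF f(1)] by (auto simp: S_def)
  then obtain n :: nat and y where y: "bij_betw y {..<n} S"
    using ex_bij_betw_nat_finite[of S] by (auto simp: lessThan_atLeast0)
  define D where "D i = f -` {y i} \<inter> space N" for i
  have yS: "y i \<in> S" if "i < n" for i using y that by (auto simp: bij_betw_def)
  have yfin: "y i < top" if "i < n" for i using yS[OF that] f(2) by (auto simp: S_def)
  have D_sets: "D i \<in> sets N" for i using simple_functionD(2)[OF f(1)] by (simp add: D_def)
  have D_fin: "emeasure N (D i) < \<infinity>" if "i < n" for i
  proof -
    have "D i \<subseteq> A"
    proof
      fix p assume "p \<in> D i"
      then have "p \<in> space N" "f p \<noteq> 0" using yS[OF that] by (auto simp: D_def S_def)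
      then show "p \<in> A" using supp(3)[of p] by auto
    qed
    then have "emeasure N (D i) \<le> emeasure N A" using supp(1) by (rule emeasure_mono)
    then show ?thesis using supp(2) by simp
  qed
  have D_disj: "D i \<inter> D j = {}" if "i < n" "j < n" "i \<noteq> j" for i j
    using y that by (auto simp: D_def bij_betw_def inj_on_def)
  \<comment> \<open>Used twice: with the identity for the sum over the configuration, and with h x =
    1 - \<open>exp_neg x\<close> for the integrand of the exponent.\<close>
  have rep_gen: "h (f p) = (\<Sum>i<n. h (y i) * indicator (D i) p)" if p: "p \<in> space N" and "h 0 = 0"
    for p and h :: "ennreal \<Rightarrow> ennreal"
  proof (cases "f p = 0")
    case True
    then have "p \<notin> D i" if "i < n" for i using yS[OF that] by (auto simp: D_def S_def)
    then show ?thesis using \<open>h 0 = 0\<close> True by simp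
  next
    case False
    then have "f p \<in> y ` {..<n}" using y p by (simp add: bij_betw_def S_def)
    then obtain i where i: "i < n" "y i = f p" by auto
    have "(\<Sum>j<n. h (y j) * indicator (D j) p) = (\<Sum>j\<in>{i}. h (y j) * indicator (D j) p)"
      using i y by (intro sum.mono_neutral_right) (auto simp: indicator_def D_def bij_betw_def inj_on_def)
    then show ?thesis using i p by (simp add: D_def)
  qed
  have "(\<integral>\<^sup>+w. exp_neg (\<integral>\<^sup>+p. f p \<partial>count_space (Phi w)) \<partial>Pr)
      = (\<integral>\<^sup>+w. (\<Prod>i<n. exp_neg (y i * pp_count (Phi w) (D i))) \<partial>Pr)"
  proof (rule nn_integral_cong)
    fix w assume "w \<in> space Pr"
    then have "(\<integral>\<^sup>+p. f p \<partial>count_space (Phi w)) = (\<integral>\<^sup>+p. (\<Sum>i<n. y i * indicator (D i) p) \<partial>count_space (Phi w))"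
      using ppp_subset rep_gen[of _ "\<lambda>x. x"] by (intro nn_integral_cong) auto
    also have "\<dots> = (\<Sum>i<n. y i * pp_count (Phi w) (D i))"
      by (subst nn_integral_sum) (simp_all add: nn_integral_cmult pp_count_nn_integral)
    finally show "exp_neg (\<integral>\<^sup>+p. f p \<partial>count_space (Phi w)) = (\<Prod>i<n. exp_neg (y i * pp_count (Phi w) (D i)))"
      by (simp add: exp_neg_sum)
  qed
  also have "\<dots> = (\<Prod>i<n. \<integral>\<^sup>+w. exp_neg (y i * pp_count (Phi w) (D i)) \<partial>Pr)"
  proof (rule indep_vars_nn_integral)
    have "indep_vars (\<lambda>_. borel) (\<lambda>i w. pp_count (Phi w) (D i)) {..<n}"
      using ppp D_sets D_fin D_disj by (simp add: poisson_point_process_def)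
    then show "indep_vars (\<lambda>_. borel) (\<lambda>i w. exp_neg (y i * pp_count (Phi w) (D i))) {..<n}"
      by (rule indep_vars_compose2) auto
  qed auto
  also have "\<dots> = (\<Prod>i<n. exp_neg ((1 - exp_neg (y i)) * emeasure N (D i)))"
  proof (rule prod.cong)
    fix i assume "i \<in> {..<n}"
    then have i: "i < n" by simp
    obtain c where c: "y i = ennreal c" "0 \<le> c" using yfin[OF i] by (cases "y i") auto
    have fin: "emeasure N (D i) = ennreal (measure N (D i))"
      using D_fin[OF i] by (intro emeasure_eq_ennreal_measure) auto
    have [measurable]: "D i \<in> sets N" by (rule D_sets)
    have "(\<integral>\<^sup>+w. exp_neg (ennreal c * pp_count (Phi w) (D i)) \<partial>Pr) =
        ennreal (exp (- (measure N (D i) * (1 - exp (- c)))))"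
      using ppp D_sets D_fin[OF i] c
      by (intro laplace_poisson_count) (auto simp: poisson_point_process_def)
    also have "\<dots> = exp_neg ((1 - exp_neg (y i)) * emeasure N (D i))"
      using c by (simp add: fin ennreal_minus mult.commute flip: ennreal_1 ennreal_mult)
    finally show "(\<integral>\<^sup>+w. exp_neg (y i * pp_count (Phi w) (D i)) \<partial>Pr) = exp_neg ((1 - exp_neg (y i)) * emeasure N (D i))"
      using c by simp
  qed simp
  also have "\<dots> = exp_neg (\<Sum>i<n. (1 - exp_neg (y i)) * emeasure N (D i))"
    by (simp add: exp_neg_sum)
  also have "(\<Sum>i<n. (1 - exp_neg (y i)) * emeasure N (D i)) = (\<integral>\<^sup>+p. (\<Sum>i<n. (1 - exp_neg (y i)) * indicator (D i) p) \<partial>N)"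
    using D_sets by (subst nn_integral_sum) (simp_all add: nn_integral_cmult)
  also have "\<dots> = (\<integral>\<^sup>+p. 1 - exp_neg (f p) \<partial>N)"
    using rep_gen[of _ "\<lambda>x. 1 - exp_neg x"] by (intro nn_integral_cong) auto
  finally show ?thesis .
qed

text \<open>Simple functions increasing to \<open>f\<close>, each cut off to a set of finite
  intensity, reduce this to \<open>ppp_laplace_simple\<close>. The left side decreases along the
  sequence and is bounded by 1, the exponent on the right increases, so monotone convergence applies
  on both sides.\<close>

theorem ppp_laplace_functional:
  fixes f :: "'a \<Rightarrow> ennreal"
  assumes "sigma_finite_measure N" and f [measurable]: "f \<in> borel_measurable N"
  shows "(\<integral>\<^sup>+w. exp_neg (\<integral>\<^sup>+p. f p \<partial>count_space (Phi w)) \<partial>Pr) = exp_neg (\<integral>\<^sup>+p. 1 - exp_neg (f p) \<partial>N)"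
proof -
  interpret prob_space Pr by (rule ppp_prob_space)
  interpret N: sigma_finite_measure N by fact
  obtain A :: "nat \<Rightarrow> 'a set" where A: "range A \<subseteq> sets N" "(\<Union>i. A i) = space N"
      "\<And>i. emeasure N (A i) \<noteq> \<infinity>" "incseq A"
    by (rule N.sigma_finite_incseq) blast
  have [measurable]: "A i \<in> sets N" for i using A(1) by auto
  obtain F where F: "\<And>i. simple_function N (F i)" "incseq F" "\<And>i x. F i x < top" "\<And>x. (SUP i. F i x) = f x"
    by (rule borel_measurable_implies_simple_function_sequence'[OF f]) blast
  define U where "U i p = F i p * indicator (A i) p" for i p
  have U_simple: "simple_function N (U i)" for i
    unfolding U_def using F(1) by (intro simple_function_mult simple_function_indicator) auto
  then have U_meas [measurable]: "U i \<in> borel_measurable N" for i by (rule borel_measurable_simple_function)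
  have U_inc: "incseq U"
    unfolding incseq_def le_fun_def U_def
  proof (intro allI impI mult_mono)
    fix i j p assume "i \<le> (j::nat)"
    show "F i p \<le> F j p" using incseqD[OF F(2) \<open>i \<le> j\<close>] by (simp add: le_fun_def)
    show "(indicator (A i) p :: ennreal) \<le> indicator (A j) p"
      using incseqD[OF A(4) \<open>i \<le> j\<close>] by (auto simp: indicator_def)
  qed auto
  have U_SUP: "(SUP i. U i p) = f p" if "p \<in> space N" for p
  proof (rule antisym)
    show "(SUP i. U i p) \<le> f p"
      unfolding F(4)[symmetric] by (intro SUP_mono) (auto simp: U_def indicator_def)
    obtain k where k: "p \<in> A k" using A(2) \<open>p \<in> space N\<close> by auto
    have "F i p \<le> U (max i k) p" for i
      using k F(2) A(4) incseqD[OF A(4), of k "max i k"] incseqD[OF F(2), of i "max i k"]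
      by (auto simp: U_def le_fun_def)
    then show "f p \<le> (SUP i. U i p)"
      unfolding F(4)[symmetric] by (intro SUP_mono) blast
  qed
  have simp: "(\<integral>\<^sup>+w. exp_neg (\<integral>\<^sup>+p. U i p \<partial>count_space (Phi w)) \<partial>Pr) = exp_neg (\<integral>\<^sup>+p. 1 - exp_neg (U i p) \<partial>N)" for i
    using A F by (intro ppp_laplace_simple[where A="A i"] U_simple)
      (auto simp: U_def indicator_def less_top)
  have "(\<integral>\<^sup>+w. exp_neg (\<integral>\<^sup>+p. f p \<partial>count_space (Phi w)) \<partial>Pr) =
      (\<integral>\<^sup>+w. (INF i. exp_neg (\<integral>\<^sup>+p. U i p \<partial>count_space (Phi w))) \<partial>Pr)"
  proof (rule nn_integral_cong)
    fix w assume w: "w \<in> space Pr"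
    have "(\<integral>\<^sup>+p. f p \<partial>count_space (Phi w)) = (\<integral>\<^sup>+p. (SUP i. U i p) \<partial>count_space (Phi w))"
      using ppp_subset[OF w] U_SUP by (intro nn_integral_cong) auto
    also have "\<dots> = (SUP i. \<integral>\<^sup>+p. U i p \<partial>count_space (Phi w))"
      using U_inc by (intro nn_integral_monotone_convergence_SUP) auto
    finally show "exp_neg (\<integral>\<^sup>+p. f p \<partial>count_space (Phi w)) = (INF i. exp_neg (\<integral>\<^sup>+p. U i p \<partial>count_space (Phi w)))"
      by (simp add: exp_neg_SUP)
  qed
  also have "\<dots> = (INF i. \<integral>\<^sup>+w. exp_neg (\<integral>\<^sup>+p. U i p \<partial>count_space (Phi w)) \<partial>Pr)"
  proof (rule nn_integral_monotone_convergence_INF_decseq)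
    show "decseq (\<lambda>i w. exp_neg (\<integral>\<^sup>+p. U i p \<partial>count_space (Phi w)))"
      using U_inc by (intro decseq_SucI le_funI exp_neg_antimono nn_integral_mono) (auto dest: incseq_SucD le_funD)
    show "(\<integral>\<^sup>+w. exp_neg (\<integral>\<^sup>+p. U 0 p \<partial>count_space (Phi w)) \<partial>Pr) < \<infinity>"
      unfolding simp using exp_neg_le_1 by (metis ennreal_one_less_top infinity_ennreal_def le_less_trans)
  qed measurable
  also have "\<dots> = exp_neg (SUP i. \<integral>\<^sup>+p. 1 - exp_neg (U i p) \<partial>N)"
    by (simp add: simp exp_neg_SUP)
  also have "(SUP i. \<integral>\<^sup>+p. 1 - exp_neg (U i p) \<partial>N) = (\<integral>\<^sup>+p. (SUP i. 1 - exp_neg (U i p)) \<partial>N)"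
    using U_inc by (intro nn_integral_monotone_convergence_SUP[symmetric])
      (auto simp: incseq_def le_fun_def intro!: ennreal_minus_mono exp_neg_antimono)
  also have "\<dots> = (\<integral>\<^sup>+p. 1 - exp_neg (f p) \<partial>N)"
    by (intro nn_integral_cong)
      (simp add: U_SUP[symmetric] exp_neg_SUP ennreal_INF_const_minus ennreal_SUP_const_minus)
  finally show ?thesis .
qed

end

section \<open>Poisson weights and independence\<close>

text \<open>The probability that a Poisson variable of mean t equals n. An infinite mean leaves no
  mass on any integer, hence the value 0 there.\<close>

definition poisson_weight :: "nat \<Rightarrow> ennreal \<Rightarrow> ennreal" where
  "poisson_weight n t = (if t = \<infinity> then 0 else ennreal (enn2real t ^ n / fact n * exp (- enn2real t)))"

lemma poisson_weight_simps [simp]: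
  "poisson_weight n \<infinity> = 0" "poisson_weight n top = 0"
  "0 \<le> r \<Longrightarrow> poisson_weight n (ennreal r) = ennreal (r ^ n / fact n * exp (- r))"
  by (auto simp: poisson_weight_def)

lemma measurable_poisson_weight [measurable]: "poisson_weight n \<in> borel_measurable borel"
  unfolding poisson_weight_def[abs_def] by measurable

text \<open>The strict bound u < 1 matters at t = \<infinity>, where 1 - u > 0 keeps the argument of
  \<open>exp_neg\<close> infinite and both sides equal to 0.\<close>

lemma poisson_weight_generating_function:
  assumes "0 \<le> u" "u < 1"
  shows "(\<Sum>n. ennreal (u ^ n) * poisson_weight n t) = exp_neg (ennreal (1 - u) * t)"
proof (cases t)
  case (real r)
  have "(\<lambda>n. u ^ n * (r ^ n / fact n * exp (- r))) sums (exp (u * r) * exp (- r))"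
    using sums_mult2[OF exp_converges[of "u * r"], of "exp (- r)"]
    by (simp add: divide_inverse ac_simps power_mult_distrib)
  also have "exp (u * r) * exp (- r) = exp (- ((1 - u) * r))"
    by (simp flip: exp_add add: algebra_simps)
  finally show ?thesis
    using real assms by (simp flip: ennreal_mult, intro suminf_ennreal_eq) auto
next
  case top
  then show ?thesis using assms by (simp add: ennreal_mult_top)
qed

lemma poisson_weight_le_1: "poisson_weight n t \<le> 1"
proof (cases t)
  case (real r)
  have "r ^ n / fact n \<le> exp r"
    using real sum_le_suminf[OF summable_exp[of r], of "{n}"] by (simp add: exp_def divide_inverse ac_simps scaleR_conv_of_real)
  then have "r ^ n / fact n * exp (- r) \<le> exp r * exp (- r)" by (intro mult_right_mono) auto
  then show ?thesis using real by (simp add: exp_minus)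
qed simp

text \<open>Poisson laws convolve, by the binomial theorem. Applied with \<open>a\<close> the scaled
  noise and \<open>b\<close> the scaled interference, it produces the inner sum over n \<le> m of
  the outage formula.\<close>

lemma poisson_weight_add:
  assumes "0 \<le> a"
  shows "poisson_weight m (b + ennreal a) = (\<Sum>n\<le>m. poisson_weight (m - n) (ennreal a) * poisson_weight n b)"
proof (cases b)
  case (real r)
  have "(r + a) ^ m / fact m = (\<Sum>n\<le>m. (a ^ (m - n) / fact (m - n)) * (r ^ n / fact n))"
    using binomial_ring[of r a m] by (simp add: sum_divide_distrib binomial_fact field_simps)
  then have "(r + a) ^ m / fact m * exp (- (r + a)) = (\<Sum>n\<le>m. (a ^ (m - n) / fact (m - n) * exp (- a)) * (r ^ n / fact n * exp (- r)))"
    by (simp add: sum_distrib_left sum_distrib_right exp_diff exp_minus mult_ac divide_inverse)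
  then show ?thesis
    using real assms by (simp flip: ennreal_plus ennreal_mult add: sum_ennreal)
qed simp

text \<open>The M-th arrival of a unit-rate Poisson process comes after time t iff fewer than M
  points arrive before t. A level t = \<infinity> is never reached, in agreement with the vanishing
  weights.\<close>

lemma erlang_tail:
  assumes "prob_space Pr" "distributed Pr lborel H (\<lambda>x. ennreal (erlang_density (M - 1) 1 x))" "1 \<le> M"
  shows "emeasure Pr {w \<in> space Pr. t \<le> ennreal (H w)} = (\<Sum>m<M. poisson_weight m t)"
proof (cases t)
  case (real r)
  interpret prob_space Pr by fact
  have [measurable]: "H \<in> borel_measurable Pr" using assms(2) by (simp add: distributed_def)
  have M: "{..<M} = {..M - 1}" using assms(3) by auto
  have eq: "(\<Sum>m<M. poisson_weight m t) = ennreal (1 - erlang_CDF (M - 1) 1 r)"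
    using real by (simp add: M erlang_CDF_def sum_ennreal)
  show ?thesis
  proof (cases "r = 0")
    \<comment> \<open>At level 0 the event is the whole space, because \<open>ennreal\<close> sends
      negative values of \<open>H\<close> to 0. For r > 0 the comparison becomes r \<le>
      \<open>H w\<close>, and the atom at r has mass 0.\<close>
    case True
    then show ?thesis unfolding eq using real by (simp add: emeasure_space_1 erlang_CDF_at0)
  next
    case False
    then have r: "0 < r" using real by simp
    have null: "emeasure Pr {w \<in> space Pr. H w = r} = 0"
    proof -
      have "emeasure Pr (H -` {r} \<inter> space Pr) = (\<integral>\<^sup>+x. ennreal (erlang_density (M - 1) 1 x) * indicator {r} x \<partial>lborel)"
        using assms(2) by (rule distributed_emeasure) auto
      also have "\<dots> = 0"
        using AE_lborel_singleton[of r] by (subst nn_integral_0_iff_AE) (auto elim!: eventually_mono simp: indicator_def)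
      finally show ?thesis by (simp add: vimage_def Int_def conj_commute)
    qed
    have "emeasure Pr {w \<in> space Pr. t \<le> ennreal (H w)} = emeasure Pr ({w \<in> space Pr. r < H w} \<union> {w \<in> space Pr. H w = r})"
      using real r by (intro arg_cong[where f="emeasure Pr"]) (auto simp: ennreal_le_iff2)
    also have "\<dots> = emeasure Pr {w \<in> space Pr. r < H w}"
      using null by (intro emeasure_Un_null_set) auto
    also have "\<dots> = ennreal (1 - erlang_CDF (M - 1) 1 r)"
      using erlang_distributed_gt[OF assms(2), of r] r by (simp add: emeasure_eq_measure)
    finally show ?thesis unfolding eq .
  qed
qed (simp add: top_unique)

text \<open>Fubini for a variable \<open>X\<close> independent of a sub-\<sigma>-algebra
  \<open>G\<close>. The remaining randomness is represented by the outcome \<open>w\<close> itself,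
  seen through \<open>G\<close>, so no joint state space for the point processes has to be built.
  The first form freezes \<open>X\<close> and serves to condition on the serving distance; the
  second integrates \<open>X\<close> out for a fixed outcome and serves for the signal gain.\<close>

lemma nn_integral_indep_subalgebra:
  assumes "prob_space M" "X \<in> measurable M N" "sets G \<subseteq> sets M" "space G = space M"
    and indep: "\<And>A B. A \<in> sets N \<Longrightarrow> B \<in> sets G \<Longrightarrow>
      measure M ((X -` A \<inter> space M) \<inter> B) = measure M (X -` A \<inter> space M) * measure M B"
    and F: "F \<in> borel_measurable (N \<Otimes>\<^sub>M G)"
  shows "(\<integral>\<^sup>+w. F (X w, w) \<partial>M) = (\<integral>\<^sup>+x. (\<integral>\<^sup>+w. F (x, w) \<partial>M) \<partial>distr M N X)"
    and "(\<integral>\<^sup>+w. F (X w, w) \<partial>M) = (\<integral>\<^sup>+w. (\<integral>\<^sup>+x. F (x, w) \<partial>distr M N X) \<partial>M)"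
proof -
  interpret M: prob_space M by fact
  define M' where "M' = restr_to_subalg M G"
  have sub: "subalgebra M G" using assms by (simp add: subalgebra_def)
  have [measurable_cong]: "sets M' = sets G" and sp: "space M' = space M"
    using sets_restr_to_subalg[OF sub] space_restr_to_subalg[of M G] by (auto simp: M'_def)
  interpret M': prob_space M'
    using M.emeasure_space_1 sets.top[of G] assms(4)
    by (intro prob_spaceI) (simp add: M'_def emeasure_restr_to_subalg[OF sub] space_restr_to_subalg)
  interpret X: prob_space "distr M N X" using assms(2) by (rule M.prob_space_distr)
  have id [measurable]: "(\<lambda>w. w) \<in> measurable M M'"
    using assms(3,4) by (auto simp: measurable_def \<open>sets M' = sets G\<close> sp subset_iff sets.sets_into_space Int_absorb2 dest: sets.sets_into_space)
  note [measurable] = assms(2)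
  have F': "F \<in> borel_measurable (distr M N X \<Otimes>\<^sub>M M')"
    using F by (simp cong: measurable_cong_sets add: sets_pair_measure_cong[OF sets_distr \<open>sets M' = sets G\<close>])
  \<comment> \<open>Independence enters only here: the joint law of \<open>X\<close> and the
    identity into the coarser space \<open>M'\<close> agrees with the product measure on
    rectangles.\<close>
  have "distr M N X \<Otimes>\<^sub>M M' = distr M (N \<Otimes>\<^sub>M M') (\<lambda>w. (X w, w))"
  proof (rule pair_measure_eqI)
    show "sigma_finite_measure (distr M N X)" "sigma_finite_measure M'" by unfold_locales
    show "sets (distr M N X \<Otimes>\<^sub>M M') = sets (distr M (N \<Otimes>\<^sub>M M') (\<lambda>w. (X w, w)))"
      by (simp cong: sets_pair_measure_cong)
    fix A B assume A: "A \<in> sets (distr M N X)" and B: "B \<in> sets M'"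
    have BG: "B \<in> sets G" using B by (simp add: \<open>sets M' = sets G\<close>)
    have "emeasure (distr M (N \<Otimes>\<^sub>M M') (\<lambda>w. (X w, w))) (A \<times> B) = emeasure M ((X -` A \<inter> space M) \<inter> B)"
      using A B by (subst emeasure_distr) (auto intro!: arg_cong[where f="emeasure M"] dest: sets.sets_into_space)
    also have "\<dots> = emeasure M (X -` A \<inter> space M) * emeasure M B"
      using A BG indep by (simp add: M.emeasure_eq_measure ennreal_mult)
    finally show "emeasure (distr M N X) A * emeasure M' B = emeasure (distr M (N \<Otimes>\<^sub>M M') (\<lambda>w. (X w, w))) (A \<times> B)"
      using A BG by (simp add: emeasure_distr M'_def emeasure_restr_to_subalg[OF sub])
  qed
  note prod = this
  have "(\<integral>\<^sup>+w. F (X w, w) \<partial>M) = (\<integral>\<^sup>+z. F z \<partial>distr M (N \<Otimes>\<^sub>M M') (\<lambda>w. (X w, w)))"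
    using F' by (subst nn_integral_distr) (auto cong: measurable_cong_sets sets_pair_measure_cong)
  also have "\<dots> = (\<integral>\<^sup>+z. F z \<partial>(distr M N X \<Otimes>\<^sub>M M'))" by (simp add: prod)
  finally have joint: "(\<integral>\<^sup>+w. F (X w, w) \<partial>M) = (\<integral>\<^sup>+z. F z \<partial>(distr M N X \<Otimes>\<^sub>M M'))" .
  interpret pair_sigma_finite "distr M N X" M' ..
  have "(\<integral>\<^sup>+z. F z \<partial>(distr M N X \<Otimes>\<^sub>M M')) = (\<integral>\<^sup>+w. (\<integral>\<^sup>+x. F (x, w) \<partial>distr M N X) \<partial>M')"
    using F' by (rule nn_integral_snd[symmetric])
  also have "\<dots> = (\<integral>\<^sup>+w. (\<integral>\<^sup>+x. F (x, w) \<partial>distr M N X) \<partial>M)"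
  proof -
    have "(\<lambda>w. \<integral>\<^sup>+x. F (x, w) \<partial>distr M N X) \<in> borel_measurable M'"
      using X.borel_measurable_nn_integral_fst[OF measurable_pair_swap[OF F']] by simp
    then show ?thesis
      unfolding M'_def by (intro nn_integral_subalgebra2[OF sub]) (simp cong: measurable_cong_sets add: sets_restr_to_subalg[OF sub])
  qed
  finally show "(\<integral>\<^sup>+w. F (X w, w) \<partial>M) = (\<integral>\<^sup>+w. (\<integral>\<^sup>+x. F (x, w) \<partial>distr M N X) \<partial>M)"
    using joint by simp
  note joint
  also have "(\<integral>\<^sup>+z. F z \<partial>(distr M N X \<Otimes>\<^sub>M M')) = (\<integral>\<^sup>+x. (\<integral>\<^sup>+w. F (x, w) \<partial>M') \<partial>distr M N X)"
    using F' by (rule M'.nn_integral_fst[symmetric])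
  also have "\<dots> = (\<integral>\<^sup>+x. (\<integral>\<^sup>+w. F (x, w) \<partial>M) \<partial>distr M N X)"
  proof (rule nn_integral_cong)
    fix x assume "x \<in> space (distr M N X)"
    then have "(\<lambda>w. F (x, w)) \<in> borel_measurable G"
      using F by (intro measurable_Pair2[OF F]) simp
    then show "(\<integral>\<^sup>+w. F (x, w) \<partial>M') = (\<integral>\<^sup>+w. F (x, w) \<partial>M)"
      unfolding M'_def by (intro nn_integral_subalgebra2[OF sub])
  qed
  finally show "(\<integral>\<^sup>+w. F (X w, w) \<partial>M) = (\<integral>\<^sup>+x. (\<integral>\<^sup>+w. F (x, w) \<partial>M) \<partial>distr M N X)" .
qed

text \<open>
  Right continuity in the radius \<open>r\<close> reduces joint measurability to countably many rational radii;
  no local finiteness of the configurations is needed.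
\<close>
lemma measurable_cfg_shot_noise:
  fixes q :: "'a \<Rightarrow> ennreal" and d :: "'a \<Rightarrow> real"
  assumes [measurable]: "q \<in> borel_measurable N" "d \<in> borel_measurable N"
  shows "(\<lambda>(r, C). \<integral>\<^sup>+p. q p * indicator {p. r < d p} p \<partial>count_space C)
           \<in> borel_measurable (borel \<Otimes>\<^sub>M cfg_space N)"
proof -
  have eq: "(\<integral>\<^sup>+p. q p * indicator {p. r < d p} p \<partial>count_space C) =
      (SUP s::rat. indicator {r<..} (of_rat s) * (\<integral>\<^sup>+p. q p * indicator {p. of_rat s < d p} p \<partial>count_space C))"
    (is "?I r = (SUP s. ?J s)") for r C
  proof (rule antisym)
    define s where "s n = (SOME s. r < of_rat s \<and> of_rat s < r + 1 / real (Suc n))" for n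
    have s: "r < of_rat (s n)" "of_rat (s n) < r + 1 / real (Suc n)" for n
    proof -
      have "\<exists>s. r < of_rat s \<and> of_rat s < r + 1 / real (Suc n)"
        using of_rat_dense[of r "r + 1 / real (Suc n)"] by auto
      from someI_ex[OF this] show "r < of_rat (s n)" "of_rat (s n) < r + 1 / real (Suc n)"
        unfolding s_def by auto
    qed
    have lim: "(\<lambda>n. real_of_rat (s n)) \<longlonglongrightarrow> r"
    proof (rule tendsto_sandwich[where f="\<lambda>_. r" and h="\<lambda>n. r + 1 / real (Suc n)"])
      show "(\<lambda>n. r + 1 / real (Suc n)) \<longlonglongrightarrow> r"
        using tendsto_add[OF tendsto_const[of r] LIMSEQ_Suc[OF lim_1_over_n[where 'a=real]]] by simp
      show "\<forall>\<^sub>F n in sequentially. r \<le> real_of_rat (s n)"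
        "\<forall>\<^sub>F n in sequentially. real_of_rat (s n) \<le> r + 1 / real (Suc n)"
        using s by (auto intro!: always_eventually less_imp_le simp del: of_nat_Suc)
    qed simp
    \<comment> \<open>The rationals \<open>s n\<close> tend to r from above but need not be
      monotone, so Fatou is used in place of monotone convergence. A point beyond radius r is
      eventually beyond radius \<open>s n\<close>.\<close>
    have "?I r \<le> (\<integral>\<^sup>+p. liminf (\<lambda>n. q p * indicator {p. of_rat (s n) < d p} p) \<partial>count_space C)"
    proof (rule nn_integral_mono)
      fix p
      show "q p * indicator {p. r < d p} p \<le> liminf (\<lambda>n. q p * indicator {p. of_rat (s n) < d p} p)"
      proof (cases "r < d p")
        case True
        have "\<forall>\<^sub>F n in sequentially. q p \<le> q p * indicator {p. of_rat (s n) < d p} p"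
          using order_tendstoD(2)[OF lim True] by eventually_elim simp
        then have "q p \<le> liminf (\<lambda>n. q p * indicator {p. of_rat (s n) < d p} p)"
          by (rule Liminf_bounded)
        then show ?thesis using True by simp
      qed simp
    qed
    also have "\<dots> \<le> liminf (\<lambda>n. \<integral>\<^sup>+p. q p * indicator {p. of_rat (s n) < d p} p \<partial>count_space C)"
      by (intro nn_integral_liminf) simp
    also have "\<dots> = liminf (\<lambda>n. ?J (s n))"
      using s by simp
    also have "\<dots> \<le> liminf (\<lambda>n. (SUP s. ?J s))"
      by (intro Liminf_mono always_eventually allI SUP_upper) auto
    finally show "?I r \<le> (SUP s. ?J s)" by (simp add: Liminf_const)
    show "(SUP s. ?J s) \<le> ?I r"
    proof (rule SUP_least)
      fix s
      show "?J s \<le> ?I r"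
      proof (cases "r < of_rat s")
        case True
        then have "?J s = (\<integral>\<^sup>+p. q p * indicator {p. of_rat s < d p} p \<partial>count_space C)" by simp
        also have "\<dots> \<le> ?I r"
          using True by (intro nn_integral_mono mult_left_mono) (auto simp: indicator_def)
        finally show ?thesis .
      qed simp
    qed
  qed
  have [measurable]: "(\<lambda>C. \<integral>\<^sup>+p. q p * indicator {p. of_rat s < d p} p \<partial>count_space C) \<in> borel_measurable (cfg_space N)" for s
    by (intro measurable_nn_integral_cfg) (auto simp: indicator_def if_distrib cong: if_cong)
  have [measurable]: "(\<lambda>x::real. indicator {x<..} (real_of_rat s) :: ennreal) \<in> borel_measurable borel" for s
  proof -
    have "(\<lambda>x::real. indicator {x<..} (real_of_rat s) :: ennreal) = indicator {..<real_of_rat s}"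
      by (auto simp: indicator_def fun_eq_iff)
    then show ?thesis by simp
  qed
  have "(\<lambda>(r, C). \<integral>\<^sup>+p. q p * indicator {p. r < d p} p \<partial>count_space C) =
    (\<lambda>z. SUP s::rat. indicator {fst z<..} (of_rat s) * (\<integral>\<^sup>+p. q p * indicator {p. of_rat s < d p} p \<partial>count_space (snd z)))"
    by (rule ext, subst split_beta) (rule eq)
  then show ?thesis by simp
qed

section \<open>Euler integrals and path loss\<close>

text \<open>The squared norm pushes planar Lebesgue measure to \<pi> times Lebesgue measure on the
  half line, since a disc of squared radius t has area \<pi> t. The sign in the pushforward is
  chosen because measures are compared on upper rays: their preimages are then discs of finite
  area.\<close>

lemma nn_integral_radial_plane:
  fixes h :: "real \<Rightarrow> ennreal"
  assumes [measurable]: "h \<in> borel_measurable borel"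
  shows "(\<integral>\<^sup>+y. h ((norm (y :: real \<times> real))\<^sup>2) \<partial>lborel) = ennreal pi * (\<integral>\<^sup>+t. h t * indicator {0..} t \<partial>lborel)"
proof -
  have eq: "distr lborel borel (\<lambda>y :: real \<times> real. - ((norm y)\<^sup>2)) = density lborel (\<lambda>t. ennreal pi * indicator {..0} t)"
    (is "?M = ?N")
  proof (rule measure_eqI_lessThan)
    fix x :: real
    have "emeasure ?M {x<..} = emeasure lborel {y :: real \<times> real. (norm y)\<^sup>2 < - x}"
      by (subst emeasure_distr) (auto intro!: arg_cong[where f="emeasure lborel"])
    also have "\<dots> = ennreal (pi * max 0 (- x))"
    proof (cases "0 \<le> - x")
      case True
      have "{y :: real \<times> real. (norm y)\<^sup>2 < - x} = ball 0 (sqrt (- x))"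
      proof (rule Set.set_eqI)
        fix y :: "real \<times> real"
        have "(norm y)\<^sup>2 < - x \<longleftrightarrow> sqrt ((norm y)\<^sup>2) < sqrt (- x)" by (simp only: real_sqrt_less_iff)
        then show "y \<in> {y. (norm y)\<^sup>2 < - x} \<longleftrightarrow> y \<in> ball 0 (sqrt (- x))" by simp
      qed
      then show ?thesis using True by (simp add: emeasure_ball unit_ball_vol_2)
    next
      case False
      have "\<not> (norm y)\<^sup>2 < - x" for y :: "real \<times> real"
        using False zero_le_power2[of "norm y"] by linarith
      then show ?thesis using False by simp
    qed
    finally have M: "emeasure ?M {x<..} = ennreal (pi * max 0 (- x))" .
    then show "emeasure ?M {x<..} < \<infinity>" by simp
    have "emeasure ?N {x<..} = (\<integral>\<^sup>+t. ennreal pi * indicator {x<..0} t \<partial>lborel)"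
      by (subst emeasure_density) (auto intro!: nn_integral_cong simp: indicator_def)
    also have "\<dots> = ennreal (pi * max 0 (- x))"
      by (cases "x \<le> 0") (auto simp: nn_integral_cmult max_def simp flip: ennreal_mult)
    finally show "emeasure ?M {x<..} = emeasure ?N {x<..}" using M by simp
  qed auto
  have "(\<integral>\<^sup>+y. h ((norm (y :: real \<times> real))\<^sup>2) \<partial>lborel) = (\<integral>\<^sup>+t. h (- t) \<partial>?M)"
    by (subst nn_integral_distr) auto
  also have "\<dots> = (\<integral>\<^sup>+t. ennreal pi * indicator {..0} t * h (- t) \<partial>lborel)"
    unfolding eq by (subst nn_integral_density) auto
  also have "\<dots> = (\<integral>\<^sup>+t. ennreal pi * indicator {..0} (- t) * h t \<partial>lborel)"
    by (subst nn_integral_real_affine[where c="-1" and t=0]) auto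
  also have "\<dots> = (\<integral>\<^sup>+t. ennreal pi * (h t * indicator {0..} t) \<partial>lborel)"
    by (intro nn_integral_cong) (auto simp: indicator_def)
  finally show ?thesis by (simp add: nn_integral_cmult)
qed

lemma neg_binomial_sums:
  fixes a z :: real
  assumes "\<bar>z\<bar> < 1"
  shows "(\<lambda>m. pochhammer a m / fact m * z ^ m) sums (1 - z) powr (- a)"
proof -
  have "(- a gchoose m) * (- z) ^ m = pochhammer a m / fact m * z ^ m" for m
    by (simp add: gbinomial_pochhammer power_mult_distrib[symmetric])
  then show ?thesis using gen_binomial_real[of "- z" "- a"] assms by simp
qed

lemma has_bochner_integral_Beta:
  assumes "0 < a" "0 < (b::real)"
  shows "has_bochner_integral lborel (\<lambda>v. v powr (a - 1) * (1 - v) powr (b - 1) * indicator {0<..<1} v) (Beta a b)"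
proof (rule has_bochner_integral_nn_integral)
  have "((\<lambda>t. t powr (a - 1) * (1 - t) powr (b - 1)) has_integral Beta a b) {0<..<1}"
    using has_integral_Beta_real[OF assms] by (simp add: has_integral_Icc_iff_Ioo)
  from nn_integral_has_integral_lebesgue'[OF _ this]
  show "(\<integral>\<^sup>+v. ennreal (v powr (a - 1) * (1 - v) powr (b - 1) * indicator {0<..<1} v) \<partial>lborel) = ennreal (Beta a b)"
    by (simp add: ennreal_mult' flip: ennreal_indicator)
  show "0 \<le> Beta a b" using assms by (simp add: Beta_def Gamma_real_pos less_imp_le)
qed (auto simp: indicator_def)

text \<open>
  The choice \<open>s v = v\<close> yields the Gauss series and \<open>s v = 1 - v\<close> its Pfaff transform.
\<close>
lemma has_bochner_integral_neg_binomial: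
  fixes a b z :: real and s :: "real \<Rightarrow> real"
  assumes "0 < a" "0 < b" "\<bar>z\<bar> < 1" and [measurable]: "s \<in> borel_measurable borel"
    and s: "\<And>v. 0 < v \<Longrightarrow> v < 1 \<Longrightarrow> 0 \<le> s v \<and> s v \<le> 1"
    and I: "\<And>m. has_bochner_integral lborel (\<lambda>v. v powr (b - 1) * s v ^ m * indicator {0<..<1} v) (I m)"
  shows "has_bochner_integral lborel (\<lambda>v. v powr (b - 1) * (1 - z * s v) powr (- a) * indicator {0<..<1} v)
           (\<Sum>m. pochhammer a m / fact m * z ^ m * I m)"
proof -
  define f where "f m v = pochhammer a m / fact m * z ^ m * (v powr (b - 1) * s v ^ m * indicator {0<..<1} v)" for m v
  have pos: "0 \<le> pochhammer a m" for m using assms(1) by (intro pochhammer_nonneg)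
  have f_int: "integrable lborel (f m)" "integral\<^sup>L lborel (f m) = pochhammer a m / fact m * z ^ m * I m" for m
    using has_bochner_integral_mult_right[where c="pochhammer a m / fact m * z ^ m", OF I[of m]] unfolding f_def
    by (auto simp: has_bochner_integral_iff)
  have f_sums: "(\<lambda>m. f m v) sums (v powr (b - 1) * (1 - z * s v) powr (- a) * indicator {0<..<1} v)" for v
  proof (cases "v \<in> {0<..<1}")
    case True
    have "\<bar>z * s v\<bar> \<le> \<bar>z\<bar> * 1" unfolding abs_mult using s[of v] True by (intro mult_left_mono) auto
    then have "\<bar>z * s v\<bar> < 1" using assms(3) by simp
    from sums_mult2[OF neg_binomial_sums[OF this, of a], of "v powr (b - 1)"]
    show ?thesis using True by (simp add: f_def power_mult_distrib mult_ac)
  qed (simp add: f_def)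
  have sm: "summable (\<lambda>m. pochhammer a m / fact m * \<bar>z\<bar> ^ m)"
    using neg_binomial_sums[of "\<bar>z\<bar>" a] assms(3) by (auto simp: sums_iff)
  have norm_f: "norm (f m v) \<le> pochhammer a m / fact m * \<bar>z\<bar> ^ m * (v powr (b - 1) * s v ^ 0 * indicator {0<..<1} v)" for m v
  proof (cases "v \<in> {0<..<1}")
    case True
    then have "v powr (b - 1) * s v ^ m \<le> v powr (b - 1)"
      using s[of v] by (intro mult_left_le) (auto simp: power_le_one)
    then have "pochhammer a m / fact m * \<bar>z\<bar> ^ m * (v powr (b - 1) * s v ^ m) \<le> pochhammer a m / fact m * \<bar>z\<bar> ^ m * v powr (b - 1)"
      using pos[of m] by (intro mult_left_mono) auto
    then show ?thesis using True s[of v] pos[of m] by (simp add: f_def abs_mult power_abs)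
  qed (simp add: f_def)
  have s1: "summable (\<lambda>m. norm (f m v))" for v
    by (rule summable_comparison_test'[OF summable_mult2[OF sm, of "v powr (b - 1) * s v ^ 0 * indicator {0<..<1} v"], of 0])
       (use norm_f in auto)
  have s2: "summable (\<lambda>m. LINT v|lborel. norm (f m v))"
  proof (rule summable_comparison_test'[OF summable_mult2[OF sm, of "I 0"], of 0])
    fix m :: nat
    have "(LINT v|lborel. norm (f m v)) \<le> (LINT v|lborel. pochhammer a m / fact m * \<bar>z\<bar> ^ m * (v powr (b - 1) * s v ^ 0 * indicator {0<..<1} v))"
      using f_int I[of 0] by (intro integral_mono norm_f) (auto simp: has_bochner_integral_iff)
    also have "\<dots> = pochhammer a m / fact m * \<bar>z\<bar> ^ m * I 0"
      using I[of 0] by (simp add: has_bochner_integral_iff)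
    finally show "norm (LINT v|lborel. norm (f m v)) \<le> pochhammer a m / fact m * \<bar>z\<bar> ^ m * I 0"
      by simp
  qed
  have "has_bochner_integral lborel (\<lambda>v. \<Sum>m. f m v) (\<Sum>m. integral\<^sup>L lborel (f m))"
    using f_int(1) s1 s2 by (auto simp: has_bochner_integral_iff intro!: integrable_suminf integral_suminf)
  then show ?thesis using f_sums by (simp add: sums_iff f_int(2))
qed

text \<open>For c = b + 1 the quotient (b)_m / (c)_m telescopes to b / (b + m), which is how the
  Gauss coefficients match the moments 1 / (b + m).\<close>

lemma pochhammer_shift: "pochhammer b m * (b + real m) = b * pochhammer (b + 1) m" for b :: real
  using pochhammer_rec[of b m] pochhammer_Suc[of b m] by simp

text \<open>Euler's integral with c = b + 1, where the factor (1 - v)^(c-b-1) is 1 and the Beta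
  prefactor is b. The two cases follow the definition of \<open>hyp2f1\<close>: for \<tau> < 1 the
  integrand is expanded in powers of v, and otherwise in powers of 1 - v after factoring out 1 +
  \<tau>.\<close>

lemma has_bochner_integral_hyp2f1:
  fixes a b \<tau> :: real
  assumes "0 < a" "0 < b" "0 < \<tau>"
  shows "has_bochner_integral lborel (\<lambda>v. v powr (b - 1) * (1 + \<tau> * v) powr (- a) * indicator {0<..<1} v)
           (hyp2f1 a b (b + 1) (- \<tau>) / b)"
proof (cases "\<tau> < 1")
  case True
  have I: "has_bochner_integral lborel (\<lambda>v. v powr (b - 1) * v ^ m * indicator {0<..<1} v) (1 / (b + real m))" for m
  proof -
    have "Gamma (b + real m + 1) = (b + real m) * Gamma (b + real m)"
      using assms(2) by (intro Gamma_plus1) (auto simp: nonpos_Ints_def)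
    then have "Beta (b + real m) 1 = 1 / (b + real m)"
      using assms(2) less_imp_neq[OF Gamma_real_pos[of "b + real m"]] by (simp add: Beta_def add_pos_nonneg)
    moreover have "has_bochner_integral lborel (\<lambda>v. v powr (b + real m - 1) * (1 - v) powr (1 - 1) * indicator {0<..<1} v) (Beta (b + real m) 1)"
      using assms(2) by (intro has_bochner_integral_Beta) auto
    moreover have "v powr (b + real m - 1) * (1 - v) powr (1 - 1) * indicator {0<..<1} v = v powr (b - 1) * v ^ m * indicator {0<..<1} v" for v :: real
      by (auto simp: indicator_def powr_add[symmetric] powr_realpow[symmetric] algebra_simps)
    ultimately show ?thesis by (simp only:)
  qed
  have eq: "pochhammer a m / fact m * (- \<tau>) ^ m * (1 / (b + real m)) =
      pochhammer a m * pochhammer b m / (pochhammer (b + 1) m * fact m) * (- \<tau>) ^ m / b" for m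
  proof -
    have "pochhammer (b + 1) m > 0" using assms(2) by (intro pochhammer_pos) simp
    then have "pochhammer b m / pochhammer (b + 1) m = b / (b + real m)"
      using pochhammer_shift[of b m] assms(2) by (subst frac_eq_eq) auto
    then have "1 / (b + real m) = pochhammer b m / pochhammer (b + 1) m / b" using assms(2) by simp
    then show ?thesis by (simp only:) (simp add: mult_ac)
  qed
  have sm: "summable (\<lambda>m. pochhammer a m / fact m * (- \<tau>) ^ m * (1 / (b + real m)))"
  proof (rule summable_comparison_test'[OF summable_mult2[of "\<lambda>m. pochhammer a m / fact m * \<tau> ^ m" "1 / b"], of 0])
    show "summable (\<lambda>m. pochhammer a m / fact m * \<tau> ^ m)"
      using neg_binomial_sums[of "\<tau>" a] assms(3) True by (auto simp: sums_iff)
    show "norm (pochhammer a m / fact m * (- \<tau>) ^ m * (1 / (b + real m))) \<le> pochhammer a m / fact m * \<tau> ^ m * (1 / b)" for m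
      using assms pochhammer_nonneg[OF assms(1), of m]
      by (auto simp: abs_mult power_abs intro!: mult_left_mono divide_left_mono)
  qed
  have "(\<Sum>m. pochhammer a m / fact m * (- \<tau>) ^ m * (1 / (b + real m))) = hyp2f1 a b (b + 1) (- \<tau>) / b"
    using True suminf_divide[of "\<lambda>m. pochhammer a m * pochhammer b m / (pochhammer (b + 1) m * fact m) * (- \<tau>) ^ m" b]
      summable_mult[OF sm, of b] assms(2) unfolding eq hyp2f1_def hyp2f1_series_def
    by simp
  moreover have "has_bochner_integral lborel (\<lambda>v. v powr (b - 1) * (1 - (- \<tau>) * v) powr (- a) * indicator {0<..<1} v)
     (\<Sum>m. pochhammer a m / fact m * (- \<tau>) ^ m * (1 / (b + real m)))"
    using assms True I by (intro has_bochner_integral_neg_binomial) auto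
  ultimately show ?thesis by simp
next
  case False
  \<comment> \<open>The Pfaff argument of -\<tau>. It satisfies 1 + \<tau> v = (1 + \<tau>)(1 - z(1
    - v)), and z < 1 for every positive \<tau>, so the new expansion converges.\<close>
  define z where "z = \<tau> / (1 + \<tau>)"
  have z: "\<bar>z\<bar> < 1" "0 < z" using assms(3) by (auto simp: z_def)
  have I: "has_bochner_integral lborel (\<lambda>v. v powr (b - 1) * (1 - v) ^ m * indicator {0<..<1} v) (fact m / (b * pochhammer (b + 1) m))" for m
  proof -
    have "pochhammer b (m + 1) = Gamma (b + real (m + 1)) / Gamma b"
      using assms(2) by (intro pochhammer_Gamma) (auto simp: nonpos_Ints_def)
    moreover have "pochhammer b (m + 1) = b * pochhammer (b + 1) m" by (simp add: pochhammer_rec)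
    ultimately have "Gamma (b + (real m + 1)) = b * pochhammer (b + 1) m * Gamma b"
      using Gamma_real_pos[OF assms(2)] by (simp add: field_simps)
    then have "Beta b (real m + 1) = fact m / (b * pochhammer (b + 1) m)"
      using assms(2) less_imp_neq[OF Gamma_real_pos[OF assms(2)]] by (simp add: Beta_def add.commute flip: Gamma_fact)
    moreover have "has_bochner_integral lborel (\<lambda>v. v powr (b - 1) * (1 - v) powr (real m + 1 - 1) * indicator {0<..<1} v) (Beta b (real m + 1))"
      using assms(2) by (intro has_bochner_integral_Beta) auto
    moreover have "v powr (b - 1) * (1 - v) powr (real m + 1 - 1) * indicator {0<..<1} v = v powr (b - 1) * (1 - v) ^ m * indicator {0<..<1} v" for v :: real
      by (auto simp: indicator_def powr_realpow)
    ultimately show ?thesis by (simp only:)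
  qed
  have pos: "pochhammer (b + 1) m > 0" for m using assms(2) by (intro pochhammer_pos) simp
  have eq: "pochhammer a m / fact m * z ^ m * (fact m / (b * pochhammer (b + 1) m)) =
     pochhammer a m * pochhammer 1 m / (pochhammer (b + 1) m * fact m) * z ^ m / b" for m
    by (simp add: pochhammer_fact)
  have sm: "summable (\<lambda>m. pochhammer a m / fact m * z ^ m * (fact m / (b * pochhammer (b + 1) m)))"
  proof (rule summable_comparison_test'[OF summable_mult2[of "\<lambda>m. pochhammer a m / fact m * z ^ m" "1 / b"], of 0])
    show "summable (\<lambda>m. pochhammer a m / fact m * z ^ m)"
      using neg_binomial_sums[of z a] z by (auto simp: sums_iff)
    fix m :: nat
    \<comment> \<open>Factorwise comparison of (1)_m = m! with (b + 1)_m; the series is then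
      dominated by the binomial series in z.\<close>
    have "fact m \<le> pochhammer (b + 1) m"
      unfolding pochhammer_fact pochhammer_prod using assms(2) by (intro prod_mono) auto
    then have "fact m / (b * pochhammer (b + 1) m) \<le> 1 / b"
      using assms(2) pos[of m] by (simp add: field_simps)
    then have "pochhammer a m / fact m * z ^ m * (fact m / (b * pochhammer (b + 1) m)) \<le> pochhammer a m / fact m * z ^ m * (1 / b)"
      using pochhammer_nonneg[OF assms(1), of m] z by (intro mult_left_mono) auto
    moreover have "0 \<le> pochhammer a m / fact m * z ^ m * (fact m / (b * pochhammer (b + 1) m))"
      using pochhammer_nonneg[OF assms(1), of m] z assms(2) pos[of m] by (intro mult_nonneg_nonneg) auto
    ultimately show "norm (pochhammer a m / fact m * z ^ m * (fact m / (b * pochhammer (b + 1) m))) \<le> pochhammer a m / fact m * z ^ m * (1 / b)"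
      by (simp only: real_norm_def abs_of_nonneg)
  qed
  have "has_bochner_integral lborel (\<lambda>v. v powr (b - 1) * (1 - z * (1 - v)) powr (- a) * indicator {0<..<1} v)
     (\<Sum>m. pochhammer a m / fact m * z ^ m * (fact m / (b * pochhammer (b + 1) m)))"
    using assms z I by (intro has_bochner_integral_neg_binomial) auto
  also have "(\<Sum>m. pochhammer a m / fact m * z ^ m * (fact m / (b * pochhammer (b + 1) m))) = hyp2f1_series a 1 (b + 1) z / b"
    using suminf_divide[of "\<lambda>m. pochhammer a m * pochhammer 1 m / (pochhammer (b + 1) m * fact m) * z ^ m" b]
      summable_mult[OF sm, of b] assms(2) unfolding eq hyp2f1_series_def
    by simp
  finally have "has_bochner_integral lborel (\<lambda>v. (1 + \<tau>) powr (- a) * (v powr (b - 1) * (1 - z * (1 - v)) powr (- a) * indicator {0<..<1} v))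
     ((1 + \<tau>) powr (- a) * (hyp2f1_series a 1 (b + 1) z / b))"
    by (rule has_bochner_integral_mult_right)
  moreover have "(1 + \<tau>) powr (- a) * (v powr (b - 1) * (1 - z * (1 - v)) powr (- a) * indicator {0<..<1} v)
     = v powr (b - 1) * (1 + \<tau> * v) powr (- a) * indicator {0<..<1} v" for v
  proof (cases "v \<in> {0<..<1}")
    case True
    have e: "(1 + \<tau>) * (1 - z * (1 - v)) = 1 + \<tau> * v" using assms(3) by (simp add: z_def field_simps)
    have "0 < (1 + \<tau>) * (1 - z * (1 - v))" unfolding e using True assms(3) by (simp add: add_pos_pos)
    then have "0 < 1 - z * (1 - v)" using assms(3) by (simp add: zero_less_mult_iff)
    then have "(1 + \<tau>) powr (- a) * (1 - z * (1 - v)) powr (- a) = (1 + \<tau> * v) powr (- a)"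
      using assms(3) by (simp add: e flip: powr_mult)
    then show ?thesis by (simp add: mult_ac)
  qed simp
  moreover have "(1 + \<tau>) powr (- a) * (hyp2f1_series a 1 (b + 1) z / b) = hyp2f1 a b (b + 1) (- \<tau>) / b"
  proof -
    have "- \<tau> / (- \<tau> - 1) = z" using assms(3) by (simp add: z_def divide_simps) (simp add: algebra_simps)
    then show ?thesis using False by (simp only: hyp2f1_def) simp
  qed
  ultimately show ?thesis by (simp only:)
qed

text \<open>Positivity is read off the Euler integral; for \<tau> < 1 the defining series alternates
  and does not show it.\<close>

lemma hyp2f1_nonneg:
  assumes "0 < a" "0 < b" "0 < \<tau>"
  shows "0 \<le> hyp2f1 a b (b + 1) (- \<tau>)"
proof -
  have "0 \<le> hyp2f1 a b (b + 1) (- \<tau>) / b"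
    unfolding has_bochner_integral_hyp2f1[OF assms, THEN has_bochner_integral_integral_eq, symmetric]
    by (intro Bochner_Integration.integral_nonneg) (auto simp: indicator_def)
  then show ?thesis using assms(2) by (simp add: zero_le_divide_iff)
qed

text \<open>In the squared radius t the substitution t = \<rho>^2 v^(-\<delta>) turns the gain into
  \<tau> v and the exterior of the disc into the unit interval; the Jacobian shifts the exponent to
  p - \<delta> - 1, so \<delta> < p gives convergence at infinity. The instances needed are (p, a) =
  (1, 1) for the zeroth coefficient and (n, n + 1) for the others.\<close>

lemma nn_integral_path_loss:
  fixes \<rho> \<tau> \<delta> a :: real and p :: nat
  assumes "0 < \<rho>" "0 < \<tau>" "0 < \<delta>" "\<delta> < real p" "0 < a"
  defines "c \<equiv> \<lambda>y :: real \<times> real. \<tau> * (\<rho> / norm y) powr (2 / \<delta>)"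
  shows "(\<integral>\<^sup>+y. ennreal (c y ^ p * (1 + c y) powr (- a)) * indicator {y. \<rho> < norm y} y \<partial>lborel)
     = ennreal (pi * \<rho>\<^sup>2 * (\<delta> * \<tau> ^ p * hyp2f1 a (real p - \<delta>) (real p + 1 - \<delta>) (- \<tau>) / (real p - \<delta>)))"
proof -
  define b where "b = real p - \<delta>"
  have b: "0 < b" "real p + 1 - \<delta> = b + 1" using assms by (auto simp: b_def)
  define d where "d t = \<tau> * (\<rho>\<^sup>2 / t) powr (1 / \<delta>)" for t
  define f where "f t = d t ^ p * (1 + d t) powr (- a)" for t
  define g where "g v = \<rho>\<^sup>2 * v powr (- \<delta>)" for v
  define g' where "g' v = \<rho>\<^sup>2 * (- \<delta> * v powr (- \<delta> - 1))" for v
  have [measurable]: "f \<in> borel_measurable borel" unfolding f_def[abs_def] d_def[abs_def] by measurable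
  have d_c: "d ((norm y)\<^sup>2) = c y" if "\<rho> < norm y" for y
  proof -
    have "(\<rho>\<^sup>2 / (norm y)\<^sup>2) powr (1 / \<delta>) = ((\<rho> / norm y) powr 2) powr (1 / \<delta>)"
      using that assms(1) by (simp add: power_divide)
    then show ?thesis by (simp add: d_def c_def powr_powr)
  qed
  have d_g: "d (g v) = \<tau> * v" if "0 < v" for v
    using that assms by (simp add: d_def g_def powr_minus divide_simps powr_powr)
  let ?H = "hyp2f1 a b (b + 1) (- \<tau>) / b"
  have H: "has_bochner_integral lborel (\<lambda>v. (\<rho>\<^sup>2 * \<delta> * \<tau> ^ p) * (v powr (b - 1) * (1 + \<tau> * v) powr (- a) * indicator {0<..<1} v))
      ((\<rho>\<^sup>2 * \<delta> * \<tau> ^ p) * ?H)"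
    using has_bochner_integral_hyp2f1[OF assms(5) b(1) assms(2)] by (rule has_bochner_integral_mult_right)
  have fg: "\<bar>g' v\<bar> * f (g v) = (\<rho>\<^sup>2 * \<delta> * \<tau> ^ p) * (v powr (b - 1) * (1 + \<tau> * v) powr (- a))" if "v \<in> {0<..<1}" for v
  proof -
    have "v powr (- \<delta> - 1) * v ^ p = v powr (b - 1)"
      using that by (simp add: b_def powr_realpow[symmetric] powr_add[symmetric] algebra_simps)
    then show ?thesis using that assms
      by (simp add: f_def d_g g'_def abs_mult power_mult_distrib mult_ac)
  qed
  have sI: "set_integrable lborel {0<..<1} (\<lambda>v. \<bar>g' v\<bar> * f (g v))"
  proof -
    have "(\<lambda>v. indicat_real {0<..<1} v *\<^sub>R (\<bar>g' v\<bar> * f (g v))) =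
        (\<lambda>v. (\<rho>\<^sup>2 * \<delta> * \<tau> ^ p) * (v powr (b - 1) * (1 + \<tau> * v) powr (- a) * indicator {0<..<1} v))"
      by (auto simp: fun_eq_iff indicator_def fg)
    then have "integrable lborel (\<lambda>v. indicat_real {0<..<1} v *\<^sub>R (\<bar>g' v\<bar> * f (g v)))"
      using H by (simp add: has_bochner_integral_iff)
    then show ?thesis by (simp add: set_integrable_def)
  qed
  have sV: "(LINT v:{0<..<1}|lborel. \<bar>g' v\<bar> * f (g v)) = (\<rho>\<^sup>2 * \<delta> * \<tau> ^ p) * ?H"
  proof -
    have "(LINT v:{0<..<1}|lborel. \<bar>g' v\<bar> * f (g v)) = (LINT v|lborel. (\<rho>\<^sup>2 * \<delta> * \<tau> ^ p) * (v powr (b - 1) * (1 + \<tau> * v) powr (- a) * indicator {0<..<1} v))"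
      unfolding set_lebesgue_integral_def by (intro Bochner_Integration.integral_cong) (auto simp: indicator_def fg)
    then show ?thesis using H by (simp add: has_bochner_integral_iff)
  qed
  have abs: "(\<lambda>v. \<bar>g' v\<bar> * f (g v)) absolutely_integrable_on {0<..<1}"
    using assms by (intro nonnegative_absolutely_integrable_1[OF set_borel_integral_eq_integral(1)[OF sI]]) (simp add: fg)
  have img: "g ` {0<..<1} = {\<rho>\<^sup>2<..}"
  proof (intro Set.set_eqI iffI)
    fix t assume "t \<in> g ` {0<..<1}"
    then obtain v where v: "0 < v" "v < 1" "t = g v" by auto
    have "1 < v powr (- \<delta>)" using v assms powr_less_mono2_neg[of "-\<delta>" v 1] by simp
    then show "t \<in> {\<rho>\<^sup>2<..}" using v assms by (simp add: g_def)
  next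
    fix t assume t: "t \<in> {\<rho>\<^sup>2<..}"
    define v where "v = (t / \<rho>\<^sup>2) powr (- 1 / \<delta>)"
    have t1: "1 < t / \<rho>\<^sup>2" using t assms by simp
    have "v < 1" using powr_less_mono2_neg[of "-1/\<delta>" 1 "t / \<rho>\<^sup>2"] t1 assms by (simp add: v_def)
    moreover have "0 < v" unfolding v_def powr_gt_zero using t1 by linarith
    moreover have "g v = t" using t1 assms order.strict_trans1[OF zero_le_power2[of \<rho>], of t] t by (simp add: g_def v_def powr_powr)
    ultimately show "t \<in> g ` {0<..<1}" by (intro image_eqI[of _ _ v]) auto
  qed
  have inj: "inj_on g {0<..<1}"
    \<comment> \<open>The gain itself inverts the substitution: d(g v) = \<tau> v.\<close>
    by (rule inj_on_inverseI[where g="\<lambda>t. d t / \<tau>"]) (use d_g assms in auto)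
  have "f absolutely_integrable_on (g ` {0<..<1}) \<and> integral (g ` {0<..<1}) f = (\<rho>\<^sup>2 * \<delta> * \<tau> ^ p) * ?H"
  proof (subst has_absolute_integral_change_of_variables_1'[symmetric, where g'=g'])
    show "(g has_real_derivative g' x) (at x within {0<..<1})" if "x \<in> {0<..<1}" for x
      unfolding g_def g'_def using that by (auto intro!: derivative_eq_intros)
    show "(\<lambda>x. \<bar>g' x\<bar> * f (g x)) absolutely_integrable_on {0<..<1} \<and>
      integral {0<..<1} (\<lambda>x. \<bar>g' x\<bar> * f (g x)) = \<rho>\<^sup>2 * \<delta> * \<tau> ^ p * ?H"
      using abs sV set_borel_integral_eq_integral(2)[OF sI] by simp
  qed (use inj in auto)
  then have f: "f integrable_on {\<rho>\<^sup>2<..}" "integral {\<rho>\<^sup>2<..} f = (\<rho>\<^sup>2 * \<delta> * \<tau> ^ p) * ?H"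
    unfolding img by (auto intro: set_lebesgue_integral_eq_integral(1))
  have f_nonneg: "0 \<le> f t" if "t \<in> {\<rho>\<^sup>2<..}" for t
    using that assms by (auto simp: f_def d_def)
  have nnf: "(\<integral>\<^sup>+t. ennreal (f t) * indicator {\<rho>\<^sup>2<..} t \<partial>lborel) = ennreal ((\<rho>\<^sup>2 * \<delta> * \<tau> ^ p) * ?H)"
    using f f_nonneg by (intro nn_integral_has_integral_lebesgue') (auto simp: has_integral_integral)
  have "(\<integral>\<^sup>+y. ennreal (c y ^ p * (1 + c y) powr (- a)) * indicator {y. \<rho> < norm y} y \<partial>lborel)
     = (\<integral>\<^sup>+y. (\<lambda>t. ennreal (f t) * indicator {\<rho>\<^sup>2<..} t) ((norm (y :: real \<times> real))\<^sup>2) \<partial>lborel)"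
  proof (intro nn_integral_cong)
    fix y :: "real \<times> real"
    have "\<rho>\<^sup>2 < (norm y)\<^sup>2 \<longleftrightarrow> \<rho> < norm y"
      using assms(1) by (metis norm_ge_zero power_less_imp_less_base power_strict_mono less_imp_le zero_less_numeral)
    then show "ennreal (c y ^ p * (1 + c y) powr (- a)) * indicator {y. \<rho> < norm y} y =
      (\<lambda>t. ennreal (f t) * indicator {\<rho>\<^sup>2<..} t) ((norm y)\<^sup>2)"
      by (auto simp: indicator_def f_def d_c)
  qed
  also have "\<dots> = ennreal pi * (\<integral>\<^sup>+t. ennreal (f t) * indicator {\<rho>\<^sup>2<..} t * indicator {0..} t \<partial>lborel)"
    by (rule nn_integral_radial_plane) simp
  also have "(\<integral>\<^sup>+t. ennreal (f t) * indicator {\<rho>\<^sup>2<..} t * indicator {0..} t \<partial>lborel) = (\<integral>\<^sup>+t. ennreal (f t) * indicator {\<rho>\<^sup>2<..} t \<partial>lborel)"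
    by (intro nn_integral_cong) (auto simp: indicator_def dest: order.strict_trans1[OF zero_le_power2[of \<rho>]])
  also have "ennreal pi * \<dots> = ennreal (pi * ((\<rho>\<^sup>2 * \<delta> * \<tau> ^ p) * ?H))"
    unfolding nnf by (rule ennreal_mult'[symmetric]) simp
  finally show ?thesis unfolding b(2) b_def[symmetric] by (simp add: mult_ac)
qed

section \<open>Power series and Toeplitz matrices\<close>

text \<open>The difference of the two series is analytic in the unit disc and vanishes on (0, 1),
  whereas the zeros of a nonzero power series are isolated. Nonnegative coefficients turn finiteness
  of the \<open>ennreal\<close> sums into summability.\<close>

lemma power_series_unique_right:
  fixes a b :: "nat \<Rightarrow> real"
  assumes "\<And>n. 0 \<le> a n" "\<And>n. 0 \<le> b n"
    and eq: "\<And>u. 0 < u \<Longrightarrow> u < 1 \<Longrightarrow> (\<Sum>n. ennreal (a n * u ^ n)) = (\<Sum>n. ennreal (b n * u ^ n))"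
    and fin: "\<And>u. 0 < u \<Longrightarrow> u < 1 \<Longrightarrow> (\<Sum>n. ennreal (b n * u ^ n)) < \<infinity>"
  shows "a = b"
proof (rule ext, rule ccontr)
  fix m0 assume "a m0 \<noteq> b m0"
  define f where "f u = (\<Sum>n. (a n - b n) * u ^ n)" for u
  have sm: "summable (\<lambda>n. a n * u ^ n)" "summable (\<lambda>n. b n * u ^ n)" if "0 < u" "u < 1" for u
  proof -
    show "summable (\<lambda>n. b n * u ^ n)"
      using fin[OF that] that assms(2) by (intro summable_suminf_not_top) auto
    show "summable (\<lambda>n. a n * u ^ n)"
      using fin[OF that] that assms(1) by (intro summable_suminf_not_top) (auto simp: eq)
  qed
  have f0: "f u = 0" if u: "0 < u" "u < 1" for u
  proof -
    have "ennreal (\<Sum>n. a n * u ^ n) = ennreal (\<Sum>n. b n * u ^ n)"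
      using eq[OF u] sm[OF u] assms(1,2) u by (simp add: suminf_ennreal2)
    then have "(\<Sum>n. a n * u ^ n) = (\<Sum>n. b n * u ^ n)"
      using sm[OF u] assms(1,2) u by (subst (asm) ennreal_inj) (auto intro!: suminf_nonneg)
    then show ?thesis unfolding f_def left_diff_distrib using sm[OF u] by (simp add: suminf_diff[symmetric])
  qed
  have sums: "(\<lambda>n. (a n - b n) * (u - 0) ^ n) sums f u" if u1: "norm (u - 0) < 1" for u
  proof (cases "u = 0")
    case False
    obtain w where w: "\<bar>u\<bar> < w" "w < 1" using u1 dense[of "\<bar>u\<bar>" 1] by auto
    have "summable (\<lambda>n. (a n - b n) * w ^ n)"
      unfolding left_diff_distrib using w by (intro summable_diff sm) auto
    then have "summable (\<lambda>n. (a n - b n) * u ^ n)"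
      by (rule powser_inside) (use w in auto)
    then show ?thesis by (simp add: f_def summable_sums)
  next
    case True
    then show ?thesis using powser_sums_zero[of "\<lambda>n. a n - b n"] by (simp add: f_def sums_iff)
  qed
  \<comment> \<open>The isolated-zero theorem is applied to a function vanishing at 0, so the
    constant term is settled beforehand, by continuity from the right.\<close>
  have a0: "a 0 = b 0"
  proof -
    have "isCont f 0"
      unfolding f_def by (rule isCont_powser[of _ "1/2"]) (use sums[of "1/2"] in \<open>auto simp: sums_iff\<close>)
    then have "(f \<longlongrightarrow> f 0) (at_right 0)"
      by (simp add: isCont_def filterlim_at_split)
    moreover have "(f \<longlongrightarrow> 0) (at_right 0)"
      by (rule tendsto_eventually, rule eventually_at_rightI[of 0 1]) (use f0 in auto)
    ultimately have "f 0 = 0" by (rule tendsto_unique[rotated]) simp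
    then show ?thesis by (simp add: f_def)
  qed
  have "m0 > 0" using a0 \<open>a m0 \<noteq> b m0\<close> by (cases m0) auto
  moreover have "f 0 = 0" using a0 by (simp add: f_def)
  ultimately obtain s where s: "0 < s" "\<And>z. z \<in> cball 0 s - {0} \<Longrightarrow> f z \<noteq> 0"
    using powser_0_nonzero[of 1 0 "\<lambda>n. a n - b n" f m0] sums \<open>a m0 \<noteq> b m0\<close> by auto
  have "min s (1/2) \<in> cball 0 s - {0}" using s(1) by auto
  from s(2)[OF this] f0[of "min s (1/2)"] s(1) show False by auto
qed

text \<open>A lower triangular Toeplitz matrix is multiplication by a power series truncated at
  order M. Truncation is compatible with products, since entry (p, q) of a product involves only
  rows between q and p. Indices start at 0, so the first column of a power lists the coefficients of
  G^i.\<close>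

lemma toeplitz_power_fps:
  fixes c :: "nat \<Rightarrow> real" and M :: nat
  defines "G \<equiv> Abs_fps (\<lambda>n. if n = 0 then 0 else c n)"
    and "Q \<equiv> mat M M (\<lambda>(p, q). if q < p then c (p - q) else 0)"
  assumes "p < M" "q < M"
  shows "(Q ^\<^sub>m i) $$ (p, q) = (if q \<le> p then fps_nth (G ^ i) (p - q) else 0)"
  using assms(3,4)
proof (induction i arbitrary: p q)
  case 0
  then show ?case by (auto simp: Q_def)
next
  case (Suc i)
  have carrier: "Q \<in> carrier_mat M M" "Q ^\<^sub>m i \<in> carrier_mat M M" by (auto simp: Q_def intro!: pow_carrier_mat)
  have "(Q ^\<^sub>m Suc i) $$ (p, q) = (\<Sum>r<M. (Q ^\<^sub>m i) $$ (p, r) * Q $$ (r, q))"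
    using carrier Suc.prems by (simp add: scalar_prod_def lessThan_atLeast0)
  also have "\<dots> = (\<Sum>r<M. if q \<le> r \<and> r \<le> p then fps_nth (G ^ i) (p - r) * fps_nth G (r - q) else 0)"
    using Suc by (intro sum.cong) (auto simp: Q_def G_def)
  also have "\<dots> = (\<Sum>r\<in>{q..p}. fps_nth (G ^ i) (p - r) * fps_nth G (r - q))"
    using Suc.prems by (intro sum.mono_neutral_cong_right) auto
  also have "\<dots> = (if q \<le> p then fps_nth (G ^ Suc i) (p - q) else 0)"
  proof (cases "q \<le> p")
    case True
    have "fps_nth (G ^ Suc i) (p - q) = (\<Sum>j=0..p - q. fps_nth G j * fps_nth (G ^ i) (p - q - j))"
      by (simp add: fps_mult_nth)
    also have "\<dots> = (\<Sum>r\<in>{q..p}. fps_nth (G ^ i) (p - r) * fps_nth G (r - q))"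
      using True by (intro sum.reindex_bij_witness[where i="\<lambda>r. r - q" and j="\<lambda>j. j + q"]) (auto simp: mult.commute add.commute)
    finally show ?thesis using True by simp
  qed simp
  finally show ?case .
qed

lemma suminf_swap_ennreal:
  fixes f :: "nat \<Rightarrow> nat \<Rightarrow> ennreal"
  shows "(\<Sum>i. \<Sum>j. f i j) = (\<Sum>j. \<Sum>i. f i j)"
proof -
  have "(\<Sum>i. \<Sum>j. f i j) = (\<integral>\<^sup>+i. (\<Sum>j. f i j) \<partial>count_space UNIV)"
    by (simp add: nn_integral_count_space_nat)
  also have "\<dots> = (\<Sum>j. \<integral>\<^sup>+i. f i j \<partial>count_space UNIV)"
    by (rule nn_integral_suminf) simp
  finally show ?thesis by (simp add: nn_integral_count_space_nat)
qed

lemma fps_power_nonneg: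
  fixes G :: "real fps"
  assumes "\<And>n. 0 \<le> fps_nth G n"
  shows "0 \<le> fps_nth (G ^ i) n"
proof (induction i arbitrary: n)
  case (Suc i)
  then show ?case using assms by (auto simp: fps_mult_nth intro!: sum_nonneg)
qed simp

lemma fps_power_sums:
  fixes G :: "real fps"
  assumes "\<And>n. 0 \<le> fps_nth G n" "0 \<le> u" "(\<lambda>n. fps_nth G n * u ^ n) sums s"
  shows "(\<lambda>n. fps_nth (G ^ i) n * u ^ n) sums (s ^ i)"
proof (induction i)
  case 0
  have "(\<lambda>n. fps_nth (G ^ 0) n * u ^ n) = (\<lambda>n. if n = 0 then 1 else 0)"
    by auto
  then show ?case using sums_single[of 0 "\<lambda>_. 1::real"] by (simp add: eq_commute)
next
  case (Suc i)
  have "(\<lambda>k. \<Sum>j\<le>k. (fps_nth G j * u ^ j) * (fps_nth (G ^ i) (k - j) * u ^ (k - j))) sums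
      ((\<Sum>k. fps_nth G k * u ^ k) * (\<Sum>k. fps_nth (G ^ i) k * u ^ k))"
    using assms Suc fps_power_nonneg[OF assms(1)]
    by (intro Cauchy_product_sums) (auto simp: sums_iff abs_mult)
  also have "(\<lambda>k. \<Sum>j\<le>k. (fps_nth G j * u ^ j) * (fps_nth (G ^ i) (k - j) * u ^ (k - j))) = (\<lambda>k. fps_nth (G ^ Suc i) k * u ^ k)"
  proof
    fix k
    have "fps_nth (G ^ Suc i) k * u ^ k = (\<Sum>j\<le>k. fps_nth G j * fps_nth (G ^ i) (k - j) * u ^ k)"
      by (simp add: fps_mult_nth sum_distrib_right atLeast0AtMost)
    also have "\<dots> = (\<Sum>j\<le>k. (fps_nth G j * u ^ j) * (fps_nth (G ^ i) (k - j) * u ^ (k - j)))"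
    proof (rule sum.cong)
      fix j assume "j \<in> {..k}"
      then have "u ^ k = u ^ j * u ^ (k - j)" by (simp flip: power_add)
      then show "fps_nth G j * fps_nth (G ^ i) (k - j) * u ^ k = (fps_nth G j * u ^ j) * (fps_nth (G ^ i) (k - j) * u ^ (k - j))"
        by simp
    qed simp
    finally show "(\<Sum>j\<le>k. (fps_nth G j * u ^ j) * (fps_nth (G ^ i) (k - j) * u ^ (k - j))) = fps_nth (G ^ Suc i) k * u ^ k" ..
  qed
  finally show ?case using assms(3) Suc by (simp add: sums_iff)
qed

text \<open>As G has no constant term, G^i starts at order i, so each coefficient of exp G is a
  finite sum over i \<le> n. Nonnegativity permits swapping the two infinite sums.\<close>

lemma suminf_exp_fps:
  fixes G :: "real fps"
  assumes "\<And>n. 0 \<le> fps_nth G n" "fps_nth G 0 = 0" "0 \<le> u" "(\<lambda>n. fps_nth G n * u ^ n) sums s"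
  shows "(\<Sum>n. ennreal ((\<Sum>i\<le>n. fps_nth (G ^ i) n / fact i) * u ^ n)) = ennreal (exp s)"
proof -
  have s0: "0 \<le> s" using assms by (auto intro!: suminf_nonneg simp: sums_iff)
  have "ennreal (exp s) = (\<Sum>i. ennreal (s ^ i / fact i))"
    using s0 exp_converges[of s] by (intro suminf_ennreal_eq[symmetric]) (auto simp: divide_inverse mult.commute)
  also have "\<dots> = (\<Sum>i. \<Sum>n. ennreal (fps_nth (G ^ i) n / fact i * u ^ n))"
  proof (rule suminf_cong)
    fix i
    show "ennreal (s ^ i / fact i) = (\<Sum>n. ennreal (fps_nth (G ^ i) n / fact i * u ^ n))"
      using sums_divide[OF fps_power_sums[OF assms(1,3,4), of i], of "fact i"] fps_power_nonneg[OF assms(1)] assms(3)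
      by (intro suminf_ennreal_eq[symmetric]) auto
  qed
  also have "\<dots> = (\<Sum>n. \<Sum>i. ennreal (fps_nth (G ^ i) n / fact i * u ^ n))"
    by (rule suminf_swap_ennreal)
  also have "\<dots> = (\<Sum>n. ennreal ((\<Sum>i\<le>n. fps_nth (G ^ i) n / fact i) * u ^ n))"
  proof (rule suminf_cong)
    fix n
    have "fps_nth (G ^ i) n = 0" if "n < i" for i
      using startsby_zero_power_prefix[OF assms(2)] that by auto
    then have "(\<Sum>i. ennreal (fps_nth (G ^ i) n / fact i * u ^ n)) = (\<Sum>i\<le>n. ennreal (fps_nth (G ^ i) n / fact i * u ^ n))"
      by (intro suminf_finite) auto
    also have "\<dots> = ennreal (\<Sum>i\<le>n. fps_nth (G ^ i) n / fact i * u ^ n)"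
      using fps_power_nonneg[OF assms(1)] assms(3) by (intro sum_ennreal) auto
    finally show "(\<Sum>i. ennreal (fps_nth (G ^ i) n / fact i * u ^ n)) = ennreal ((\<Sum>i\<le>n. fps_nth (G ^ i) n / fact i) * u ^ n)"
      by (simp add: sum_distrib_right)
  qed
  finally show ?thesis by simp
qed

text \<open>The expected weights \<open>e\<close> and the candidates \<open>b\<close> have the same
  generating function e^(s - a0) on (0, 1), so they coincide. The power series for s starts at order
  1, while \<open>a0\<close> carries the constant part of the exponent.\<close>

lemma poisson_weight_expectation:
  fixes G :: "real fps" and a0 :: real
  assumes "prob_space Pr" and [measurable]: "J \<in> borel_measurable Pr"
    and G: "\<And>n. 0 \<le> fps_nth G n" "fps_nth G 0 = 0"
    and laplace: "\<And>u. 0 < u \<Longrightarrow> u < 1 \<Longrightarrow> \<exists>s. (\<lambda>n. fps_nth G n * u ^ n) sums s \<and>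
        (\<integral>\<^sup>+w. exp_neg (ennreal (1 - u) * J w) \<partial>Pr) = ennreal (exp (s - a0))"
  shows "(\<integral>\<^sup>+w. poisson_weight n (J w) \<partial>Pr) = ennreal (exp (- a0) * (\<Sum>i\<le>n. fps_nth (G ^ i) n / fact i))"
proof -
  interpret prob_space Pr by fact
  define e where "e n = enn2real (\<integral>\<^sup>+w. poisson_weight n (J w) \<partial>Pr)" for n
  define b where "b n = exp (- a0) * (\<Sum>i\<le>n. fps_nth (G ^ i) n / fact i)" for n
  have e: "(\<integral>\<^sup>+w. poisson_weight n (J w) \<partial>Pr) = ennreal (e n)" for n
  proof -
    have "(\<integral>\<^sup>+w. poisson_weight n (J w) \<partial>Pr) \<le> (\<integral>\<^sup>+w. 1 \<partial>Pr)"
      by (intro nn_integral_mono poisson_weight_le_1)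
    also have "\<dots> < \<infinity>" by (simp add: emeasure_space_1)
    finally show ?thesis by (simp add: e_def ennreal_enn2real)
  qed
  have b_nonneg: "0 \<le> b n" for n
    using fps_power_nonneg[OF G(1)] by (auto simp: b_def intro!: sum_nonneg mult_nonneg_nonneg)
  have L: "(\<Sum>n. ennreal (e n * u ^ n)) = (\<Sum>n. ennreal (b n * u ^ n)) \<and> (\<Sum>n. ennreal (b n * u ^ n)) < \<infinity>"
    if u: "0 < u" "u < 1" for u
  proof -
    obtain s where s: "(\<lambda>n. fps_nth G n * u ^ n) sums s"
      "(\<integral>\<^sup>+w. exp_neg (ennreal (1 - u) * J w) \<partial>Pr) = ennreal (exp (s - a0))"
      using laplace[OF u] by auto
    have "(\<Sum>n. ennreal (e n * u ^ n)) = (\<Sum>n. \<integral>\<^sup>+w. ennreal (u ^ n) * poisson_weight n (J w) \<partial>Pr)"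
    proof (rule suminf_cong)
      fix n
      have "0 \<le> e n" by (simp add: e_def)
      then show "ennreal (e n * u ^ n) = (\<integral>\<^sup>+w. ennreal (u ^ n) * poisson_weight n (J w) \<partial>Pr)"
        using u by (simp add: nn_integral_cmult e ennreal_mult mult.commute)
    qed
    also have "\<dots> = (\<integral>\<^sup>+w. (\<Sum>n. ennreal (u ^ n) * poisson_weight n (J w)) \<partial>Pr)"
      by (rule nn_integral_suminf[symmetric]) simp
    also have "\<dots> = ennreal (exp (s - a0))"
      using u by (simp add: poisson_weight_generating_function s)
    finally have 1: "(\<Sum>n. ennreal (e n * u ^ n)) = ennreal (exp (s - a0))" .
    have "(\<Sum>n. ennreal (b n * u ^ n)) = (\<Sum>n. ennreal (exp (- a0)) * ennreal ((\<Sum>i\<le>n. fps_nth (G ^ i) n / fact i) * u ^ n))"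
      by (intro suminf_cong) (simp add: b_def ennreal_mult'[symmetric] mult.assoc)
    also have "\<dots> = ennreal (exp (- a0)) * ennreal (exp s)"
      using suminf_exp_fps[OF G _ s(1)] u by simp
    also have "\<dots> = ennreal (exp (s - a0))"
      by (simp add: exp_diff exp_minus divide_inverse mult.commute flip: ennreal_mult)
    finally show ?thesis using 1 by simp
  qed
  have "e = b"
    using L by (intro power_series_unique_right b_nonneg) (auto simp: e_def)
  then show ?thesis by (simp add: e b_def)
qed

section \<open>Interference under exponential fading\<close>

text \<open>These are the \<phi>_{j,k}(n). The case n = 0 is separate because it is the integral of
  c / (1 + c); the general integrand c^n / (1 + c)^(n+1) read at n = 0 would diverge over the
  plane.\<close>

definition interference_coeff :: "real \<Rightarrow> real \<Rightarrow> nat \<Rightarrow> real" where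
  "interference_coeff \<delta> \<tau> n = (if n = 0
     then \<delta> * \<tau> * hyp2f1 1 (1 - \<delta>) (2 - \<delta>) (- \<tau>) / (1 - \<delta>)
     else \<delta> * \<tau> ^ n * hyp2f1 (real n + 1) (real n - \<delta>) (real n + 1 - \<delta>) (- \<tau>) / (real n - \<delta>))"

lemma interference_coeff_nonneg:
  assumes "0 < \<delta>" "\<delta> < 1" "0 < \<tau>"
  shows "0 \<le> interference_coeff \<delta> \<tau> n"
proof (cases "n = 0")
  case True
  have "0 \<le> hyp2f1 1 (1 - \<delta>) (1 - \<delta> + 1) (- \<tau>)" using assms by (intro hyp2f1_nonneg) auto
  then show ?thesis using True assms by (simp add: interference_coeff_def add.commute)
next
  case False
  then have "\<delta> < real n" using assms by linarith
  then have "0 \<le> hyp2f1 (real n + 1) (real n - \<delta>) (real n - \<delta> + 1) (- \<tau>)"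
    using assms by (intro hyp2f1_nonneg) auto
  moreover have "real n - \<delta> + 1 = real n + 1 - \<delta>" by simp
  ultimately show ?thesis using False assms \<open>\<delta> < real n\<close> by (simp add: interference_coeff_def)
qed

lemma nn_integral_interference_coeff:
  fixes \<rho> \<tau> \<delta> :: real
  assumes "0 < \<rho>" "0 < \<tau>" "0 < \<delta>" "\<delta> < 1"
  defines "c \<equiv> \<lambda>y :: real \<times> real. \<tau> * (\<rho> / norm y) powr (2 / \<delta>)"
  shows "(\<integral>\<^sup>+y. ennreal (c y / (1 + c y)) * indicator {y. \<rho> < norm y} y \<partial>lborel)
           = ennreal (pi * \<rho>\<^sup>2 * interference_coeff \<delta> \<tau> 0)"
    and "0 < n \<Longrightarrow> (\<integral>\<^sup>+y. ennreal (c y ^ n / (1 + c y) ^ (n + 1)) * indicator {y. \<rho> < norm y} y \<partial>lborel)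
           = ennreal (pi * \<rho>\<^sup>2 * interference_coeff \<delta> \<tau> n)"
proof -
  have c: "0 \<le> c y" for y using assms(2) by (simp add: c_def)
  then have c1: "0 < 1 + c y" for y by (simp add: add_pos_nonneg)
  have pw: "(1 + c y) powr - (real m + 1) = 1 / (1 + c y) ^ (m + 1)" for y m
  proof -
    have "(1 + c y) powr (real m + 1) = (1 + c y) ^ (m + 1)"
      using powr_realpow[OF c1[of y], of "m + 1"] by (simp only: of_nat_add of_nat_1)
    then show ?thesis by (simp only: powr_minus inverse_eq_divide)
  qed
  have "c y / (1 + c y) = c y ^ 1 * (1 + c y) powr (- 1)" for y
    using pw[of y 0] by simp
  then show "(\<integral>\<^sup>+y. ennreal (c y / (1 + c y)) * indicator {y. \<rho> < norm y} y \<partial>lborel)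
           = ennreal (pi * \<rho>\<^sup>2 * interference_coeff \<delta> \<tau> 0)"
    using nn_integral_path_loss[of \<rho> \<tau> \<delta> 1 1] assms(1-4)
    by (simp only: c_def) (simp add: interference_coeff_def)
  assume n: "0 < n"
  then have "\<delta> < real n" using assms by linarith
  moreover have "c y ^ n / (1 + c y) ^ (n + 1) = c y ^ n * (1 + c y) powr - (real n + 1)" for y
    unfolding pw by simp
  ultimately show "(\<integral>\<^sup>+y. ennreal (c y ^ n / (1 + c y) ^ (n + 1)) * indicator {y. \<rho> < norm y} y \<partial>lborel)
           = ennreal (pi * \<rho>\<^sup>2 * interference_coeff \<delta> \<tau> n)"
    using nn_integral_path_loss[of \<rho> \<tau> \<delta> n "real n + 1"] assms(1-4) n
    by (simp only: c_def interference_coeff_def) simp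
qed

text \<open>The unit exponential density splits as (1 - e^(-xv)) e^(-v) plus 1 / (1 + x) times the
  exponential density of rate 1 + x. Only the total mass 1 of both densities is then used.\<close>

lemma nn_integral_one_minus_exp_neg_exponential:
  assumes "0 \<le> x"
  shows "(\<integral>\<^sup>+v. (1 - exp_neg (ennreal (x * v))) * ennreal (exponential_density 1 v) \<partial>lborel) = ennreal (x / (1 + x))"
    (is "?I = _")
proof -
  have total: "(\<integral>\<^sup>+v. ennreal (exponential_density l v) \<partial>lborel) = 1" if "0 < l" for l
    using prob_space.emeasure_space_1[OF prob_space_exponential_density[OF that]]
    by (subst (asm) emeasure_density) (auto simp: exponential_density_def)
  have x1: "0 < 1 + x" using assms by simp
  have "1 = (\<integral>\<^sup>+v. ennreal (exponential_density 1 v) \<partial>lborel)" by (simp add: total)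
  also have "\<dots> = (\<integral>\<^sup>+v. (1 - exp_neg (ennreal (x * v))) * ennreal (exponential_density 1 v)
      + ennreal (1 / (1 + x)) * ennreal (exponential_density (1 + x) v) \<partial>lborel)"
  proof (rule nn_integral_cong)
    fix v :: real
    show "ennreal (exponential_density 1 v) = (1 - exp_neg (ennreal (x * v))) * ennreal (exponential_density 1 v)
      + ennreal (1 / (1 + x)) * ennreal (exponential_density (1 + x) v)"
    proof (cases "v < 0")
      case False
      then have xv: "0 \<le> x * v" using assms by simp
      then have "1 - exp_neg (ennreal (x * v)) = ennreal (1 - exp (- (x * v)))"
        by (simp add: ennreal_minus flip: ennreal_1)
      moreover have "exp (- v) = (1 - exp (- (x * v))) * exp (- v) + 1 / (1 + x) * ((1 + x) * exp (- v * (1 + x)))"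
      proof -
        have "1 / (1 + x) * ((1 + x) * exp (- v * (1 + x))) = exp (- (x * v)) * exp (- v)"
        proof -
          have "exp (- v * (1 + x)) = exp (- (x * v)) * exp (- v)" by (simp add: algebra_simps flip: exp_add)
          then show ?thesis using x1 by simp
        qed
        then show ?thesis by (simp add: algebra_simps)
      qed
      ultimately show ?thesis using False xv x1
        by (simp add: exponential_density_def flip: ennreal_mult ennreal_plus)
    qed (simp add: exponential_density_def)
  qed
  also have "\<dots> = ?I + ennreal (1 / (1 + x))"
    using total[OF x1] by (subst nn_integral_add) (auto simp: nn_integral_cmult exponential_density_def)
  finally have 1: "1 = ?I + ennreal (1 / (1 + x))" .
  then have "?I = 1 - ennreal (1 / (1 + x))" by (metis ennreal_add_diff_cancel_right ennreal_neq_top)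
  also have "\<dots> = ennreal (1 - 1 / (1 + x))" using x1 by (simp add: ennreal_minus flip: ennreal_1)
  also have "1 - 1 / (1 + x) = x / (1 + x)" using x1 by (simp add: field_simps)
  finally show ?thesis .
qed

text \<open>Intensity of interferer locations together with their Exp(1) fading. Independent marking
  of a homogeneous Poisson process is a Poisson process on this product, so fading needs no random
  variables of its own.\<close>

definition marked_plane :: "real \<Rightarrow> ((real \<times> real) \<times> real) measure" where
  "marked_plane A = density lborel (\<lambda>_. ennreal A) \<Otimes>\<^sub>M density lborel (\<lambda>v. ennreal (exponential_density 1 v))"

lemma sets_marked_plane [measurable_cong]: "sets (marked_plane A) = sets (borel \<Otimes>\<^sub>M borel)"
  unfolding marked_plane_def by (intro sets_pair_measure_cong) auto

lemma space_marked_plane [simp]: "space (marked_plane A) = UNIV"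
  by (simp add: marked_plane_def space_pair_measure)

lemma sigma_finite_marked_plane: "sigma_finite_measure (marked_plane A)"
proof -
  interpret A: sigma_finite_measure "density lborel (\<lambda>_ :: real \<times> real. ennreal A)"
    using lborel.sigma_finite_measure_axioms by (subst sigma_finite_measure.sigma_finite_iff_density_finite) auto
  interpret B: prob_space "density lborel (\<lambda>v. ennreal (exponential_density 1 v))"
    by (rule prob_space_exponential_density) simp
  interpret pair_sigma_finite "density lborel (\<lambda>_ :: real \<times> real. ennreal A)" "density lborel (\<lambda>v. ennreal (exponential_density 1 v))" ..
  show ?thesis unfolding marked_plane_def by (rule P.sigma_finite_measure_axioms)
qed

text \<open>The sum is geometric with ratio u c / (1 + c) < 1. The identity is arranged without
  subtraction so that it can be integrated in \<open>ennreal\<close>.\<close>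

lemma interference_generating_identity:
  fixes c u :: real
  assumes "0 \<le> c" "0 < u" "u < 1"
  shows "ennreal ((1 - u) * c / (1 + (1 - u) * c)) + (\<Sum>n. ennreal (u ^ Suc n) * ennreal (c ^ Suc n / (1 + c) ^ (Suc n + 1)))
     = ennreal (c / (1 + c))"
proof -
  define r where "r = u * c / (1 + c)"
  have c1: "0 < 1 + c" using assms by simp
  have "u * c \<le> c" using assms by (intro mult_left_le_one_le) auto
  then have r: "0 \<le> r" "r < 1" using assms c1 by (auto simp: r_def)
  have "(\<lambda>n. r ^ n) sums (1 / (1 - r))" using r by (intro geometric_sums) auto
  from sums_mult[OF this, of "r / (1 + c)"]
  have s: "(\<lambda>n. u ^ Suc n * (c ^ Suc n / (1 + c) ^ (Suc n + 1))) sums (r / (1 + c) / (1 - r))"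
    by (simp add: r_def power_divide power_mult_distrib mult_ac)
  have den: "0 < 1 + (1 - u) * c" using assms by (simp add: add_pos_nonneg)
  have "1 - r = (1 + (1 - u) * c) / (1 + c)" using c1 by (simp add: r_def field_simps)
  then have v: "r / (1 + c) / (1 - r) = u * c / (1 + c) / (1 + (1 - u) * c)"
    using c1 by (simp add: r_def)
  have "(\<Sum>n. ennreal (u ^ Suc n) * ennreal (c ^ Suc n / (1 + c) ^ (Suc n + 1))) = ennreal (u * c / (1 + c) / (1 + (1 - u) * c))"
    using s assms unfolding v by (simp flip: ennreal_mult, intro suminf_ennreal_eq) auto
  moreover have "(1 - u) * c / (1 + (1 - u) * c) + u * c / (1 + c) / (1 + (1 - u) * c) = c / (1 + c)"
    using c1 den by (simp add: divide_simps) (simp add: algebra_simps)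
  ultimately show ?thesis using assms den c1 by (simp flip: ennreal_plus)
qed

text \<open>Fading is integrated out first; \<open>interference_generating_identity\<close> is then
  integrated over the exterior of the disc. \<open>L\<close> is the exponent of the Laplace
  functional, and the series is what it lacks to the zeroth coefficient.\<close>

lemma interference_laplace_exponent:
  fixes \<rho> \<tau> \<delta> u A :: real
  assumes "0 < \<rho>" "0 < \<tau>" "0 < \<delta>" "\<delta> < 1" "0 \<le> A" "0 < u" "u < 1"
  defines "f \<equiv> \<lambda>p :: (real \<times> real) \<times> real. ennreal (\<tau> * (\<rho> / norm (fst p)) powr (2 / \<delta>) * snd p) * indicator {p. \<rho> < norm (fst p)} p"
  shows "\<exists>L\<ge>0. (\<integral>\<^sup>+p. 1 - exp_neg (ennreal (1 - u) * f p) \<partial>marked_plane A) = ennreal L \<and>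
    (\<lambda>n. (if n = 0 then 0 else pi * A * \<rho>\<^sup>2 * interference_coeff \<delta> \<tau> n) * u ^ n) sums (pi * A * \<rho>\<^sup>2 * interference_coeff \<delta> \<tau> 0 - L)"
proof -
  define c where "c y = \<tau> * (\<rho> / norm y) powr (2 / \<delta>)" for y :: "real \<times> real"
  define D where "D = {y :: real \<times> real. \<rho> < norm y}"
  define \<phi> where "\<phi> n = pi * \<rho>\<^sup>2 * interference_coeff \<delta> \<tau> n" for n
  have [measurable]: "c \<in> borel_measurable borel" "D \<in> sets borel" unfolding c_def[abs_def] D_def by measurable
  have c: "0 \<le> c y" for y using assms(2) by (simp add: c_def)
  have \<phi>: "0 \<le> \<phi> n" for n unfolding \<phi>_def using assms by (intro mult_nonneg_nonneg interference_coeff_nonneg) auto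
  have [measurable]: "f \<in> borel_measurable (marked_plane A)" unfolding f_def by measurable
  interpret B: prob_space "density lborel (\<lambda>v. ennreal (exponential_density 1 v))"
    by (rule prob_space_exponential_density) simp
  define L0 where "L0 = (\<integral>\<^sup>+y. ennreal ((1 - u) * c y / (1 + (1 - u) * c y)) * indicator D y \<partial>lborel)"
  have f1: "1 - exp_neg (ennreal (1 - u) * f (y, v)) = (1 - exp_neg (ennreal ((1 - u) * c y * v))) * indicator D y" for y v
    using assms by (auto simp: f_def D_def c_def indicator_def mult.assoc simp flip: ennreal_mult')
  have "(\<integral>\<^sup>+p. 1 - exp_neg (ennreal (1 - u) * f p) \<partial>marked_plane A)
      = (\<integral>\<^sup>+y. (\<integral>\<^sup>+v. 1 - exp_neg (ennreal (1 - u) * f (y, v)) \<partial>density lborel (\<lambda>v. ennreal (exponential_density 1 v))) \<partial>density lborel (\<lambda>_. ennreal A))"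
    unfolding marked_plane_def
    by (subst B.nn_integral_fst[symmetric]) (auto simp flip: marked_plane_def)
  also have "\<dots> = (\<integral>\<^sup>+y. ennreal ((1 - u) * c y / (1 + (1 - u) * c y)) * indicator D y \<partial>density lborel (\<lambda>_. ennreal A))"
  proof (rule nn_integral_cong)
    fix y :: "real \<times> real"
    have "(\<integral>\<^sup>+v. 1 - exp_neg (ennreal (1 - u) * f (y, v)) \<partial>density lborel (\<lambda>v. ennreal (exponential_density 1 v)))
       = (\<integral>\<^sup>+v. (1 - exp_neg (ennreal ((1 - u) * c y * v))) * ennreal (exponential_density 1 v) * indicator D y \<partial>lborel)"
      unfolding f1 by (subst nn_integral_density) (auto simp: exponential_density_def mult_ac)
    also have "\<dots> = (\<integral>\<^sup>+v. (1 - exp_neg (ennreal ((1 - u) * c y * v))) * ennreal (exponential_density 1 v) \<partial>lborel) * indicator D y"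
      by (rule nn_integral_multc) (simp add: exponential_density_def)
    also have "\<dots> = ennreal ((1 - u) * c y / (1 + (1 - u) * c y)) * indicator D y"
      using assms c[of y] by (subst nn_integral_one_minus_exp_neg_exponential) auto
    finally show "(\<integral>\<^sup>+v. 1 - exp_neg (ennreal (1 - u) * f (y, v)) \<partial>density lborel (\<lambda>v. ennreal (exponential_density 1 v)))
       = ennreal ((1 - u) * c y / (1 + (1 - u) * c y)) * indicator D y" .
  qed
  also have "\<dots> = ennreal A * L0"
    unfolding L0_def by (subst nn_integral_density) (auto simp: nn_integral_cmult)
  finally have main: "(\<integral>\<^sup>+p. 1 - exp_neg (ennreal (1 - u) * f p) \<partial>marked_plane A) = ennreal A * L0" .
  have int: "(\<integral>\<^sup>+y. ennreal (c y / (1 + c y)) * indicator D y \<partial>lborel) = ennreal (\<phi> 0)"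
    "(\<integral>\<^sup>+y. ennreal (c y ^ Suc n / (1 + c y) ^ (Suc n + 1)) * indicator D y \<partial>lborel) = ennreal (\<phi> (Suc n))" for n
    using nn_integral_interference_coeff[OF assms(1-4)] unfolding c_def D_def \<phi>_def by blast+
  have "ennreal (\<phi> 0) = (\<integral>\<^sup>+y. ennreal ((1 - u) * c y / (1 + (1 - u) * c y)) * indicator D y
      + (\<Sum>n. ennreal (u ^ Suc n) * (ennreal (c y ^ Suc n / (1 + c y) ^ (Suc n + 1)) * indicator D y)) \<partial>lborel)"
    unfolding int(1)[symmetric]
  proof (rule nn_integral_cong)
    fix y
    show "ennreal (c y / (1 + c y)) * indicator D y = ennreal ((1 - u) * c y / (1 + (1 - u) * c y)) * indicator D y
      + (\<Sum>n. ennreal (u ^ Suc n) * (ennreal (c y ^ Suc n / (1 + c y) ^ (Suc n + 1)) * indicator D y))"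
      using interference_generating_identity[OF c assms(6,7), of y] by (cases "y \<in> D") auto
  qed
  also have "\<dots> = L0 + (\<Sum>n. ennreal (u ^ Suc n) * ennreal (\<phi> (Suc n)))"
    unfolding L0_def int(2)[symmetric]
    by (subst nn_integral_add, simp, simp, subst nn_integral_suminf, simp, subst nn_integral_cmult) simp_all
  also have "(\<Sum>n. ennreal (u ^ Suc n) * ennreal (\<phi> (Suc n))) = (\<Sum>n. ennreal (\<phi> (Suc n) * u ^ Suc n))"
    using assms \<phi> by (simp add: mult.commute flip: ennreal_mult)
  finally have sum: "ennreal (\<phi> 0) = L0 + (\<Sum>n. ennreal (\<phi> (Suc n) * u ^ Suc n))" .
  \<comment> \<open>Both parts of a finite sum are finite, so the equation moves to the reals, where
    \<open>L0\<close> can be isolated.\<close>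
  have fin: "L0 \<noteq> top" "(\<Sum>n. ennreal (\<phi> (Suc n) * u ^ Suc n)) \<noteq> top"
    using sum by (metis add_top_left_ennreal ennreal_neq_top, metis add_top_right_ennreal ennreal_neq_top)
  then obtain l where l: "L0 = ennreal l" "0 \<le> l" by (cases L0) auto
  have sm: "summable (\<lambda>n. \<phi> (Suc n) * u ^ Suc n)"
    using fin(2) \<phi> assms by (intro summable_suminf_not_top) auto
  have "ennreal (\<phi> 0) = ennreal (l + (\<Sum>n. \<phi> (Suc n) * u ^ Suc n))"
    unfolding sum l(1) using l sm \<phi> assms
    by (subst suminf_ennreal2) (auto intro!: suminf_nonneg ennreal_plus[symmetric])
  then have "\<phi> 0 = l + (\<Sum>n. \<phi> (Suc n) * u ^ Suc n)"
    using l sm \<phi> assms by (subst (asm) ennreal_inj) (auto intro!: suminf_nonneg add_nonneg_nonneg)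
  then have "(\<lambda>n. \<phi> (Suc n) * u ^ Suc n) sums (\<phi> 0 - l)" using sm by (simp add: sums_iff)
  then have "(\<lambda>n. A * ((if Suc n = 0 then 0 else \<phi> (Suc n)) * u ^ Suc n)) sums (A * (\<phi> 0 - l))"
    by (intro sums_mult) simp
  then have "(\<lambda>n. A * ((if n = 0 then 0 else \<phi> n) * u ^ n)) sums (A * (\<phi> 0 - l))"
    by (subst (asm) sums_Suc_iff) simp
  moreover have "(\<lambda>n. A * ((if n = 0 then 0 else \<phi> n) * u ^ n)) = (\<lambda>n. (if n = 0 then 0 else pi * A * \<rho>\<^sup>2 * interference_coeff \<delta> \<tau> n) * u ^ n)"
    by (auto simp: \<phi>_def)
  moreover have "A * (\<phi> 0 - l) = pi * A * \<rho>\<^sup>2 * interference_coeff \<delta> \<tau> 0 - A * l"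
    by (simp add: \<phi>_def algebra_simps)
  ultimately have "(\<lambda>n. (if n = 0 then 0 else pi * A * \<rho>\<^sup>2 * interference_coeff \<delta> \<tau> n) * u ^ n) sums (pi * A * \<rho>\<^sup>2 * interference_coeff \<delta> \<tau> 0 - A * l)"
    by simp
  moreover have "(\<integral>\<^sup>+p. 1 - exp_neg (ennreal (1 - u) * f p) \<partial>marked_plane A) = ennreal (A * l)"
    unfolding main l(1) using l(2) assms by (simp add: ennreal_mult)
  ultimately show ?thesis using l(2) assms by (intro exI[of _ "A * l"]) auto
qed

text \<open>Independence of the tiers multiplies their Laplace transforms, so the exponents add and
  the coefficient sequences of the tiers sum to \<open>a\<close>.\<close>

lemma poisson_weight_interference:
  fixes S :: "nat set" and A \<tau> \<delta> \<rho> :: "nat \<Rightarrow> real" and Psi :: "nat \<Rightarrow> 'w \<Rightarrow> ((real \<times> real) \<times> real) set"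
  assumes "prob_space Pr" "finite S"
    and params: "\<And>j. j \<in> S \<Longrightarrow> 0 < \<rho> j \<and> 0 < \<tau> j \<and> 0 < \<delta> j \<and> \<delta> j < 1 \<and> 0 \<le> A j"
    and ppp: "\<And>j. j \<in> S \<Longrightarrow> poisson_point_process Pr (marked_plane (A j)) (Psi j)"
    and indep: "prob_space.indep_sets Pr (\<lambda>j. {Psi j -` C \<inter> space Pr | C. C \<in> sets (cfg_space (marked_plane (A j)))}) S"
  defines "f \<equiv> \<lambda>j p. ennreal (\<tau> j * (\<rho> j / norm (fst p)) powr (2 / \<delta> j) * snd p) * indicator {p :: (real \<times> real) \<times> real. \<rho> j < norm (fst p)} p"
    and "a \<equiv> \<lambda>n. \<Sum>j\<in>S. pi * A j * (\<rho> j)\<^sup>2 * interference_coeff (\<delta> j) (\<tau> j) n"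
  shows "(\<integral>\<^sup>+w. poisson_weight n (\<Sum>j\<in>S. \<integral>\<^sup>+p. f j p \<partial>count_space (Psi j w)) \<partial>Pr) =
    ennreal (exp (- a 0) * (\<Sum>i\<le>n. fps_nth (Abs_fps (\<lambda>n. if n = 0 then 0 else a n) ^ i) n / fact i))"
proof (rule poisson_weight_expectation)
  interpret prob_space Pr by fact
  have f_meas [measurable]: "f j \<in> borel_measurable (marked_plane (A j))" for j unfolding f_def by measurable
  have Psi_meas: "Psi j \<in> measurable Pr (cfg_space (marked_plane (A j)))" if "j \<in> S" for j
    using ppp[OF that] by (rule measurable_ppp)
  have J_meas: "(\<lambda>w. \<integral>\<^sup>+p. f j p \<partial>count_space (Psi j w)) \<in> borel_measurable Pr" if "j \<in> S" for j
    using measurable_compose[OF Psi_meas[OF that] measurable_nn_integral_cfg[OF f_meas]] .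
  then show "(\<lambda>w. \<Sum>j\<in>S. \<integral>\<^sup>+p. f j p \<partial>count_space (Psi j w)) \<in> borel_measurable Pr" by simp
  have a_nonneg: "0 \<le> a n" for n
    unfolding a_def using params by (intro sum_nonneg mult_nonneg_nonneg interference_coeff_nonneg) auto
  then show "0 \<le> fps_nth (Abs_fps (\<lambda>n. if n = 0 then 0 else a n)) n" for n by simp
  fix u :: real assume u: "0 < u" "u < 1"
  define L where "L j = (SOME L. 0 \<le> L \<and> (\<integral>\<^sup>+p. 1 - exp_neg (ennreal (1 - u) * f j p) \<partial>marked_plane (A j)) = ennreal L \<and>
    (\<lambda>n. (if n = 0 then 0 else pi * A j * (\<rho> j)\<^sup>2 * interference_coeff (\<delta> j) (\<tau> j) n) * u ^ n)
      sums (pi * A j * (\<rho> j)\<^sup>2 * interference_coeff (\<delta> j) (\<tau> j) 0 - L))" for j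
  have L: "0 \<le> L j \<and> (\<integral>\<^sup>+p. 1 - exp_neg (ennreal (1 - u) * f j p) \<partial>marked_plane (A j)) = ennreal (L j) \<and>
    (\<lambda>n. (if n = 0 then 0 else pi * A j * (\<rho> j)\<^sup>2 * interference_coeff (\<delta> j) (\<tau> j) n) * u ^ n)
      sums (pi * A j * (\<rho> j)\<^sup>2 * interference_coeff (\<delta> j) (\<tau> j) 0 - L j)" if "j \<in> S" for j
    unfolding L_def
    by (rule someI_ex) (use params[OF that] u interference_laplace_exponent[of "\<rho> j" "\<tau> j" "\<delta> j" "A j" u] in \<open>simp add: f_def\<close>)
  let ?s = "\<Sum>j\<in>S. pi * A j * (\<rho> j)\<^sup>2 * interference_coeff (\<delta> j) (\<tau> j) 0 - L j"
  have "(\<lambda>n. \<Sum>j\<in>S. (if n = 0 then 0 else pi * A j * (\<rho> j)\<^sup>2 * interference_coeff (\<delta> j) (\<tau> j) n) * u ^ n) sums ?s"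
    using L by (intro sums_sum) auto
  moreover have "(\<lambda>n. \<Sum>j\<in>S. (if n = 0 then 0 else pi * A j * (\<rho> j)\<^sup>2 * interference_coeff (\<delta> j) (\<tau> j) n) * u ^ n)
     = (\<lambda>n. fps_nth (Abs_fps (\<lambda>n. if n = 0 then 0 else a n)) n * u ^ n)"
    by (auto simp: a_def sum_distrib_right)
  ultimately have s: "(\<lambda>n. fps_nth (Abs_fps (\<lambda>n. if n = 0 then 0 else a n)) n * u ^ n) sums ?s" by simp
  let ?E = "\<lambda>j w. exp_neg (\<integral>\<^sup>+p. ennreal (1 - u) * f j p \<partial>count_space (Psi j w))"
  have uf_meas [measurable]: "(\<lambda>C. exp_neg (\<integral>\<^sup>+p. ennreal (1 - u) * f j p \<partial>count_space C)) \<in> borel_measurable (cfg_space (marked_plane (A j)))" for j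
    by measurable
  have "(\<integral>\<^sup>+w. exp_neg (ennreal (1 - u) * (\<Sum>j\<in>S. \<integral>\<^sup>+p. f j p \<partial>count_space (Psi j w))) \<partial>Pr) = (\<integral>\<^sup>+w. (\<Prod>j\<in>S. ?E j w) \<partial>Pr)"
    by (simp add: sum_distrib_left exp_neg_sum nn_integral_cmult)
  also have "\<dots> = (\<Prod>j\<in>S. \<integral>\<^sup>+w. ?E j w \<partial>Pr)"
  proof (rule indep_vars_nn_integral)
    show "indep_vars (\<lambda>_. borel) ?E S"
      unfolding indep_vars_def2
    proof (intro conjI ballI)
      show "?E j \<in> borel_measurable Pr" if "j \<in> S" for j
        by (rule measurable_compose[OF Psi_meas[OF that] uf_meas])
      show "indep_sets (\<lambda>j. {?E j -` B \<inter> space Pr | B. B \<in> sets borel}) S"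
      proof (rule indep_sets_mono_sets[OF indep])
        fix j assume "j \<in> S"
        show "{?E j -` B \<inter> space Pr | B. B \<in> sets borel} \<subseteq> {Psi j -` C \<inter> space Pr | C. C \<in> sets (cfg_space (marked_plane (A j)))}"
        proof safe
          fix B :: "ennreal set" assume B: "B \<in> sets borel"
          \<comment> \<open>Independence is given for events of configurations; an event of the
            transformed sum is pulled back to such an event.\<close>
          let ?C = "(\<lambda>C. exp_neg (\<integral>\<^sup>+p. ennreal (1 - u) * f j p \<partial>count_space C)) -` B \<inter> space (cfg_space (marked_plane (A j)))"
          have "?C \<in> sets (cfg_space (marked_plane (A j)))" using uf_meas B by (rule measurable_sets)
          moreover have "?E j -` B \<inter> space Pr = Psi j -` ?C \<inter> space Pr"
            using measurable_space[OF Psi_meas[OF \<open>j \<in> S\<close>]] by auto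
          ultimately show "\<exists>C. ?E j -` B \<inter> space Pr = Psi j -` C \<inter> space Pr \<and> C \<in> sets (cfg_space (marked_plane (A j)))"
            by blast
        qed
      qed
    qed
  qed (use assms in auto)
  also have "\<dots> = (\<Prod>j\<in>S. ennreal (exp (- L j)))"
  proof (rule prod.cong)
    fix j assume j: "j \<in> S"
    show "(\<integral>\<^sup>+w. ?E j w \<partial>Pr) = ennreal (exp (- L j))"
      using L[OF j] ppp_laplace_functional[OF ppp[OF j] sigma_finite_marked_plane, of "\<lambda>p. ennreal (1 - u) * f j p"] by simp
  qed simp
  also have "\<dots> = ennreal (exp (?s - a 0))"
    using assms(2) by (simp add: prod_ennreal exp_sum[symmetric] a_def sum_subtractf sum_negf)
  finally show "\<exists>s. (\<lambda>n. fps_nth (Abs_fps (\<lambda>n. if n = 0 then 0 else a n)) n * u ^ n) sums s \<and>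
      (\<integral>\<^sup>+w. exp_neg (ennreal (1 - u) * (\<Sum>j\<in>S. \<integral>\<^sup>+p. f j p \<partial>count_space (Psi j w))) \<partial>Pr) = ennreal (exp (s - a 0))"
    using s by blast
qed (use assms in auto)

section \<open>Auxiliary facts on independence, integrability and the coverage event\<close>

lemma (in prob_space) indep_sets_single_sigma:
  assumes "indep_sets E I" "i \<in> I" "S \<subseteq> I - {i}" "\<And>j. j \<in> I \<Longrightarrow> Int_stable (E j)"
    and "A \<in> E i" "B \<in> sigma_sets (space M) (\<Union>j\<in>S. E j)"
  shows "prob (A \<inter> B) = prob A * prob B"
proof -
  \<comment> \<open>The family is grouped into two blocks indexed by \<open>bool\<close>; closure of
    the blocks under intersection extends independence to the generated \<sigma>-algebras.\<close>
  define J where "J b = (if b then {i} else S)" for b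
  have "indep_sets E (\<Union>b\<in>UNIV. J b)"
    using assms by (intro indep_sets_mono_index[OF _ assms(1)]) (auto simp: J_def)
  then have "indep_sets (\<lambda>b. sigma_sets (space M) (\<Union>i\<in>J b. E i)) UNIV"
    using assms by (intro indep_sets_collect_sigma) (auto simp: J_def disjoint_family_on_def split: if_splits)
  then have "prob (\<Inter>b\<in>UNIV. (if b then A else B)) = (\<Prod>b\<in>UNIV. prob (if b then A else B))"
    using assms(5,6) by (intro indep_setsD) (auto simp: J_def)
  then show ?thesis by (simp add: UNIV_bool Int_commute)
qed

text \<open>Each nonnegative summand is dominated by the whole sum, whose integral is finite because
  it equals a real. Integrability of every term follows, so the integral of the sum splits; for c =
  0 both sides are 0.\<close>

lemma nn_integral_sum_LBINT:
  fixes F :: "'i \<Rightarrow> real \<Rightarrow> real"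
  assumes "finite D" "0 \<le> c" "S \<in> sets borel" "\<And>t. t \<in> D \<Longrightarrow> F t \<in> borel_measurable borel"
    and nonneg: "\<And>t y. t \<in> D \<Longrightarrow> y \<in> S \<Longrightarrow> 0 \<le> F t y"
    and eq: "(\<integral>\<^sup>+y. ennreal (c * (\<Sum>t\<in>D. F t y)) * indicator S y \<partial>lborel) = ennreal r" and "0 \<le> r"
  shows "r = c * (\<Sum>t\<in>D. LBINT y:S. F t y)"
proof (cases "c = 0")
  case True
  then show ?thesis using eq \<open>0 \<le> r\<close> by simp
next
  case False
  then have c: "0 < c" using assms by simp
  note [measurable] = assms(3,4)
  have int: "set_integrable lborel S (F t)" if t: "t \<in> D" for t
    unfolding set_integrable_def
  proof (rule integrableI_bounded)
    have "F t \<in> borel_measurable borel" using t assms by blast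
    then show "(\<lambda>y. indicator S y *\<^sub>R F t y) \<in> borel_measurable lborel" by simp
    have "ennreal c * (\<integral>\<^sup>+y. ennreal (norm (indicator S y *\<^sub>R F t y)) \<partial>lborel) = (\<integral>\<^sup>+y. ennreal c * ennreal (norm (indicator S y *\<^sub>R F t y)) \<partial>lborel)"
      using \<open>F t \<in> borel_measurable borel\<close> by (intro nn_integral_cmult[symmetric]) simp
    also have "\<dots> \<le> (\<integral>\<^sup>+y. ennreal (c * (\<Sum>t\<in>D. F t y)) * indicator S y \<partial>lborel)"
    proof (rule nn_integral_mono)
      fix y
      show "ennreal c * ennreal (norm (indicator S y *\<^sub>R F t y)) \<le> ennreal (c * (\<Sum>t\<in>D. F t y)) * indicator S y"
      proof (cases "y \<in> S")
        case True
        then have "F t y \<le> (\<Sum>t\<in>D. F t y)" using nonneg assms(1) t by (intro member_le_sum) auto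
        then show ?thesis using True nonneg[OF t True] c by (simp flip: ennreal_mult add: ennreal_leI)
      qed simp
    qed
    also have "\<dots> < top" unfolding eq by simp
    finally have "ennreal c * (\<integral>\<^sup>+y. ennreal (norm (indicator S y *\<^sub>R F t y)) \<partial>lborel) < top" .
    then show "(\<integral>\<^sup>+y. ennreal (norm (indicator S y *\<^sub>R F t y)) \<partial>lborel) < \<infinity>"
      using c by (auto simp: ennreal_mult_less_top)
  qed
  have ind: "indicator S y *\<^sub>R (c * (\<Sum>t\<in>D. F t y)) = c * (\<Sum>t\<in>D. indicator S y *\<^sub>R F t y)" for y
    by (simp add: sum_distrib_left mult_ac)
  have "ennreal r = (\<integral>\<^sup>+y. ennreal (indicator S y *\<^sub>R (c * (\<Sum>t\<in>D. F t y))) \<partial>lborel)"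
    unfolding eq[symmetric] by (intro nn_integral_cong) (auto simp: indicator_def)
  also have "\<dots> = (\<integral>\<^sup>+y. ennreal (c * (\<Sum>t\<in>D. indicator S y *\<^sub>R F t y)) \<partial>lborel)"
    unfolding ind ..
  also have "\<dots> = ennreal (LBINT y. c * (\<Sum>t\<in>D. indicator S y *\<^sub>R F t y))"
    using int c nonneg
    by (intro nn_integral_eq_integral) (auto simp: set_integrable_def indicator_def intro!: sum_nonneg mult_nonneg_nonneg)
  also have "(LBINT y. c * (\<Sum>t\<in>D. indicator S y *\<^sub>R F t y)) = c * (\<Sum>t\<in>D. LBINT y:S. F t y)"
    using int unfolding set_integrable_def set_lebesgue_integral_def
    by (simp add: Bochner_Integration.integral_sum)
  finally have "ennreal r = ennreal (c * (\<Sum>t\<in>D. LBINT y:S. F t y))" .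
  moreover have "0 \<le> c * (\<Sum>t\<in>D. LBINT y:S. F t y)"
    using c nonneg unfolding set_lebesgue_integral_def
    by (intro mult_nonneg_nonneg sum_nonneg Bochner_Integration.integral_nonneg) (auto simp: indicator_def)
  ultimately show ?thesis using \<open>0 \<le> r\<close> by simp
qed

text \<open>With \<open>X\<close> and \<open>I\<close> frozen, coverage means that the Gamma gain
  exceeds the scaled interference plus noise, whose probability is the Erlang tail. \<open>G\<close>
  collects the randomness of \<open>X\<close> and \<open>I\<close>, of which \<open>H\<close> is
  independent.\<close>

lemma outage_complement:
  fixes I :: "'w \<Rightarrow> ennreal" and X H :: "'w \<Rightarrow> real"
  assumes "prob_space Pr" "AE w in Pr. 0 < X w"
    and H: "distributed Pr lborel H (\<lambda>x. ennreal (erlang_density (M - 1) 1 x))" "1 \<le> M"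
    and G: "sets G \<subseteq> sets Pr" "space G = space Pr"
    and [measurable]: "X \<in> borel_measurable G" "I \<in> borel_measurable G"
    and indep: "\<And>A B. A \<in> sets borel \<Longrightarrow> B \<in> sets G \<Longrightarrow>
      measure Pr ((H -` A \<inter> space Pr) \<inter> B) = measure Pr (H -` A \<inter> space Pr) * measure Pr B"
    and "0 < P" "0 < beta"
  shows "ennreal (1 - measure Pr {w \<in> space Pr. ennreal (P * H w * X w powr (- \<alpha>)) < ennreal beta * (I w + ennreal W)}) =
    (\<integral>\<^sup>+w. (\<Sum>m<M. poisson_weight m (ennreal (beta * X w powr \<alpha> / P) * (I w + ennreal W))) \<partial>Pr)"
proof -
  interpret prob_space Pr by fact
  define D where "D = {w \<in> space Pr. ennreal (P * H w * X w powr (- \<alpha>)) < ennreal beta * (I w + ennreal W)}"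
  have H_meas [measurable]: "H \<in> borel_measurable Pr" using H by (simp add: distributed_def)
  have sub: "subalgebra Pr G" using G by (simp add: subalgebra_def)
  have XI [measurable]: "X \<in> borel_measurable Pr" "I \<in> borel_measurable Pr"
    by (rule measurable_from_subalg[OF sub], simp)+
  have D_meas: "D \<in> sets Pr" unfolding D_def by measurable
  define F where "F = (\<lambda>(h, w). indicator {h. ennreal beta * (I w + ennreal W) \<le> ennreal (P * h * X w powr (- \<alpha>))} h :: ennreal)"
  have F_meas: "F \<in> borel_measurable (borel \<Otimes>\<^sub>M G)"
  proof -
    have "F = (\<lambda>z. if ennreal beta * (I (snd z) + ennreal W) \<le> ennreal (P * fst z * X (snd z) powr (- \<alpha>)) then 1 else 0)"
      by (auto simp: F_def fun_eq_iff indicator_def)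
    then show ?thesis by simp
  qed
  have "ennreal (1 - measure Pr D) = emeasure Pr (space Pr - D)"
    using prob_compl[OF D_meas] by (simp add: emeasure_eq_measure)
  also have "\<dots> = (\<integral>\<^sup>+w. indicator (space Pr - D) w \<partial>Pr)" using D_meas by simp
  also have "\<dots> = (\<integral>\<^sup>+w. F (H w, w) \<partial>Pr)"
    by (intro nn_integral_cong) (auto simp: F_def D_def indicator_def not_less)
  also have "\<dots> = (\<integral>\<^sup>+w. (\<integral>\<^sup>+h. F (h, w) \<partial>distr Pr borel H) \<partial>Pr)"
    using indep by (intro nn_integral_indep_subalgebra(2)[OF assms(1) H_meas G _ F_meas]) auto
  also have "\<dots> = (\<integral>\<^sup>+w. (\<Sum>m<M. poisson_weight m (ennreal (beta * X w powr \<alpha> / P) * (I w + ennreal W))) \<partial>Pr)"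
  proof (rule nn_integral_cong_AE, use assms(2) in eventually_elim)
    fix w assume Xw: "0 < X w"
    let ?Y = "I w + ennreal W" and ?c = "X w powr \<alpha> / P"
    have c: "0 < ?c" using Xw assms by simp
    have iff: "ennreal beta * ?Y \<le> ennreal (P * h * X w powr (- \<alpha>)) \<longleftrightarrow> ennreal (beta * X w powr \<alpha> / P) * ?Y \<le> ennreal h" for h
    proof -
      have "ennreal (beta * X w powr \<alpha> / P) = ennreal ?c * ennreal beta"
        using c assms by (simp flip: ennreal_mult add: mult.commute)
      moreover have "ennreal h = ennreal ?c * ennreal (P * h * X w powr (- \<alpha>))"
      proof -
        \<comment> \<open>The factor \<open>?c\<close> is the inverse of the received power per unit
          gain. Multiplying by it keeps the comparison valid when the interference is
          infinite.\<close>
        have "?c * (P * h * X w powr (- \<alpha>)) = h" using Xw \<open>0 < P\<close> by (simp add: powr_minus field_simps)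
        then show ?thesis using ennreal_mult'[of ?c "P * h * X w powr (- \<alpha>)"] c by simp
      qed
      ultimately have "ennreal (beta * X w powr \<alpha> / P) * ?Y \<le> ennreal h \<longleftrightarrow>
          ennreal ?c * (ennreal beta * ?Y) \<le> ennreal ?c * ennreal (P * h * X w powr (- \<alpha>))" by (simp only: mult.assoc)
      also have "\<dots> \<longleftrightarrow> ennreal beta * ?Y \<le> ennreal (P * h * X w powr (- \<alpha>))"
        using c by (intro ennreal_mult_le_mult_iff) auto
      finally show ?thesis by simp
    qed
    have "(\<integral>\<^sup>+h. F (h, w) \<partial>distr Pr borel H) = (\<integral>\<^sup>+h. indicator {h. ennreal (beta * X w powr \<alpha> / P) * ?Y \<le> ennreal h} h \<partial>distr Pr borel H)"
      by (simp add: F_def iff)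
    also have "\<dots> = emeasure (distr Pr borel H) {h. ennreal (beta * X w powr \<alpha> / P) * ?Y \<le> ennreal h}"
      by (intro nn_integral_indicator) simp
    also have "\<dots> = emeasure Pr {w' \<in> space Pr. ennreal (beta * X w powr \<alpha> / P) * ?Y \<le> ennreal (H w')}"
      by (subst emeasure_distr) (auto intro!: arg_cong[where f="emeasure Pr"])
    also have "\<dots> = (\<Sum>m<M. poisson_weight m (ennreal (beta * X w powr \<alpha> / P) * ?Y))"
      using assms(1) H by (rule erlang_tail)
    finally show "(\<integral>\<^sup>+h. F (h, w) \<partial>distr Pr borel H) = (\<Sum>m<M. poisson_weight m (ennreal (beta * X w powr \<alpha> / P) * ?Y))" .
  qed
  finally show ?thesis unfolding D_def .
qed

lemma borel_measurable_fps_power: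
  fixes G :: "'a \<Rightarrow> real fps"
  assumes [measurable]: "\<And>n. (\<lambda>y. fps_nth (G y) n) \<in> borel_measurable M"
  shows "(\<lambda>y. fps_nth (G y ^ i) n) \<in> borel_measurable M"
proof (induction i arbitrary: n)
  case (Suc i)
  note [measurable] = Suc
  show ?case by (simp add: fps_mult_nth)
qed simp

section \<open>Outage probability in the network\<close>

text \<open>Derived quantities are parameters with defining equations, mirroring the hypotheses of
  the final theorem, so that it is obtained by interpretation. The index set of the independence
  assumption holds the serving distance at 0, the signal gain at 1 and tier j at j + 1.\<close>

locale tier_network =
  fixes K k :: nat
    and lam P B alpha :: "nat \<Rightarrow> real"
    and Mn :: "nat \<Rightarrow> nat"
    and lam_u eps W beta :: real
    and Pr :: "'w measure"
    and X H :: "'w \<Rightarrow> real"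
    and Psi :: "nat \<Rightarrow> 'w \<Rightarrow> ((real \<times> real) \<times> real) set"
    and \<Omega> \<delta> R T Act \<tau> :: "nat \<Rightarrow> real"
    and fX :: "real \<Rightarrow> real"
    and rd g :: "nat \<Rightarrow> real \<Rightarrow> real"
    and \<sigma> :: real
    and Qm :: "real \<Rightarrow> real mat"
  assumes \<Omega>_eq: "\<Omega> = (\<lambda>j. P j * real (Mn j) * B j)"
    and \<delta>_eq: "\<delta> = (\<lambda>j. 2 / alpha j)"
    and R_eq: "R = (\<lambda>j. (\<Omega> j / eps) powr (1 / alpha j))"
    and T_eq: "T = (\<lambda>k. pi * lam k * (LBINT r:{0..(R k)\<^sup>2}.
                 exp (- pi * (\<Sum>j\<in>{1..K}. lam j * (\<Omega> j / \<Omega> k) powr \<delta> j * r powr (\<delta> j / \<delta> k)))))"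
    and Act_eq: "Act = (\<lambda>j. 1 - exp (- pi * lam_u * (LBINT r:{0..(R j)\<^sup>2}.
                 exp (- pi * (\<Sum>l\<in>{1..K}. lam l * (\<Omega> l / \<Omega> j) powr \<delta> l * r powr (\<delta> l / \<delta> j))))))"
    and fX_eq: "fX = (\<lambda>x. if 0 < x \<and> x \<le> R k
                 then 2 * pi * lam k / T k * x *
                      exp (- pi * (\<Sum>j\<in>{1..K}. lam j * (\<Omega> j / \<Omega> k) powr \<delta> j * x powr (2 * (\<delta> j / \<delta> k))))
                 else 0)"
    and rd_eq: "rd = (\<lambda>j x. (\<Omega> j / \<Omega> k) powr (1 / alpha j) * x powr (alpha k / alpha j))"
    and \<sigma>_eq: "\<sigma> = beta * W / P k"
    and \<tau>_eq: "\<tau> = (\<lambda>j. beta / ((real (Mn j) / real (Mn k)) * (B j / B k)))"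
    and g_eq: "g = (\<lambda>n x. \<Sum>j\<in>{1..K}. Act j * lam j * (\<Omega> j / \<Omega> k) powr \<delta> j * interference_coeff (\<delta> j) (\<tau> j) n * x powr (\<delta> j / \<delta> k))"
    and Qm_eq: "Qm = (\<lambda>x. mat (Mn k) (Mn k) (\<lambda>(p, q). if q < p then g (p - q) x else 0))"
    and k: "k \<in> {1..K}"
    and pos: "\<And>j. j \<in> {1..K} \<Longrightarrow> 0 < lam j \<and> 0 < P j \<and> 1 \<le> Mn j \<and> 0 < B j \<and> 2 < alpha j"
    and lam_u: "0 < lam_u" and eps: "0 < eps" and W: "0 \<le> W" and beta: "0 < beta"
    and prob: "prob_space Pr"
    and X: "distributed Pr lborel X (\<lambda>x. ennreal (fX x))"
    and H: "distributed Pr lborel H (\<lambda>x. ennreal (erlang_density (Mn k - 1) 1 x))"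
    and ppp: "\<And>j. j \<in> {1..K} \<Longrightarrow> poisson_point_process Pr (marked_plane (Act j * lam j)) (Psi j)"
    and indep: "prob_space.indep_sets Pr
           (\<lambda>i. if i = 0 then {X -` A \<inter> space Pr | A. A \<in> sets borel}
                else if i = 1 then {H -` A \<inter> space Pr | A. A \<in> sets borel}
                else {Psi (i - 1) -` S \<inter> space Pr | S. S \<in> sets (cfg_space (marked_plane (Act (i - 1) * lam (i - 1))))})
           {0..K + 1}"
begin

section \<open>Signs, measurability and scaling of the model quantities\<close>

sublocale prob_space Pr by (rule prob)

lemma Omega_pos: "j \<in> {1..K} \<Longrightarrow> 0 < \<Omega> j"
  using pos[of j] by (auto simp: \<Omega>_eq)

lemma delta_bounds: "j \<in> {1..K} \<Longrightarrow> 0 < \<delta> j \<and> \<delta> j < 1"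
  using pos[of j] by (auto simp: \<delta>_eq)

lemma tau_pos: "j \<in> {1..K} \<Longrightarrow> 0 < \<tau> j"
  using pos[of j] pos[OF k] beta by (auto simp: \<tau>_eq)

lemma Act_nonneg: "0 \<le> Act j"
proof -
  have "0 \<le> (LBINT r:{0..(R j)\<^sup>2}. exp (- pi * (\<Sum>l\<in>{1..K}. lam l * (\<Omega> l / \<Omega> j) powr \<delta> l * r powr (\<delta> l / \<delta> j))))"
    unfolding set_lebesgue_integral_def by (intro Bochner_Integration.integral_nonneg) (auto simp: indicator_def)
  then show ?thesis using lam_u by (simp add: Act_eq)
qed

lemma T_nonneg: "0 \<le> T k"
proof -
  have "0 \<le> (LBINT r:{0..(R k)\<^sup>2}. exp (- pi * (\<Sum>l\<in>{1..K}. lam l * (\<Omega> l / \<Omega> k) powr \<delta> l * r powr (\<delta> l / \<delta> k))))"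
    unfolding set_lebesgue_integral_def by (intro Bochner_Integration.integral_nonneg) (auto simp: indicator_def)
  then show ?thesis using pos[OF k] by (simp add: T_eq)
qed

lemma g_nonneg: "0 \<le> g n y"
  unfolding g_eq using pos delta_bounds tau_pos Act_nonneg
  by (intro sum_nonneg mult_nonneg_nonneg interference_coeff_nonneg) (auto simp: less_imp_le)

lemma Qm_power_entry:
  "n < Mn k \<Longrightarrow> (Qm y ^\<^sub>m i) $$ (n, 0) = fps_nth (Abs_fps (\<lambda>n. if n = 0 then 0 else g n y) ^ i) n"
  unfolding Qm_eq using toeplitz_power_fps[of n "Mn k" 0 "\<lambda>n. g n y" i] by simp

lemma Qm_power_nonneg: "n < Mn k \<Longrightarrow> 0 \<le> (Qm y ^\<^sub>m i) $$ (n, 0)"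
  unfolding Qm_power_entry by (rule fps_power_nonneg) (simp add: g_nonneg)

lemma measurable_g [measurable]: "g n \<in> borel_measurable borel"
  unfolding g_eq by measurable

lemma measurable_Qm_power: "n < Mn k \<Longrightarrow> (\<lambda>y. (Qm y ^\<^sub>m i) $$ (n, 0)) \<in> borel_measurable borel"
  unfolding Qm_power_entry by (rule borel_measurable_fps_power) simp

lemma rd_pos: "j \<in> {1..K} \<Longrightarrow> 0 < x \<Longrightarrow> 0 < rd j x"
  using Omega_pos[of j] Omega_pos[OF k] by (simp add: rd_eq)

text \<open>The exclusion area as a function of x^2. The right side is the factor by which each tier
  enters \<open>g\<close> at x^2.\<close>

lemma rd_square:
  assumes "j \<in> {1..K}" "0 < x"
  shows "(rd j x)\<^sup>2 = (\<Omega> j / \<Omega> k) powr \<delta> j * (x\<^sup>2) powr (\<delta> j / \<delta> k)"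
proof -
  have O: "0 < \<Omega> j / \<Omega> k" using Omega_pos[OF assms(1)] Omega_pos[OF k] by simp
  have "(rd j x)\<^sup>2 = rd j x powr 2" using rd_pos[OF assms] by simp
  also have "\<dots> = ((\<Omega> j / \<Omega> k) powr (1 / alpha j)) powr 2 * (x powr (alpha k / alpha j)) powr 2"
    using O assms(2) by (simp add: rd_eq powr_mult)
  also have "\<dots> = (\<Omega> j / \<Omega> k) powr \<delta> j * (x powr 2) powr (\<delta> j / \<delta> k)"
    using pos[OF k] by (simp add: powr_powr \<delta>_eq mult.commute)
  finally show ?thesis using assms(2) by simp
qed

text \<open>Scaling by \<beta> x^\<alpha>_k / P_k makes the gain depend on the distance only
  relative to the exclusion radius. The prefactor \<tau>_j arises from \<tau>_j \<Omega>_{j,k} =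
  \<beta> P_{j,k}.\<close>

lemma gain_identity:
  assumes "j \<in> {1..K}" "0 < x" "0 < d"
  shows "beta * x powr alpha k / P k * (P j * v * d powr (- alpha j)) = \<tau> j * (rd j x / d) powr (2 / \<delta> j) * v"
proof -
  have O: "0 < \<Omega> j / \<Omega> k" using Omega_pos[OF assms(1)] Omega_pos[OF k] by simp
  have "2 / \<delta> j = alpha j" using pos[OF assms(1)] by (simp add: \<delta>_eq)
  moreover have "(rd j x / d) powr alpha j = (\<Omega> j / \<Omega> k) * x powr alpha k * d powr (- alpha j)"
  proof -
    have "(rd j x / d) powr alpha j = rd j x powr alpha j * d powr (- alpha j)"
      using rd_pos[OF assms(1,2)] assms(3) by (simp add: powr_divide powr_minus_divide)
    also have "rd j x powr alpha j = ((\<Omega> j / \<Omega> k) powr (1 / alpha j)) powr alpha j * (x powr (alpha k / alpha j)) powr alpha j"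
      unfolding rd_eq by (rule powr_mult)
    also have "\<dots> = (\<Omega> j / \<Omega> k) * x powr alpha k"
      unfolding powr_powr using O Omega_pos[OF assms(1)] Omega_pos[OF k] pos[OF assms(1)] by simp
    finally show ?thesis .
  qed
  moreover have "\<tau> j * (\<Omega> j / \<Omega> k) = beta * P j / P k"
    using pos[OF assms(1)] pos[OF k] by (simp add: \<tau>_eq \<Omega>_eq field_simps)
  ultimately show ?thesis by (simp add: mult_ac divide_inverse)
qed

text \<open>The processes live on the whole plane, independent of \<open>X\<close>; the exclusion
  disc is imposed by the indicator. Evaluating at x = \<open>X w\<close> realises the conditional
  model given the serving distance, while a fixed x keeps the distance deterministic.\<close>

definition interference :: "real \<Rightarrow> 'w \<Rightarrow> ennreal" where
  "interference x w = (\<Sum>j\<in>{1..K}. \<integral>\<^sup>+ p. ennreal (P j * snd p * norm (fst p) powr (- alpha j))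
                   * indicator {p. rd j x < norm (fst p)} p \<partial>count_space (Psi j w))"

lemma scaled_interference:
  assumes "0 < x"
  shows "ennreal (beta * x powr alpha k / P k) * interference x w =
    (\<Sum>j\<in>{1..K}. \<integral>\<^sup>+ p. ennreal (\<tau> j * (rd j x / norm (fst p)) powr (2 / \<delta> j) * snd p)
                   * indicator {p. rd j x < norm (fst p)} p \<partial>count_space (Psi j w))"
  unfolding interference_def sum_distrib_left
proof (rule sum.cong)
  fix j assume j: "j \<in> {1..K}"
  have c: "0 \<le> beta * x powr alpha k / P k" using beta pos[OF k] by simp
  have "ennreal (beta * x powr alpha k / P k) * (\<integral>\<^sup>+ p. ennreal (P j * snd p * norm (fst p) powr (- alpha j))
                   * indicator {p. rd j x < norm (fst p)} p \<partial>count_space (Psi j w))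
      = (\<integral>\<^sup>+ p. ennreal (beta * x powr alpha k / P k) * (ennreal (P j * snd p * norm (fst p) powr (- alpha j))
                   * indicator {p. rd j x < norm (fst p)} p) \<partial>count_space (Psi j w))"
    by (intro nn_integral_cmult[symmetric]) simp
  also have "\<dots> = (\<integral>\<^sup>+ p. ennreal (\<tau> j * (rd j x / norm (fst p)) powr (2 / \<delta> j) * snd p)
                   * indicator {p. rd j x < norm (fst p)} p \<partial>count_space (Psi j w))"
  proof (rule nn_integral_cong)
    fix p :: "(real \<times> real) \<times> real"
    show "ennreal (beta * x powr alpha k / P k) * (ennreal (P j * snd p * norm (fst p) powr (- alpha j))
                   * indicator {p. rd j x < norm (fst p)} p) = ennreal (\<tau> j * (rd j x / norm (fst p)) powr (2 / \<delta> j) * snd p)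
                   * indicator {p. rd j x < norm (fst p)} p"
    proof (cases "rd j x < norm (fst p)")
      case True
      then have "0 < norm (fst p)" using rd_pos[OF j assms] by linarith
      from gain_identity[OF j assms this, of "snd p"] show ?thesis
        using ennreal_mult'[OF c, of "P j * snd p * norm (fst p) powr (- alpha j)"] True by simp
    qed simp
  qed
  finally show "ennreal (beta * x powr alpha k / P k) * (\<integral>\<^sup>+ p. ennreal (P j * snd p * norm (fst p) powr (- alpha j))
                   * indicator {p. rd j x < norm (fst p)} p \<partial>count_space (Psi j w)) =
    (\<integral>\<^sup>+ p. ennreal (\<tau> j * (rd j x / norm (fst p)) powr (2 / \<delta> j) * snd p)
                   * indicator {p. rd j x < norm (fst p)} p \<partial>count_space (Psi j w))" .
qed simp

definition observables :: "nat \<Rightarrow> 'w set set" where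
  "observables i = (if i = 0 then {X -` A \<inter> space Pr | A. A \<in> sets borel}
     else if i = 1 then {H -` A \<inter> space Pr | A. A \<in> sets borel}
     else {Psi (i - 1) -` S \<inter> space Pr | S. S \<in> sets (cfg_space (marked_plane (Act (i - 1) * lam (i - 1))))})"

lemma indep_observables: "indep_sets observables {0..K + 1}"
  using indep unfolding observables_def[abs_def] .

lemma indep_sets_Psi:
  "indep_sets (\<lambda>j. {Psi j -` S \<inter> space Pr | S. S \<in> sets (cfg_space (marked_plane (Act j * lam j)))}) {1..K}"
  unfolding indep_sets_def
proof (intro conjI ballI allI impI)
  let ?F = "\<lambda>j. {Psi j -` S \<inter> space Pr | S. S \<in> sets (cfg_space (marked_plane (Act j * lam j)))}"
  have EF: "observables (Suc j) = ?F j" if "j \<in> {1..K}" for j using that by (auto simp: observables_def)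
  show "?F j \<subseteq> events" if "j \<in> {1..K}" for j
  proof -
    have "\<forall>i\<in>{0..K + 1}. observables i \<subseteq> events" using indep_observables unfolding indep_sets_def by (rule conjunct1)
    then have "observables (Suc j) \<subseteq> events" by (rule bspec) (use that in auto)
    then show ?thesis unfolding EF[OF that] .
  qed
  fix J A assume J: "J \<subseteq> {1..K}" "J \<noteq> {}" "finite J" and A: "A \<in> Pi J ?F"
  have "prob (\<Inter>i\<in>Suc ` J. A (i - 1)) = (\<Prod>i\<in>Suc ` J. prob (A (i - 1)))"
  proof (rule indep_setsD[OF indep_observables])
    show "\<forall>i\<in>Suc ` J. A (i - 1) \<in> observables i"
    proof
      fix i assume "i \<in> Suc ` J"
      then obtain j where j: "i = Suc j" "j \<in> J" by auto
      then have "A j \<in> ?F j" using A by (auto simp: Pi_iff)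
      then show "A (i - 1) \<in> observables i" using EF[of j] j J by auto
    qed
  qed (use J in auto)
  then show "prob (\<Inter>j\<in>J. A j) = (\<Prod>j\<in>J. prob (A j))" by (simp add: prod.reindex)
qed

lemma expectation_poisson_weight_interference:
  assumes "0 < x" "n < Mn k"
  shows "(\<integral>\<^sup>+w. poisson_weight n (ennreal (beta * x powr alpha k / P k) * interference x w) \<partial>Pr) =
    ennreal (exp (- pi * g 0 (x\<^sup>2)) * (\<Sum>i<Mn k. pi ^ i / fact i * (Qm (x\<^sup>2) ^\<^sub>m i) $$ (n, 0)))"
proof -
  define a where "a n = (\<Sum>j\<in>{1..K}. pi * (Act j * lam j) * (rd j x)\<^sup>2 * interference_coeff (\<delta> j) (\<tau> j) n)" for n
  have a: "a n = pi * g n (x\<^sup>2)" for n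
    unfolding a_def g_eq sum_distrib_left using assms(1) by (intro sum.cong) (auto simp: rd_square)
  define G where "G = Abs_fps (\<lambda>n. if n = 0 then 0 else g n (x\<^sup>2))"
  have aG: "Abs_fps (\<lambda>n. if n = 0 then 0 else a n) = fps_const pi * G"
    by (auto simp: fps_eq_iff G_def a)
  have nth: "fps_nth ((fps_const pi * G) ^ i) n = pi ^ i * (Qm (x\<^sup>2) ^\<^sub>m i) $$ (n, 0)" for i
    using toeplitz_power_fps[of n "Mn k" 0 "\<lambda>n. g n (x\<^sup>2)" i, folded G_def] assms(2)
    by (simp add: power_mult_distrib Qm_eq fps_const_power)
  \<comment> \<open>Powers beyond n have no coefficient of order n, so the range can be made
    independent of n, matching the sum over i < M_k in the statement.\<close>
  have "(\<Sum>i\<le>n. fps_nth ((fps_const pi * G) ^ i) n / fact i) = (\<Sum>i<Mn k. fps_nth ((fps_const pi * G) ^ i) n / fact i)"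
  proof (rule sum.mono_neutral_left)
    have "fps_nth (fps_const pi * G) 0 = 0" by (simp add: G_def)
    from startsby_zero_power_prefix[OF this]
    show "\<forall>i\<in>{..<Mn k} - {..n}. fps_nth ((fps_const pi * G) ^ i) n / fact i = 0" by auto
  qed (use assms in auto)
  then have sum_eq: "(\<Sum>i\<le>n. fps_nth ((fps_const pi * G) ^ i) n / fact i) = (\<Sum>i<Mn k. pi ^ i / fact i * (Qm (x\<^sup>2) ^\<^sub>m i) $$ (n, 0))"
    by (simp add: nth)
  have "(\<integral>\<^sup>+w. poisson_weight n (\<Sum>j\<in>{1..K}. \<integral>\<^sup>+ p. ennreal (\<tau> j * (rd j x / norm (fst p)) powr (2 / \<delta> j) * snd p)
                   * indicator {p. rd j x < norm (fst p)} p \<partial>count_space (Psi j w)) \<partial>Pr) =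
    ennreal (exp (- a 0) * (\<Sum>i\<le>n. fps_nth (Abs_fps (\<lambda>n. if n = 0 then 0 else a n) ^ i) n / fact i))"
    unfolding a_def
    using rd_pos[OF _ assms(1)] tau_pos delta_bounds pos Act_nonneg ppp indep_sets_Psi prob
    by (intro poisson_weight_interference) (auto simp: less_imp_le)
  then show ?thesis
    unfolding scaled_interference[OF assms(1)] aG sum_eq by (simp add: a)
qed

lemma expectation_erlang_tail_interference:
  assumes "0 < x"
  shows "(\<integral>\<^sup>+w. (\<Sum>m<Mn k. poisson_weight m (ennreal (beta * x powr alpha k / P k) * (interference x w + ennreal W))) \<partial>Pr) =
    ennreal (\<Sum>i<Mn k. \<Sum>m<Mn k. \<Sum>n\<le>m. pi ^ i * \<sigma> ^ (m - n) / (fact (m - n) * fact i) * (x\<^sup>2) powr (alpha k / 2 * real (m - n))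
              * exp (- \<sigma> * (x\<^sup>2) powr (alpha k / 2) - pi * g 0 (x\<^sup>2)) * (Qm (x\<^sup>2) ^\<^sub>m i) $$ (n, 0))"
proof -
  let ?s = "beta * x powr alpha k / P k" and ?y = "x\<^sup>2"
  have s: "0 \<le> ?s" using beta pos[OF k] by simp
  have y: "?y powr (alpha k / 2) = x powr alpha k"
  proof -
    have "?y = x powr 2" using assms by simp
    then show ?thesis by (simp only: powr_powr) simp
  qed
  have \<sigma>: "0 \<le> \<sigma>" using beta W pos[OF k] by (simp add: \<sigma>_eq)
  have sW: "?s * W = \<sigma> * ?y powr (alpha k / 2)" unfolding y \<sigma>_eq by simp
  have sW0: "0 \<le> \<sigma> * ?y powr (alpha k / 2)" using \<sigma> by simp
  have [measurable]: "interference x \<in> borel_measurable Pr"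
    unfolding interference_def[abs_def]
  proof (rule borel_measurable_sum)
    fix j assume j: "j \<in> {1..K}"
    have "(\<lambda>p. ennreal (P j * snd p * norm (fst p) powr (- alpha j)) * indicator {p. rd j x < norm (fst p)} p)
        \<in> borel_measurable (marked_plane (Act j * lam j))" by measurable
    from measurable_compose[OF measurable_ppp[OF ppp[OF j]] measurable_nn_integral_cfg[OF this]]
    show "(\<lambda>w. \<integral>\<^sup>+ p. ennreal (P j * snd p * norm (fst p) powr (- alpha j))
                   * indicator {p. rd j x < norm (fst p)} p \<partial>count_space (Psi j w)) \<in> borel_measurable Pr" .
  qed
  \<comment> \<open>\<open>q\<close> is the Poisson weight of the scaled noise and \<open>r\<close>
    the expected weight of the scaled interference; their convolution is the weight of the
    total.\<close>
  define q where "q l = (\<sigma> * ?y powr (alpha k / 2)) ^ l / fact l * exp (- (\<sigma> * ?y powr (alpha k / 2)))" for l :: nat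
  define r where "r n = exp (- pi * g 0 ?y) * (\<Sum>i<Mn k. pi ^ i / fact i * (Qm ?y ^\<^sub>m i) $$ (n, 0))" for n
  have q0: "0 \<le> q l" for l unfolding q_def using \<sigma> by (intro mult_nonneg_nonneg divide_nonneg_nonneg zero_le_power) auto
  have r0: "0 \<le> r n" if "n < Mn k" for n
    unfolding r_def using Qm_power_nonneg[OF that] by (intro mult_nonneg_nonneg sum_nonneg) auto
  have "(\<integral>\<^sup>+w. (\<Sum>m<Mn k. poisson_weight m (ennreal ?s * (interference x w + ennreal W))) \<partial>Pr)
     = (\<Sum>m<Mn k. \<integral>\<^sup>+w. poisson_weight m (ennreal ?s * (interference x w + ennreal W)) \<partial>Pr)"
    by (intro nn_integral_sum) simp
  also have "\<dots> = (\<Sum>m<Mn k. \<Sum>n\<le>m. ennreal (q (m - n) * r n))"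
  proof (rule sum.cong)
    fix m assume m: "m \<in> {..<Mn k}"
    have "ennreal ?s * (interference x w + ennreal W) = ennreal ?s * interference x w + ennreal (\<sigma> * ?y powr (alpha k / 2))" for w
      unfolding sW[symmetric] using s by (simp only: distrib_left ennreal_mult')
    then have "(\<integral>\<^sup>+w. poisson_weight m (ennreal ?s * (interference x w + ennreal W)) \<partial>Pr)
      = (\<integral>\<^sup>+w. (\<Sum>n\<le>m. ennreal (q (m - n)) * poisson_weight n (ennreal ?s * interference x w)) \<partial>Pr)"
      using sW0 by (simp add: poisson_weight_add q_def)
    also have "\<dots> = (\<Sum>n\<le>m. ennreal (q (m - n)) * (\<integral>\<^sup>+w. poisson_weight n (ennreal ?s * interference x w) \<partial>Pr))"
      by (subst nn_integral_sum) (simp_all add: nn_integral_cmult)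
    also have "\<dots> = (\<Sum>n\<le>m. ennreal (q (m - n) * r n))"
      using m expectation_poisson_weight_interference[OF assms] q0 by (intro sum.cong) (auto simp: r_def ennreal_mult')
    finally show "(\<integral>\<^sup>+w. poisson_weight m (ennreal ?s * (interference x w + ennreal W)) \<partial>Pr) = (\<Sum>n\<le>m. ennreal (q (m - n) * r n))" .
  qed simp
  also have "\<dots> = (\<Sum>m<Mn k. ennreal (\<Sum>n\<le>m. q (m - n) * r n))"
    using q0 r0 by (intro sum.cong sum_ennreal mult_nonneg_nonneg) auto
  also have "\<dots> = ennreal (\<Sum>m<Mn k. \<Sum>n\<le>m. q (m - n) * r n)"
    using q0 r0 by (intro sum_ennreal sum_nonneg mult_nonneg_nonneg) auto
  also have "(\<Sum>m<Mn k. \<Sum>n\<le>m. q (m - n) * r n) = (\<Sum>m<Mn k. \<Sum>n\<le>m. \<Sum>i<Mn k.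
      pi ^ i * \<sigma> ^ (m - n) / (fact (m - n) * fact i) * ?y powr (alpha k / 2 * real (m - n))
              * exp (- \<sigma> * ?y powr (alpha k / 2) - pi * g 0 ?y) * (Qm ?y ^\<^sub>m i) $$ (n, 0))"
  proof (intro sum.cong refl)
    fix m n
    have "(?y powr (alpha k / 2)) ^ (m - n) = ?y powr (alpha k / 2 * real (m - n))"
      using assms powr_realpow[of "?y powr (alpha k / 2)" "m - n"] by (simp add: powr_powr)
    then have "q (m - n) = \<sigma> ^ (m - n) * ?y powr (alpha k / 2 * real (m - n)) / fact (m - n) * exp (- \<sigma> * ?y powr (alpha k / 2))"
      unfolding q_def power_mult_distrib by simp
    moreover have "exp (- \<sigma> * ?y powr (alpha k / 2) - pi * g 0 ?y) = exp (- \<sigma> * ?y powr (alpha k / 2)) * exp (- pi * g 0 ?y)"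
      by (simp flip: exp_add)
    ultimately show "q (m - n) * r n = (\<Sum>i<Mn k. pi ^ i * \<sigma> ^ (m - n) / (fact (m - n) * fact i) * ?y powr (alpha k / 2 * real (m - n))
              * exp (- \<sigma> * ?y powr (alpha k / 2) - pi * g 0 ?y) * (Qm ?y ^\<^sub>m i) $$ (n, 0))"
      by (simp add: r_def sum_distrib_left sum_divide_distrib mult_ac)
  qed
  also have "\<dots> = (\<Sum>i<Mn k. \<Sum>m<Mn k. \<Sum>n\<le>m. pi ^ i * \<sigma> ^ (m - n) / (fact (m - n) * fact i) * ?y powr (alpha k / 2 * real (m - n))
              * exp (- \<sigma> * ?y powr (alpha k / 2) - pi * g 0 ?y) * (Qm ?y ^\<^sub>m i) $$ (n, 0))"
    by (subst sum.swap, rule sum.cong, simp, subst sum.swap[of _ _ "{..<Mn k}"]) simp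
  finally show ?thesis .
qed

section \<open>Sub-\<sigma>-algebras generated by selected components of the model\<close>

lemma Int_stable_observables: "Int_stable (observables i)"
proof -
  have *: "Int_stable {f -` A \<inter> space Pr | A. A \<in> sets N}" for f :: "'w \<Rightarrow> 'c" and N
  proof (rule Int_stableI)
    fix a b assume "a \<in> {f -` A \<inter> space Pr | A. A \<in> sets N}" "b \<in> {f -` A \<inter> space Pr | A. A \<in> sets N}"
    then obtain A B where "a = f -` A \<inter> space Pr" "b = f -` B \<inter> space Pr" "A \<in> sets N" "B \<in> sets N" by auto
    then show "a \<inter> b \<in> {f -` A \<inter> space Pr | A. A \<in> sets N}"
      by (intro CollectI exI[of _ "A \<inter> B"]) auto
  qed
  show ?thesis unfolding observables_def by (simp add: *)
qed

lemma observables_events: "i \<in> {0..K + 1} \<Longrightarrow> observables i \<subseteq> events"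
  using indep_observables unfolding indep_sets_def by blast

text \<open>Serves as the sub-\<sigma>-algebra in the independence lemmas. Omitting index 1 isolates
  the signal gain; omitting 0 and 1 leaves the interfering tiers alone.\<close>

definition observed :: "nat set \<Rightarrow> 'w measure" where
  "observed S = sigma (space Pr) (\<Union>i\<in>S. observables i)"

context
  fixes S assumes S: "S \<subseteq> {0..K + 1}"
begin

lemma space_observed: "space (observed S) = space Pr"
  and sets_observed: "sets (observed S) = sigma_sets (space Pr) (\<Union>i\<in>S. observables i)"
proof -
  have "(\<Union>i\<in>S. observables i) \<subseteq> Pow (space Pr)"
    using observables_events S sets.sets_into_space by blast
  then show "space (observed S) = space Pr" "sets (observed S) = sigma_sets (space Pr) (\<Union>i\<in>S. observables i)"
    by (simp_all add: observed_def space_measure_of sets_measure_of)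
qed

lemma observables_sets_observed: "i \<in> S \<Longrightarrow> observables i \<subseteq> sets (observed S)"
  unfolding sets_observed by (auto intro: sigma_sets.Basic)

lemma sets_observed_events: "sets (observed S) \<subseteq> events"
  unfolding sets_observed using observables_events S by (intro sets.sigma_sets_subset) blast

lemma measurable_X_observed:
  assumes "0 \<in> S"
  shows "X \<in> borel_measurable (observed S)"
proof (rule measurableI)
  fix A :: "real set" assume "A \<in> sets borel"
  then have "X -` A \<inter> space Pr \<in> observables 0" by (auto simp: observables_def)
  then show "X -` A \<inter> space (observed S) \<in> sets (observed S)"
    using observables_sets_observed[OF assms] by (auto simp: space_observed)
qed simp

lemma measurable_Psi_observed:
  assumes "Suc j \<in> S" "j \<in> {1..K}"
  shows "Psi j \<in> measurable (observed S) (cfg_space (marked_plane (Act j * lam j)))"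
proof (rule measurableI)
  fix A assume "A \<in> sets (cfg_space (marked_plane (Act j * lam j)))"
  then have "Psi j -` A \<inter> space Pr \<in> observables (Suc j)" using assms(2) by (auto simp: observables_def)
  then show "Psi j -` A \<inter> space (observed S) \<in> sets (observed S)"
    using observables_sets_observed[OF assms(1)] by (auto simp: space_observed)
qed simp

text \<open>Joint measurability in distance and outcome is what permits the random value
  \<open>X w\<close> to be substituted for the distance. It follows by feeding the radius and the
  configuration into \<open>measurable_cfg_shot_noise\<close>.\<close>

lemma measurable_interference_observed:
  assumes "{2..K + 1} \<subseteq> S"
  shows "(\<lambda>z. interference (fst z) (snd z)) \<in> borel_measurable (borel \<Otimes>\<^sub>M observed S)"
  unfolding interference_def
proof (rule borel_measurable_sum)
  fix j assume j: "j \<in> {1..K}"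
  have [measurable]: "Psi j \<in> measurable (observed S) (cfg_space (marked_plane (Act j * lam j)))"
    using assms j by (intro measurable_Psi_observed) auto
  have [measurable]: "rd j \<in> borel_measurable borel" unfolding rd_eq by measurable
  have "(\<lambda>(r, C). \<integral>\<^sup>+ p. ennreal (P j * snd p * norm (fst p) powr (- alpha j)) * indicator {p. r < norm (fst p)} p \<partial>count_space C)
      \<in> borel_measurable (borel \<Otimes>\<^sub>M cfg_space (marked_plane (Act j * lam j)))"
    by (rule measurable_cfg_shot_noise) measurable
  note shot = this
  have "(\<lambda>z. (rd j (fst z), Psi j (snd z))) \<in> measurable (borel \<Otimes>\<^sub>M observed S) (borel \<Otimes>\<^sub>M cfg_space (marked_plane (Act j * lam j)))"
    by measurable
  from measurable_compose[OF this shot]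
  show "(\<lambda>z. \<integral>\<^sup>+ p. ennreal (P j * snd p * norm (fst p) powr (- alpha j)) * indicator {p. rd j (fst z) < norm (fst p)} p \<partial>count_space (Psi j (snd z)))
      \<in> borel_measurable (borel \<Otimes>\<^sub>M observed S)"
    by simp
qed

lemma prob_observable_inter_observed:
  assumes "i \<in> {0..K + 1}" "i \<notin> S" "A \<in> observables i" "B' \<in> sets (observed S)"
  shows "prob (A \<inter> B') = prob A * prob B'"
  using assms S Int_stable_observables unfolding sets_observed
  by (intro indep_sets_single_sigma[OF indep_observables, of i S]) auto

end

section \<open>Averaging over the serving distance\<close>

lemma AE_X_pos: "AE w in Pr. 0 < X w"
proof -
  have "emeasure Pr (X -` {..0} \<inter> space Pr) = (\<integral>\<^sup>+x. ennreal (fX x) * indicator {..0} x \<partial>lborel)"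
    using X by (rule distributed_emeasure) simp
  also have "\<dots> = 0"
    by (subst nn_integral_0_iff_AE) (auto simp: fX_eq indicator_def)
  finally show ?thesis
    using distributed_measurable[OF X] by (intro AE_I[of _ _ "X -` {..0} \<inter> space Pr"]) (auto simp: not_less)
qed

definition coverage_term :: "nat \<Rightarrow> nat \<Rightarrow> nat \<Rightarrow> real \<Rightarrow> real" where
  "coverage_term i m n x = pi ^ (i + 1) * \<sigma> ^ (m - n) / (fact (m - n) * fact i) * x powr (alpha k / 2 * real (m - n))
              * exp (- \<sigma> * x powr (alpha k / 2) - pi * g 0 x
                     - pi * (\<Sum>j\<in>{1..K}. lam j * (\<Omega> j / \<Omega> k) powr \<delta> j * x powr (\<delta> j / \<delta> k)))
              * (Qm x ^\<^sub>m i) $$ (n, 0)"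

lemma sigma_nonneg: "0 \<le> \<sigma>"
  using beta W pos[OF k] by (simp add: \<sigma>_eq)

lemma coverage_term_nonneg: "n < Mn k \<Longrightarrow> 0 \<le> coverage_term i m n x"
  unfolding coverage_term_def using sigma_nonneg Qm_power_nonneg[of n x i]
  by (intro mult_nonneg_nonneg divide_nonneg_nonneg) auto

lemma measurable_coverage_term: "n < Mn k \<Longrightarrow> coverage_term i m n \<in> borel_measurable borel"
  unfolding coverage_term_def[abs_def] using measurable_Qm_power[of n i] by measurable

lemma coverage_probability_nn_integral:
  "ennreal (1 - prob {w \<in> space Pr.
      ennreal (P k * H w * X w powr (- alpha k)) < ennreal beta * (interference (X w) w + ennreal W)}) =
   (\<integral>\<^sup>+y. ennreal (lam k / T k * (\<Sum>i<Mn k. \<Sum>m<Mn k. \<Sum>n\<le>m. coverage_term i m n y)) * indicator {0..(R k)\<^sup>2} y \<partial>lborel)"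
proof -
  let ?S1 = "{0} \<union> {2..K + 1}" and ?S2 = "{2..K + 1}"
  have S1: "?S1 \<subseteq> {0..K + 1}" and S2: "?S2 \<subseteq> {0..K + 1}" by auto
  have X_meas: "X \<in> borel_measurable Pr" using distributed_measurable[OF X] by simp
  define F where "F = (\<lambda>z. \<Sum>m<Mn k. poisson_weight m (ennreal (beta * fst z powr alpha k / P k) * (interference (fst z) (snd z) + ennreal W)))"
  have F_meas: "F \<in> borel_measurable (borel \<Otimes>\<^sub>M observed ?S2)"
    unfolding F_def using measurable_interference_observed[OF S2] by measurable
  have "F \<in> borel_measurable (borel \<Otimes>\<^sub>M Pr)"
  proof -
    have "(\<lambda>w. w) \<in> measurable Pr (observed ?S2)"
      using sets_observed_events[OF S2] space_observed[OF S2]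
      by (intro measurableI) (auto simp: Int_absorb2 dest: sets.sets_into_space)
    then have "(\<lambda>z. (fst z, snd z)) \<in> measurable (borel \<Otimes>\<^sub>M Pr) (borel \<Otimes>\<^sub>M observed ?S2)" by measurable
    from measurable_compose[OF this F_meas] show ?thesis by simp
  qed
  then have EF_meas: "(\<lambda>x. \<integral>\<^sup>+w. F (x, w) \<partial>Pr) \<in> borel_measurable borel"
    by (rule borel_measurable_nn_integral_fst)
  have "ennreal (1 - prob {w \<in> space Pr. ennreal (P k * H w * X w powr (- alpha k)) < ennreal beta * (interference (X w) w + ennreal W)})
     = (\<integral>\<^sup>+w. (\<Sum>m<Mn k. poisson_weight m (ennreal (beta * X w powr alpha k / P k) * (interference (X w) w + ennreal W))) \<partial>Pr)"
  proof (rule outage_complement[OF prob AE_X_pos H _ sets_observed_events[OF S1] space_observed[OF S1]])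
    show "X \<in> borel_measurable (observed ?S1)" by (rule measurable_X_observed[OF S1]) simp
    \<comment> \<open>\<open>?S1\<close> contains index 0, so the interference at the random
      distance stays within a \<sigma>-algebra that is independent of \<open>H\<close>.\<close>
    then have "(\<lambda>w. (X w, w)) \<in> measurable (observed ?S1) (borel \<Otimes>\<^sub>M observed ?S1)" by measurable
    from measurable_compose[OF this measurable_interference_observed[OF S1]]
    show "(\<lambda>w. interference (X w) w) \<in> borel_measurable (observed ?S1)" by auto
    show "prob ((H -` A \<inter> space Pr) \<inter> B') = prob (H -` A \<inter> space Pr) * prob B'" if "A \<in> sets borel" "B' \<in> sets (observed ?S1)" for A B'
      using that by (intro prob_observable_inter_observed[OF S1, of 1]) (auto simp: observables_def)
  qed (use pos[OF k] beta in auto)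
  also have "\<dots> = (\<integral>\<^sup>+w. F (X w, w) \<partial>Pr)" by (simp add: F_def)
  also have "\<dots> = (\<integral>\<^sup>+x. (\<integral>\<^sup>+w. F (x, w) \<partial>Pr) \<partial>distr Pr borel X)"
  proof (rule nn_integral_indep_subalgebra(1)[OF prob X_meas sets_observed_events[OF S2] space_observed[OF S2] _ F_meas])
    show "prob ((X -` A \<inter> space Pr) \<inter> B') = prob (X -` A \<inter> space Pr) * prob B'" if "A \<in> sets borel" "B' \<in> sets (observed ?S2)" for A B'
      using that by (intro prob_observable_inter_observed[OF S2, of 0]) (auto simp: observables_def)
  qed
  also have "\<dots> = (\<integral>\<^sup>+w. (\<integral>\<^sup>+w'. F (X w, w') \<partial>Pr) \<partial>Pr)"
    using EF_meas X_meas by (subst nn_integral_distr) auto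
  also have "\<dots> = (\<integral>\<^sup>+x. ennreal (fX x) * (\<integral>\<^sup>+w. F (x, w) \<partial>Pr) \<partial>lborel)"
    using EF_meas by (intro distributed_nn_integral[OF X, symmetric]) simp
  \<comment> \<open>The factor 2x of the density is split off as the Jacobian of y = x^2. Its \<pi>
    raises \<pi>^i to \<pi>^(i+1) inside \<open>coverage_term\<close>, and its exponential supplies
    the association term there.\<close>
  also have "\<dots> = (\<integral>\<^sup>+x. ennreal (lam k / T k * (\<Sum>i<Mn k. \<Sum>m<Mn k. \<Sum>n\<le>m. coverage_term i m n (x\<^sup>2))) * ennreal (2 * x) * indicator {0..R k} x \<partial>lborel)"
  proof (rule nn_integral_cong)
    fix x :: real
    show "ennreal (fX x) * (\<integral>\<^sup>+w. F (x, w) \<partial>Pr) =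
      ennreal (lam k / T k * (\<Sum>i<Mn k. \<Sum>m<Mn k. \<Sum>n\<le>m. coverage_term i m n (x\<^sup>2))) * ennreal (2 * x) * indicator {0..R k} x"
    proof (cases "0 < x \<and> x \<le> R k")
      case True
      define t where "t i m n = pi ^ i * \<sigma> ^ (m - n) / (fact (m - n) * fact i) * (x\<^sup>2) powr (alpha k / 2 * real (m - n))
              * exp (- \<sigma> * (x\<^sup>2) powr (alpha k / 2) - pi * g 0 (x\<^sup>2)) * (Qm (x\<^sup>2) ^\<^sub>m i) $$ (n, 0)" for i m n
      define e where "e = exp (- pi * (\<Sum>j\<in>{1..K}. lam j * (\<Omega> j / \<Omega> k) powr \<delta> j * (x\<^sup>2) powr (\<delta> j / \<delta> k)))"
      have x2: "(x\<^sup>2) powr q = x powr (2 * q)" for q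
      proof -
        have "x\<^sup>2 = x powr 2" using True by simp
        then show ?thesis by (simp only: powr_powr)
      qed
      have fX: "fX x = 2 * pi * lam k / T k * x * e" using True by (simp add: fX_eq e_def x2)
      have ct: "coverage_term i m n (x\<^sup>2) = pi * e * t i m n" for i m n
      proof -
        have "exp (- \<sigma> * (x\<^sup>2) powr (alpha k / 2) - pi * g 0 (x\<^sup>2)
                     - pi * (\<Sum>j\<in>{1..K}. lam j * (\<Omega> j / \<Omega> k) powr \<delta> j * (x\<^sup>2) powr (\<delta> j / \<delta> k)))
            = exp (- \<sigma> * (x\<^sup>2) powr (alpha k / 2) - pi * g 0 (x\<^sup>2)) * e"
          unfolding e_def by (simp flip: exp_add)
        then show ?thesis unfolding coverage_term_def t_def by (simp only:) (simp add: mult_ac)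
      qed
      have "(\<integral>\<^sup>+w. F (x, w) \<partial>Pr) = ennreal (\<Sum>i<Mn k. \<Sum>m<Mn k. \<Sum>n\<le>m. t i m n)"
        unfolding F_def t_def using expectation_erlang_tail_interference[of x] True by simp
      then have "ennreal (fX x) * (\<integral>\<^sup>+w. F (x, w) \<partial>Pr) = ennreal (fX x * (\<Sum>i<Mn k. \<Sum>m<Mn k. \<Sum>n\<le>m. t i m n))"
        using True T_nonneg pos[OF k] by (subst ennreal_mult') (auto simp: fX e_def)
      also have "fX x * (\<Sum>i<Mn k. \<Sum>m<Mn k. \<Sum>n\<le>m. t i m n) =
          (lam k / T k * (\<Sum>i<Mn k. \<Sum>m<Mn k. \<Sum>n\<le>m. coverage_term i m n (x\<^sup>2))) * (2 * x)"
        unfolding ct sum_distrib_left[symmetric] fX by simp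
      also have "ennreal \<dots> = ennreal (lam k / T k * (\<Sum>i<Mn k. \<Sum>m<Mn k. \<Sum>n\<le>m. coverage_term i m n (x\<^sup>2))) * ennreal (2 * x)"
        using True by (intro ennreal_mult'') simp
      finally show ?thesis using True by simp
    qed (auto simp: fX_eq indicator_def)
  qed
  also have "\<dots> = (\<integral>\<^sup>+y. ennreal (lam k / T k * (\<Sum>i<Mn k. \<Sum>m<Mn k. \<Sum>n\<le>m. coverage_term i m n y)) * indicator {0..(R k)\<^sup>2} y \<partial>lborel)"
  proof -
    have "0 < R k" using Omega_pos[OF k] eps by (simp add: R_eq)
    then have "(\<integral>\<^sup>+y. ennreal (lam k / T k * (\<Sum>i<Mn k. \<Sum>m<Mn k. \<Sum>n\<le>m. coverage_term i m n y)) * indicator {0\<^sup>2..(R k)\<^sup>2} y \<partial>lborel)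
      = (\<integral>\<^sup>+x. ennreal (lam k / T k * (\<Sum>i<Mn k. \<Sum>m<Mn k. \<Sum>n\<le>m. coverage_term i m n (x\<^sup>2))) * ennreal (2 * x) * indicator {0..R k} x \<partial>lborel)"
      using measurable_coverage_term
      by (intro nn_integral_substitution_aux[where g="\<lambda>x. x\<^sup>2"])
        (auto intro!: derivative_eq_intros continuous_intros borel_measurable_sum borel_measurable_times measurable_compose[OF _ measurable_ennreal])
    then show ?thesis by simp
  qed
  finally show ?thesis .
qed

theorem outage_probability:
  "prob {w \<in> space Pr.
      ennreal (P k * H w * X w powr (- alpha k)) < ennreal beta * (interference (X w) w + ennreal W)} =
   1 - lam k / T k * (\<Sum>i<Mn k. \<Sum>m<Mn k. \<Sum>n\<le>m. LBINT x:{0..(R k)\<^sup>2}. coverage_term i m n x)"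
proof -
  \<comment> \<open>Flattening the triple sum allows all terms to be split off at once. Membership
    in \<open>D\<close> records n \<le> m < M_k, which makes (n, 0) a valid matrix index and the
    term nonnegative.\<close>
  define D where "D = {..<Mn k} \<times> (SIGMA m:{..<Mn k}. {..m})"
  have flat: "(\<Sum>i<Mn k. \<Sum>m<Mn k. \<Sum>n\<le>m. f i m n) = (\<Sum>t\<in>D. case t of (i, m, n) \<Rightarrow> f i m n)" for f :: "nat \<Rightarrow> nat \<Rightarrow> nat \<Rightarrow> real"
    unfolding D_def by (simp add: sum.Sigma split_beta flip: sum.cartesian_product)
  have "1 - prob {w \<in> space Pr. ennreal (P k * H w * X w powr (- alpha k)) < ennreal beta * (interference (X w) w + ennreal W)}
    = lam k / T k * (\<Sum>t\<in>D. LBINT x:{0..(R k)\<^sup>2}. (case t of (i, m, n) \<Rightarrow> coverage_term i m n x))"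
  proof (rule nn_integral_sum_LBINT)
    show "finite D" by (auto simp: D_def)
    show "0 \<le> lam k / T k" using pos[OF k] T_nonneg by simp
    show "(\<lambda>x. case t of (i, m, n) \<Rightarrow> coverage_term i m n x) \<in> borel_measurable borel" if "t \<in> D" for t
      using that measurable_coverage_term by (auto simp: D_def)
    show "0 \<le> (case t of (i, m, n) \<Rightarrow> coverage_term i m n x)" if "t \<in> D" for t x
      using that coverage_term_nonneg by (auto simp: D_def)
    show "(\<integral>\<^sup>+y. ennreal (lam k / T k * (\<Sum>t\<in>D. case t of (i, m, n) \<Rightarrow> coverage_term i m n y)) * indicator {0..(R k)\<^sup>2} y \<partial>lborel) =
      ennreal (1 - prob {w \<in> space Pr. ennreal (P k * H w * X w powr (- alpha k)) < ennreal beta * (interference (X w) w + ennreal W)})"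
      unfolding coverage_probability_nn_integral flat ..
  qed auto
  also have "(\<Sum>t\<in>D. LBINT x:{0..(R k)\<^sup>2}. (case t of (i, m, n) \<Rightarrow> coverage_term i m n x)) =
     (\<Sum>i<Mn k. \<Sum>m<Mn k. \<Sum>n\<le>m. LBINT x:{0..(R k)\<^sup>2}. coverage_term i m n x)"
    unfolding flat by (intro sum.cong) auto
  finally show ?thesis by simp
qed

end

text \<open>SINR < \<beta> is written as signal < \<beta> times (interference + noise) in
  \<open>ennreal\<close>, which is meaningful also for infinite interference and for a vanishing
  denominator. Matrix indices start at 0, so the entry (n + 1, 1) appears as (n, 0).\<close>

theorem theorem1:
  fixes K k :: nat
    and lam P B alpha :: "nat \<Rightarrow> real"
    and Mn :: "nat \<Rightarrow> nat"
    and lam_u eps W beta :: real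
    and Pr :: "'w measure"
    and X H :: "'w \<Rightarrow> real"
    and Psi :: "nat \<Rightarrow> 'w \<Rightarrow> ((real \<times> real) \<times> real) set"
    and \<Omega> \<delta> R T Act \<tau> \<theta> :: "nat \<Rightarrow> real"
    and fX :: "real \<Rightarrow> real"
    and Nint :: "nat \<Rightarrow> ((real \<times> real) \<times> real) measure"
    and rd g :: "nat \<Rightarrow> real \<Rightarrow> real"
    and Iint :: "'w \<Rightarrow> ennreal"
    and Out \<sigma> \<Lambda> Z :: real
    and \<phi> :: "nat \<Rightarrow> nat \<Rightarrow> real"
    and Qm :: "real \<Rightarrow> real mat"
    and \<Theta> :: "real mat"
    and Qint :: "nat \<Rightarrow> nat \<Rightarrow> nat \<Rightarrow> real"
  assumes "\<Omega> = (\<lambda>j. P j * real (Mn j) * B j)"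
    and "\<delta> = (\<lambda>j. 2 / alpha j)"
    and "R = (\<lambda>j. (\<Omega> j / eps) powr (1 / alpha j))"
    and "T = (\<lambda>k. pi * lam k * (LBINT r:{0..(R k)\<^sup>2}.
                 exp (- pi * (\<Sum>j\<in>{1..K}. lam j * (\<Omega> j / \<Omega> k) powr \<delta> j * r powr (\<delta> j / \<delta> k)))))"
    and "Act = (\<lambda>j. 1 - exp (- pi * lam_u * (LBINT r:{0..(R j)\<^sup>2}.
                 exp (- pi * (\<Sum>l\<in>{1..K}. lam l * (\<Omega> l / \<Omega> j) powr \<delta> l * r powr (\<delta> l / \<delta> j))))))"
    and "fX = (\<lambda>x. if 0 < x \<and> x \<le> R k
                 then 2 * pi * lam k / T k * x *
                      exp (- pi * (\<Sum>j\<in>{1..K}. lam j * (\<Omega> j / \<Omega> k) powr \<delta> j * x powr (2 * (\<delta> j / \<delta> k))))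
                 else 0)"
    and "Nint = (\<lambda>j. density lborel (\<lambda>_. ennreal (Act j * lam j))
                   \<Otimes>\<^sub>M density lborel (\<lambda>v. ennreal (exponential_density 1 v)))"
    and "rd = (\<lambda>j x. (\<Omega> j / \<Omega> k) powr (1 / alpha j) * x powr (alpha k / alpha j))"
    and "Iint = (\<lambda>w. \<Sum>j\<in>{1..K}. \<integral>\<^sup>+ p. ennreal (P j * snd p * norm (fst p) powr (- alpha j))
                   * indicator {p. rd j (X w) < norm (fst p)} p \<partial>count_space (Psi j w))"
    and "Out = (measure Pr {w \<in> space Pr.
                 ennreal (P k * H w * X w powr (- alpha k)) < ennreal beta * (Iint w + ennreal W)})"
    and "\<sigma> = (beta * W / P k)"
    and "\<tau> = (\<lambda>j. beta / ((real (Mn j) / real (Mn k)) * (B j / B k)))"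
    and "\<phi> = (\<lambda>j (n::nat). if n = 0
                 then \<delta> j * \<tau> j * hyp2f1 1 (1 - \<delta> j) (2 - \<delta> j) (- \<tau> j) / (1 - \<delta> j)
                 else \<delta> j * \<tau> j ^ n * hyp2f1 (real n + 1) (real n - \<delta> j) (real n + 1 - \<delta> j) (- \<tau> j)
                      / (real n - \<delta> j))"
    and "g = (\<lambda>(n::nat) x. \<Sum>j\<in>{1..K}. Act j * lam j * (\<Omega> j / \<Omega> k) powr \<delta> j * \<phi> j n * x powr (\<delta> j / \<delta> k))"
    and "Qm = (\<lambda>x. mat (Mn k) (Mn k) (\<lambda>(p, q). if q < p then g (p - q) x else 0))"
    and "\<Lambda> = (\<Sum>j\<in>{1..K}. lam j * \<Omega> j powr \<delta> k)"
    and "\<theta> = (\<lambda>n. \<Sum>j\<in>{1..K}. Act j * lam j * (\<Omega> j / \<Omega> k) powr \<delta> k * \<phi> j n)"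
    and "\<Theta> = (mat (Mn k) (Mn k) (\<lambda>(p, q). if q < p then \<theta> (p - q) else 0))"
    and "Z = (\<theta> 0 + \<Lambda> / \<Omega> k powr \<delta> k)"
    and "Qint = (\<lambda>(i::nat) (m::nat) (n::nat). LBINT x:{0..(R k)\<^sup>2}.
                 x powr (real i + alpha k / 2 * real (m - n)) * exp (- \<sigma> * x powr (alpha k / 2) - pi * Z * x))"
    and "1 \<le> K" and "k \<in> {1..K}"
    and "\<forall>j\<in>{1..K}. 0 < lam j \<and> 0 < P j \<and> 1 \<le> Mn j \<and> 0 < B j \<and> 2 < alpha j"
    and "0 < lam_u" and "0 < eps" and "0 \<le> W" and "0 < beta"
    and "prob_space Pr"
    and "distributed Pr lborel X (\<lambda>x. ennreal (fX x))"
    and "distributed Pr lborel H (\<lambda>x. ennreal (erlang_density (Mn k - 1) 1 x))"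
    and "\<forall>j\<in>{1..K}. poisson_point_process Pr (Nint j) (Psi j)"
    and "prob_space.indep_sets Pr
           (\<lambda>i. if i = 0 then {X -` A \<inter> space Pr | A. A \<in> sets borel}
                else if i = 1 then {H -` A \<inter> space Pr | A. A \<in> sets borel}
                else {Psi (i - 1) -` S \<inter> space Pr | S. S \<in> sets (cfg_space (Nint (i - 1)))})
           {0..K + 1}"
  shows "Out = 1 - lam k / T k *
           (\<Sum>i<Mn k. \<Sum>m<Mn k. \<Sum>n\<le>m. LBINT x:{0..(R k)\<^sup>2}.
              pi ^ (i + 1) * \<sigma> ^ (m - n) / (fact (m - n) * fact i) * x powr (alpha k / 2 * real (m - n))
              * exp (- \<sigma> * x powr (alpha k / 2) - pi * g 0 x
                     - pi * (\<Sum>j\<in>{1..K}. lam j * (\<Omega> j / \<Omega> k) powr \<delta> j * x powr (\<delta> j / \<delta> k)))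
              * (Qm x ^\<^sub>m i) $$ (n, 0))
         \<and> ((\<forall>j\<in>{1..K}. alpha j = alpha k) \<longrightarrow>
            Out = 1 - lam k / T k *
              (\<Sum>i<Mn k. \<Sum>m<Mn k. \<Sum>n\<le>m.
                 pi ^ (i + 1) * \<sigma> ^ (m - n) * Qint i m n / (fact i * fact (m - n)) * (\<Theta> ^\<^sub>m i) $$ (n, 0)))"
proof -
  let ?F = "\<lambda>i m n x. pi ^ (i + 1) * \<sigma> ^ (m - n) / (fact (m - n) * fact i) * x powr (alpha k / 2 * real (m - n))
              * exp (- \<sigma> * x powr (alpha k / 2) - pi * g 0 x
                     - pi * (\<Sum>j\<in>{1..K}. lam j * (\<Omega> j / \<Omega> k) powr \<delta> j * x powr (\<delta> j / \<delta> k)))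
              * (Qm x ^\<^sub>m i) $$ (n, 0)"
  have \<phi>: "\<phi> = (\<lambda>j. interference_coeff (\<delta> j) (\<tau> j))"
    unfolding assms(13) by (intro ext) (simp add: interference_coeff_def)
  have Nint: "Nint = (\<lambda>j. marked_plane (Act j * lam j))"
    unfolding assms(7) marked_plane_def ..
  interpret tier_network K k lam P B alpha Mn lam_u eps W beta Pr X H Psi \<Omega> \<delta> R T Act \<tau> fX rd g \<sigma> Qm
    by (rule tier_network.intro)
      (use assms(1-6,8,11,12) assms(14)[unfolded \<phi>] assms(15,22-30) assms(31,32)[unfolded Nint] in blast)+
  have Iint: "Iint = (\<lambda>w. interference (X w) w)"
    unfolding assms(9) interference_def ..
  have Out: "Out = 1 - lam k / T k * (\<Sum>i<Mn k. \<Sum>m<Mn k. \<Sum>n\<le>m. LBINT x:{0..(R k)\<^sup>2}. ?F i m n x)"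
    unfolding assms(10) Iint outage_probability coverage_term_def ..
  moreover have "Out = 1 - lam k / T k * (\<Sum>i<Mn k. \<Sum>m<Mn k. \<Sum>n\<le>m.
      pi ^ (i + 1) * \<sigma> ^ (m - n) * Qint i m n / (fact i * fact (m - n)) * (\<Theta> ^\<^sub>m i) $$ (n, 0))"
    if alpha: "\<forall>j\<in>{1..K}. alpha j = alpha k"
  proof -
    have \<delta>1: "\<delta> j = \<delta> k" if "j \<in> {1..K}" for j
      using alpha that by (auto simp: \<delta>_eq)
    \<comment> \<open>Equal path-loss exponents make every exponent \<delta>_{j,k} equal to 1, so
      \<open>g\<close> becomes linear in x.\<close>
    have g_lin: "g n x = x * \<theta> n" if "0 \<le> x" for n x
    proof -
      have "g n x = (\<Sum>j\<in>{1..K}. x * (Act j * lam j * (\<Omega> j / \<Omega> k) powr \<delta> k * \<phi> j n))"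
        unfolding g_eq \<phi>
      proof (rule sum.cong)
        fix j assume j: "j \<in> {1..K}"
        show "Act j * lam j * (\<Omega> j / \<Omega> k) powr \<delta> j * interference_coeff (\<delta> j) (\<tau> j) n * x powr (\<delta> j / \<delta> k) =
          x * (Act j * lam j * (\<Omega> j / \<Omega> k) powr \<delta> k * interference_coeff (\<delta> j) (\<tau> j) n)"
          using \<delta>1[OF j] delta_bounds[OF k] that by simp
      qed simp
      then show ?thesis unfolding assms(17) by (simp only: sum_distrib_left)
    qed
    have assoc_lin: "(\<Sum>j\<in>{1..K}. lam j * (\<Omega> j / \<Omega> k) powr \<delta> j * x powr (\<delta> j / \<delta> k)) = x * (\<Lambda> / \<Omega> k powr \<delta> k)" if "0 \<le> x" for x
      unfolding assms(16) sum_divide_distrib sum_distrib_left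
    proof (rule sum.cong)
      fix j assume j: "j \<in> {1..K}"
      show "lam j * (\<Omega> j / \<Omega> k) powr \<delta> j * x powr (\<delta> j / \<delta> k) = x * (lam j * \<Omega> j powr \<delta> k / \<Omega> k powr \<delta> k)"
        using \<delta>1[OF j] delta_bounds[OF k] that Omega_pos[OF j] Omega_pos[OF k] by (simp add: powr_divide)
    qed simp
    have Q: "(Qm x ^\<^sub>m i) $$ (n, 0) = x ^ i * (\<Theta> ^\<^sub>m i) $$ (n, 0)" if "0 \<le> x" "n < Mn k" for i n x
    proof -
      \<comment> \<open>Scaling the symbol of the Toeplitz matrix by x scales its i-th power by x^i;
        this is the power of x appearing in \<open>Qint\<close>.\<close>
      have "Abs_fps (\<lambda>n. if n = 0 then 0 else g n x) = fps_const x * Abs_fps (\<lambda>n. if n = 0 then 0 else \<theta> n)"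
        using g_lin[OF that(1)] by (auto simp: fps_eq_iff)
      then show ?thesis
        unfolding Qm_power_entry[OF that(2)] assms(18) using toeplitz_power_fps[of n "Mn k" 0 \<theta> i] that(2)
        by (simp add: power_mult_distrib fps_const_power)
    qed
    have int_eq: "(LBINT x:{0..(R k)\<^sup>2}. ?F i m n x) =
        pi ^ (i + 1) * \<sigma> ^ (m - n) * Qint i m n / (fact i * fact (m - n)) * (\<Theta> ^\<^sub>m i) $$ (n, 0)"
      if n: "n < Mn k" for i m n
    proof -
      have "(LBINT x:{0..(R k)\<^sup>2}. ?F i m n x) = (LBINT x:{0..(R k)\<^sup>2}.
          (pi ^ (i + 1) * \<sigma> ^ (m - n) / (fact i * fact (m - n)) * (\<Theta> ^\<^sub>m i) $$ (n, 0)) *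
          (x powr (real i + alpha k / 2 * real (m - n)) * exp (- \<sigma> * x powr (alpha k / 2) - pi * Z * x)))"
      proof (rule set_lebesgue_integral_cong)
        show "\<forall>x. x \<in> {0..(R k)\<^sup>2} \<longrightarrow> ?F i m n x =
          (pi ^ (i + 1) * \<sigma> ^ (m - n) / (fact i * fact (m - n)) * (\<Theta> ^\<^sub>m i) $$ (n, 0)) *
          (x powr (real i + alpha k / 2 * real (m - n)) * exp (- \<sigma> * x powr (alpha k / 2) - pi * Z * x))"
        proof (intro allI impI)
          fix x assume "x \<in> {0..(R k)\<^sup>2}"
          then have x: "0 \<le> x" by simp
          have "- \<sigma> * x powr (alpha k / 2) - pi * g 0 x
                - pi * (\<Sum>j\<in>{1..K}. lam j * (\<Omega> j / \<Omega> k) powr \<delta> j * x powr (\<delta> j / \<delta> k))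
              = - \<sigma> * x powr (alpha k / 2) - pi * Z * x"
            unfolding g_lin[OF x] assoc_lin[OF x] assms(19) by (simp add: algebra_simps)
          \<comment> \<open>At x = 0 both sides are 0, because \<open>0 powr a\<close> is 0 for
            every exponent a, including a = 0. The convention affects a single point and hence no
            integral.\<close>
          moreover have "x powr (alpha k / 2 * real (m - n)) * x ^ i = x powr (real i + alpha k / 2 * real (m - n))"
            using x by (cases "x = 0") (auto simp: powr_add powr_realpow)
          ultimately show "?F i m n x =
            (pi ^ (i + 1) * \<sigma> ^ (m - n) / (fact i * fact (m - n)) * (\<Theta> ^\<^sub>m i) $$ (n, 0)) *
            (x powr (real i + alpha k / 2 * real (m - n)) * exp (- \<sigma> * x powr (alpha k / 2) - pi * Z * x))"
            unfolding Q[OF x n] by (simp only:) (simp add: mult_ac)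
        qed
      qed simp
      also have "\<dots> = pi ^ (i + 1) * \<sigma> ^ (m - n) * Qint i m n / (fact i * fact (m - n)) * (\<Theta> ^\<^sub>m i) $$ (n, 0)"
        unfolding assms(20) by (subst set_integral_mult_right) simp
      finally show ?thesis .
    qed
    have "(\<Sum>i<Mn k. \<Sum>m<Mn k. \<Sum>n\<le>m. LBINT x:{0..(R k)\<^sup>2}. ?F i m n x) =
       (\<Sum>i<Mn k. \<Sum>m<Mn k. \<Sum>n\<le>m. pi ^ (i + 1) * \<sigma> ^ (m - n) * Qint i m n / (fact i * fact (m - n)) * (\<Theta> ^\<^sub>m i) $$ (n, 0))"
      by (intro sum.cong refl int_eq) auto
    then show ?thesis unfolding Out by (simp only:)
  qed
  ultimately show ?thesis by blast
qed

end
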